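(* Let $X=V(f)\subset\mathbb P^5$ be a cubic hypersurface with vanishing hessian which is not a cone, and let $Z^*\subset\mathbb P^5$ be the dual variety of its polar image $Z$. Then: (i) $X$ is a Special Perazzo Cubic Hypersurface such that $Z^*$ is a conic, so that $X$ is a scroll in $\mathbb P^2$ tangent to the conic $Z^*$; (ii) $X$ is projectively equivalent to $V(x_0x_4^2+2x_1x_4x_5+x_2x_5^2+D(x_3,x_4,x_5))\subset\mathbb P^5$ with $D(x_3,x_4,x_5)$ a cubic form.
   Context: The ground field $\mathbb K$ is algebraically closed of characteristic zero; hypersurfaces $X=V(f)\subset\mathbb P^N$ are reduced. $X$ has vanishing hessian if $\det\left[\frac{\partial^2f}{\partial x_i\partial x_j}\right]\equiv0$. $X$ is a cone if there is $p\in X$ with $\langle p,q\rangle\subset X$ for all $q\in X$, $q\ne p$. The polar map is $\Phi_X:\mathbb P^N\dashrightarrow(\mathbb P^N)^*$, $p\mapsto(\frac{\partial f}{\partial x_0}(p):\dots:\frac{\partial f}{\partial x_N}(p))$, and the polar image is $Z=\overline{\Phi_X(\mathbb P^N)}$; it is a proper subvariety of $(\mathbb P^N)^*$ when $X$ has vanishing hessian. For a linear space $\Lambda\subset(\mathbb P^N)^*$, $\Lambda^*\subset\mathbb P^N$ is the linear space of points corresponding to hyperplanes of $(\mathbb P^N)^*$ containing $\Lambda$. $T_zZ$ is the projective tangent space at a smooth point $z$, $Z_{\rm reg}$ is the smooth locus, and $Z^*=\overline{\bigcup_{z\in Z_{\rm reg}}(T_zZ)^*}\subset\mathbb P^N$.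 The Perazzo map is $\mathcal P_X:\mathbb P^N\dashrightarrow\mathbb G(\operatorname{codim}(Z)-1,N)$, $p\mapsto(T_{\Phi_X(p)}Z)^*$, with $\mu$ the dimension of (the closure of) its image. For cubics the closure of a general fiber of $\mathcal P_X$ is a linear space of dimension $N-\mu$. A Special Perazzo Cubic Hypersurface is an irreducible cubic hypersurface with vanishing hessian, not a cone, such that the closures of the general fibers of $\mathcal P_X$ all contain one fixed linear space of dimension $N-\mu-1$. $X$ is a scroll in $\mathbb P^k$ tangent to $Z^*$ means: there is an irreducible family of $k$-dimensional linear spaces contained in $X$ such that through a general point of $X$ there passes exactly one member of the family, and this member contains the projective tangent space to $Z^*$ at some smooth point of $Z^*$. *)

theory Defs
  imports
    "HOL-Analysis.Determinants"
    "HOL-Library.Poly_Mapping"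
    "HOL-Library.Numeral_Type"
    "HOL-Computational_Algebra.Polynomial"
    "HOL-Computational_Algebra.Squarefree"
begin

text \<open>
  Conventions. The projective space with homogeneous coordinates indexed by the finite type
  \<open>'n\<close> (so \<open>N + 1 = CARD('n)\<close>) and its dual are both modelled on \<open>'a ^ 'n\<close>. A point is given by
  any of its nonzero coordinate vectors, and a subset of the projective space by the set of
  all nonzero coordinate vectors of its points. A linear subspace of projective
  dimension \<open>k\<close> is given by the corresponding vector subspace of dimension \<open>k + 1\<close>, zero vector
  included.
\<close>

subsection \<open>Polynomials\<close>

type_synonym ('a, 'n) mpoly = "('n \<Rightarrow>\<^sub>0 nat) \<Rightarrow>\<^sub>0 'a"

definition Var :: "'n \<Rightarrow> ('a::comm_ring_1, 'n) mpoly" where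
  "Var i = Poly_Mapping.single (Poly_Mapping.single i 1) 1"

definition peval :: "('a::comm_ring_1, 'n::finite) mpoly \<Rightarrow> 'a ^ 'n \<Rightarrow> 'a" where
  "peval g x = (\<Sum>m\<in>Poly_Mapping.keys g.
     Poly_Mapping.lookup g m * (\<Prod>i\<in>UNIV. (x $ i) ^ Poly_Mapping.lookup m i))"

definition partial :: "'n \<Rightarrow> ('a::comm_ring_1, 'n) mpoly \<Rightarrow> ('a, 'n) mpoly" where
  "partial i g = (\<Sum>m\<in>Poly_Mapping.keys g.
     Poly_Mapping.single (m - Poly_Mapping.single i 1)
       (of_nat (Poly_Mapping.lookup m i) * Poly_Mapping.lookup g m))"

definition form :: "nat \<Rightarrow> ('a::comm_ring_1, 'n::finite) mpoly \<Rightarrow> bool" where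
  "form d g \<longleftrightarrow> (\<forall>m\<in>Poly_Mapping.keys g. (\<Sum>i\<in>UNIV. Poly_Mapping.lookup m i) = d)"

definition homogeneous :: "('a::comm_ring_1, 'n::finite) mpoly \<Rightarrow> bool" where
  "homogeneous g \<longleftrightarrow> (\<exists>d. form d g)"

definition grad :: "('a::comm_ring_1, 'n::finite) mpoly \<Rightarrow> 'a ^ 'n \<Rightarrow> 'a ^ 'n" where
  "grad g x = (\<chi> i. peval (partial i g) x)"

definition hessian :: "('a::comm_ring_1, 'n::finite) mpoly \<Rightarrow> ('a, 'n) mpoly ^ 'n ^ 'n" where
  "hessian g = (\<chi> i j. partial i (partial j g))"

definition vanishing_hessian :: "('a::comm_ring_1, 'n::finite) mpoly \<Rightarrow> bool" where
  "vanishing_hessian g \<longleftrightarrow> det (hessian g) = 0"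

subsection \<open>Zariski topology of projective space\<close>

definition hypersurface :: "('a::field, 'n::finite) mpoly \<Rightarrow> ('a ^ 'n) set" where
  "hypersurface g = {x. x \<noteq> 0 \<and> peval g x = 0}"

definition zariski_closed :: "('a::field ^ 'n::finite) set \<Rightarrow> bool" where
  "zariski_closed A \<longleftrightarrow>
     (\<exists>G. (\<forall>g\<in>G. homogeneous g) \<and> A = {x. x \<noteq> 0 \<and> (\<forall>g\<in>G. peval g x = 0)})"

definition zariski_closure :: "('a::field ^ 'n::finite) set \<Rightarrow> ('a ^ 'n) set" where
  "zariski_closure S = \<Inter>{A. zariski_closed A \<and> S - {0} \<subseteq> A}"

definition zariski_irreducible :: "('a::field ^ 'n::finite) set \<Rightarrow> bool" where
  "zariski_irreducible S \<longleftrightarrow> S \<noteq> {} \<and>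
     (\<forall>A B. zariski_closed A \<and> zariski_closed B \<and> S \<subseteq> A \<union> B \<longrightarrow> S \<subseteq> A \<or> S \<subseteq> B)"

text \<open>Krull dimension of a nonempty closed set. The lengths \<open>n\<close> are bounded by
  \<open>CARD('n) - 1\<close>, so the supremum is a maximum.\<close>

definition proj_dim :: "('a::field ^ 'n::finite) set \<Rightarrow> nat" where
  "proj_dim S = Sup {n. \<exists>C :: nat \<Rightarrow> ('a ^ 'n) set.
     (\<forall>i\<le>n. zariski_closed (C i) \<and> zariski_irreducible (C i) \<and> C i \<subseteq> S) \<and>
     (\<forall>i<n. C i \<subset> C (Suc i))}"

text \<open>\<open>P\<close> holds at a general point of \<open>S\<close>, that is, on a dense relatively open subset.\<close>

definition generically :: "('a::field ^ 'n::finite) set \<Rightarrow> ('a ^ 'n \<Rightarrow> bool) \<Rightarrow> bool" where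
  "generically S P \<longleftrightarrow>
     (\<exists>A. zariski_closed A \<and> S \<subseteq> zariski_closure (S - A) \<and> (\<forall>x\<in>S - A. P x))"

definition is_cone :: "('a::field ^ 'n::finite) set \<Rightarrow> bool" where
  "is_cone X \<longleftrightarrow> (\<exists>p\<in>X. \<forall>q\<in>X. q \<notin> vec.span {p} \<longrightarrow> vec.span {p, q} - {0} \<subseteq> X)"

definition proj_equivalent :: "('a::field ^ 'n::finite) set \<Rightarrow> ('a ^ 'n) set \<Rightarrow> bool" where
  "proj_equivalent X Y \<longleftrightarrow> (\<exists>A :: 'a ^ 'n ^ 'n. invertible A \<and> (\<lambda>x. A *v x) ` X = Y)"

subsection \<open>Tangent spaces and duality\<close>

definition tangent_space :: "('a::field ^ 'n::finite) set \<Rightarrow> 'a ^ 'n \<Rightarrow> ('a ^ 'n) set" where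
  "tangent_space Z z = {v. \<forall>g. homogeneous g \<and> (\<forall>x\<in>Z. peval g x = 0) \<longrightarrow>
     (\<Sum>i\<in>UNIV. grad g z $ i * v $ i) = 0}"

text \<open>For irreducible closed \<open>Z\<close>, whose local dimension is \<open>proj_dim Z\<close> everywhere.\<close>

definition smooth_locus :: "('a::field ^ 'n::finite) set \<Rightarrow> ('a ^ 'n) set" where
  "smooth_locus Z = {z\<in>Z. vec.dim (tangent_space Z z) = proj_dim Z + 1}"

definition dual_space :: "('a::field ^ 'n::finite) set \<Rightarrow> ('a ^ 'n) set" where
  "dual_space L = {p. \<forall>v\<in>L. (\<Sum>i\<in>UNIV. v $ i * p $ i) = 0}"

definition dual_variety :: "('a::field ^ 'n::finite) set \<Rightarrow> ('a ^ 'n) set" where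
  "dual_variety Z =
     zariski_closure (\<Union>z\<in>smooth_locus Z. dual_space (tangent_space Z z) - {0})"

definition polar_image :: "('a::field, 'n::finite) mpoly \<Rightarrow> ('a ^ 'n) set" where
  "polar_image f = zariski_closure {y. y \<noteq> 0 \<and> (\<exists>p. p \<noteq> 0 \<and> y = grad f p)}"

subsection \<open>Grassmannians\<close>

text \<open>
  The Pluecker coordinates of a \<open>k\<close>-dimensional vector subspace are the maximal minors of any
  of its bases; they are indexed by the \<open>k\<close>-element subsets of \<open>'n\<close> and padded with zeros
  to a vector indexed by all subsets, so that the index type does not depend on \<open>k\<close>.
  For \<open>k \<ge> 1\<close>, letting the basis vary yields all coordinate vectors of the Pluecker point.
\<close>

definition pluecker_vector :: "('a::field ^ 'n::{finite,linorder}) list \<Rightarrow> 'a ^ ('n set)" where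
  "pluecker_vector bs = (\<chi> S. if card S = length bs
     then (\<Sum>\<pi> | \<pi> permutes {..<length bs}. of_int (sign \<pi>) *
             (\<Prod>i<length bs. (bs ! i) $ (sorted_list_of_set S ! \<pi> i)))
     else 0)"

definition pluecker ::
    "('a::field ^ 'n::{finite,linorder}) set \<Rightarrow> ('a ^ ('n set)) set" where
  "pluecker W = {pluecker_vector bs | bs.
     distinct bs \<and> vec.independent (set bs) \<and> vec.span (set bs) = W}"

subsection \<open>The Perazzo map\<close>

text \<open>The Perazzo map on the open set where its defining formula makes sense.\<close>

definition perazzo_domain :: "('a::field, 'n::finite) mpoly \<Rightarrow> ('a ^ 'n) set" where
  "perazzo_domain f = {p. p \<noteq> 0 \<and> grad f p \<in> smooth_locus (polar_image f)}"

definition perazzo_map :: "('a::field, 'n::finite) mpoly \<Rightarrow> 'a ^ 'n \<Rightarrow> ('a ^ 'n) set" where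
  "perazzo_map f p = dual_space (tangent_space (polar_image f) (grad f p))"

definition perazzo_fiber :: "('a::field, 'n::finite) mpoly \<Rightarrow> 'a ^ 'n \<Rightarrow> ('a ^ 'n) set" where
  "perazzo_fiber f p = {q\<in>perazzo_domain f. perazzo_map f q = perazzo_map f p}"

definition perazzo_rank :: "('a::field, 'n::{finite,linorder}) mpoly \<Rightarrow> nat" where
  "perazzo_rank f =
     proj_dim (zariski_closure (\<Union>p\<in>perazzo_domain f. pluecker (perazzo_map f p)))"

text \<open>With \<open>\<mu> = perazzo_rank f\<close> and \<open>N = CARD('n) - 1\<close>, the dimension condition on \<open>L\<close> says that
  its projective dimension is \<open>N - \<mu> - 1\<close>.\<close>

definition special_perazzo_cubic :: "('a::field, 'n::{finite,linorder}) mpoly \<Rightarrow> bool" where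
  "special_perazzo_cubic f \<longleftrightarrow>
     form 3 f \<and> irreducible f \<and> vanishing_hessian f \<and> \<not> is_cone (hypersurface f) \<and>
     (\<exists>L. vec.subspace L \<and> vec.dim L + perazzo_rank f + 1 = CARD('n) \<and>
        generically (UNIV - {0}) (\<lambda>p. p \<in> perazzo_domain f \<and>
          L - {0} \<subseteq> zariski_closure (perazzo_fiber f p)))"

subsection \<open>Conics and scrolls\<close>

text \<open>An irreducible curve of degree two in the plane spanned by the rows of \<open>b\<close>.\<close>

definition is_conic :: "('a::field ^ 'n::finite) set \<Rightarrow> bool" where
  "is_conic C \<longleftrightarrow> (\<exists>(b :: 'a ^ 'n ^ 3) (q :: ('a, 3) mpoly).
     inj (\<lambda>t. t v* b) \<and> form 2 q \<and> irreducible q \<and> C = (\<lambda>t. t v* b) ` hypersurface q)"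

text \<open>\<open>F\<close> is an irreducible closed subvariety of the Grassmannian of \<open>k\<close>-dimensional linear
  subspaces of the projective space.\<close>

definition irreducible_family :: "nat \<Rightarrow> ('a::field ^ 'n::{finite,linorder}) set set \<Rightarrow> bool" where
  "irreducible_family k F \<longleftrightarrow>
     (\<forall>L\<in>F. vec.subspace L \<and> vec.dim L = k + 1) \<and>
     zariski_closed (\<Union>L\<in>F. pluecker L) \<and> zariski_irreducible (\<Union>L\<in>F. pluecker L)"

definition tangent_scroll ::
    "nat \<Rightarrow> ('a::field ^ 'n::{finite,linorder}) set \<Rightarrow>
     ('a ^ 'n::{finite,linorder}) set \<Rightarrow> bool" where
  "tangent_scroll k X W \<longleftrightarrow> (\<exists>F. irreducible_family k F \<and> (\<forall>L\<in>F. L - {0} \<subseteq> X) \<and>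
     generically X (\<lambda>x. (\<exists>!L. L \<in> F \<and> x \<in> L) \<and>
       (\<forall>L\<in>F. x \<in> L \<longrightarrow> (\<exists>z\<in>smooth_locus W. tangent_space W z \<subseteq> L))))"

end

theory Submission imports Defs
begin

text \<open>Let \<open>F\<close> be the polarisation of \<open>f\<close> and \<open>H x = F x\<close>, a singular symmetric matrix for every \<open>x\<close>.
  At a general \<open>x\<close> the kernel of \<open>H x\<close> deforms polynomially with \<open>x\<close>. Differentiating this family shows
  that \<open>F k k' = 0\<close> for all kernel vectors \<open>k, k'\<close>, that the span \<open>U\<close> of all of them has dimension at
  most 3, and that each \<open>H k\<close> has rank at most one, so \<open>F k y z = l y * l z\<close> for a linear form \<open>l\<close>.
  Since \<open>X\<close> is not a cone, there are three independent \<open>k\<^sub>i\<close> whose linear forms \<open>l\<^sub>i\<close> span a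
  plane; coordinates adapted to them bring \<open>f\<close> into the normal form of (ii). The geometric statements
  are then explicit: the polar image is the cone \<open>\<eta>\<^sub>1\<^sup>2 = 4 \<eta>\<^sub>0 \<eta>\<^sub>2\<close>, its dual is the conic of points
  \<open>(t\<^sup>2, - s t, s\<^sup>2, 0, 0, 0)\<close>, the Perazzo map sends \<open>p\<close> to the conic point with parameter
  \<open>(p\<^sub>4, p\<^sub>5)\<close>, and the planes of the scroll are spanned by a point of \<open>X\<close> and a tangent line
  of the conic.\<close>

section \<open>Polynomial functions\<close>

text \<open>Arguments at a general point run along polynomial curves in one parameter: an identity
  valid off finitely many parameters holds for all, and its derivative at 0 is the first-order
  information. The dimension six enters through small counts. For a kernel vector k at x, the kernel
  of \<open>H k\<close> contains a space that \<open>H x\<close> maps over the image of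
  \<open>H k\<close> while losing k; this leaves rank at most 2. If U had dimension four or more, a
  complement would have at most two dimensions and each u would be determined by a binary quadratic
  form, which has three coefficients. Rank 2 of \<open>H k\<close> would make the image of
  \<open>H k\<close> fill the image of U under \<open>H x\<close>, and then \<open>F k x x\<close>
  would vanish for all x, as only a cone allows. On the geometric side the obstacle is closure. The
  scroll has to be a closed family, while the planes through general points are an image of K^3 that
  need not be closed. The closure is taken, and equations inherited by it show that every limit is
  again a plane inside X. It also has to be shown that the part of X in x4 = x5 = 0 consists of
  limits of other points of X.\<close>

lemma mpoly_induct [case_names single add]:
  fixes p :: "('a::comm_ring_1, 'n) mpoly"
  assumes "\<And>m c. P (Poly_Mapping.single m c)"
    and "\<And>p q. P p \<Longrightarrow> P q \<Longrightarrow> P (p + q)"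
  shows "P p"
proof -
  have "p = (\<Sum>m\<in>Poly_Mapping.keys p. Poly_Mapping.single m (Poly_Mapping.lookup p m))"
    by (rule poly_mapping_eqI) (simp add: lookup_sum lookup_single when_def in_keys_iff)
  moreover have "P (\<Sum>m\<in>S. Poly_Mapping.single m (Poly_Mapping.lookup p m))" if "finite S" for S
    using that
  proof (induction S rule: finite_induct)
    case empty
    show ?case using assms(1)[of 0 0] by simp
  qed (simp add: assms)
  ultimately show ?thesis
    by (metis finite_keys)
qed

lemma sum_keys_add:
  fixes p q :: "('a::comm_ring_1, 'n) mpoly"
  assumes "\<And>m. h m 0 = 0" and "\<And>m a b. h m (a + b) = h m a + h m b"
  shows "(\<Sum>m\<in>Poly_Mapping.keys (p + q). h m (Poly_Mapping.lookup (p + q) m)) =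
    (\<Sum>m\<in>Poly_Mapping.keys p. h m (Poly_Mapping.lookup p m)) +
    (\<Sum>m\<in>Poly_Mapping.keys q. h m (Poly_Mapping.lookup q m))"
proof -
  let ?S = "Poly_Mapping.keys p \<union> Poly_Mapping.keys q"
  have *: "(\<Sum>m\<in>Poly_Mapping.keys r. h m (Poly_Mapping.lookup r m)) =
      (\<Sum>m\<in>?S. h m (Poly_Mapping.lookup r m))" if "Poly_Mapping.keys r \<subseteq> ?S"
    for r :: "('a, 'n) mpoly"
    by (rule sum.mono_neutral_left) (use that assms in \<open>auto simp: in_keys_iff\<close>)
  show ?thesis
    using *[of "p + q"] *[of p] *[of q] keys_add[of p q]
    by (simp add: lookup_add assms sum.distrib)
qed

text \<open>Evaluation takes an arbitrary coefficient map so that three uses share one definition: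
  the identity gives \<open>peval\<close>, constant univariate polynomials give the restriction to a
  polynomial curve, and constants of \<open>mpoly\<close> give substitution.\<close>

definition mev :: "('a::comm_ring_1 \<Rightarrow> 'r::comm_ring_1) \<Rightarrow> ('n::finite \<Rightarrow> 'r) \<Rightarrow> ('a, 'n) mpoly \<Rightarrow> 'r"
  where "mev \<kappa> v g = (\<Sum>m\<in>Poly_Mapping.keys g.
     \<kappa> (Poly_Mapping.lookup g m) * (\<Prod>i\<in>UNIV. v i ^ Poly_Mapping.lookup m i))"

lemma peval_mev: "peval g x = mev (\<lambda>c. c) (\<lambda>i. x $ i) g"
  by (simp add: peval_def mev_def)

locale coeff_hom =
  fixes \<kappa> :: "'a::comm_ring_1 \<Rightarrow> 'r::comm_ring_1"
  assumes hom_zero: "\<kappa> 0 = 0" and hom_one: "\<kappa> 1 = 1"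
    and hom_add: "\<kappa> (a + b) = \<kappa> a + \<kappa> b" and hom_mult: "\<kappa> (a * b) = \<kappa> a * \<kappa> b"
begin

lemma mev_single:
  "mev \<kappa> v (Poly_Mapping.single m c) = \<kappa> c * (\<Prod>i\<in>UNIV. v i ^ Poly_Mapping.lookup m i)"
  by (cases "c = 0") (simp_all add: mev_def hom_zero)

lemma mev_add: "mev \<kappa> v (p + q) = mev \<kappa> v p + mev \<kappa> v q"
  unfolding mev_def
  by (rule sum_keys_add) (simp_all add: hom_zero hom_add algebra_simps)

lemma mev_mult: "mev \<kappa> v (p * q) = mev \<kappa> v p * mev \<kappa> v q"
proof (induction p rule: mpoly_induct)
  case (single m c)
  show ?case
  proof (induction q rule: mpoly_induct)
    case (single m' c')
    show ?case
      by (simp add: mult_single mev_single hom_mult lookup_add power_add prod.distrib algebra_simps)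
  qed (simp add: distrib_left mev_add)
qed (simp add: distrib_right mev_add)

lemma mev_zero: "mev \<kappa> v 0 = 0"
  by (simp add: mev_def)

lemma mev_one: "mev \<kappa> v 1 = 1"
  using mev_single[of v 0 1] by (simp add: hom_one)

lemma mev_Var: "mev \<kappa> v (Var i) = v i"
proof -
  have "(\<Prod>j\<in>UNIV. v j ^ Poly_Mapping.lookup (Poly_Mapping.single i (1::nat)) j) =
      (\<Prod>j\<in>UNIV. if i = j then v j else 1)"
    by (rule prod.cong) (auto simp: lookup_single when_def)
  then show ?thesis
    by (simp add: Var_def mev_single hom_one)
qed

lemma mev_uminus: "mev \<kappa> v (- p) = - mev \<kappa> v p"
  using mev_add[of v p "- p"] by (simp add: mev_zero add_eq_0_iff2 minus_equation_iff)

lemma mev_diff: "mev \<kappa> v (p - q) = mev \<kappa> v p - mev \<kappa> v q"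
  using mev_add[of v p "- q"] by (simp add: mev_uminus)

lemma mev_sum: "mev \<kappa> v (sum g S) = (\<Sum>s\<in>S. mev \<kappa> v (g s))"
  by (induction S rule: infinite_finite_induct) (simp_all add: mev_zero mev_add)

lemma mev_prod: "mev \<kappa> v (prod g S) = (\<Prod>s\<in>S. mev \<kappa> v (g s))"
  by (induction S rule: infinite_finite_induct) (simp_all add: mev_one mev_mult)

lemma mev_power: "mev \<kappa> v (p ^ k) = mev \<kappa> v p ^ k"
  by (induction k) (simp_all add: mev_one mev_mult)

end

lemma coeff_hom_id: "coeff_hom (\<lambda>c::'a::comm_ring_1. c)"
  by unfold_locales simp_all

lemma coeff_hom_poly: "coeff_hom (\<lambda>c::'a::comm_ring_1. [:c:])"
  by unfold_locales (simp_all add: one_pCons)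

lemma peval_zero [simp]: "peval 0 x = 0"
  and peval_one [simp]: "peval 1 x = 1"
  and peval_add [simp]: "peval (p + q) x = peval p x + peval q x"
  and peval_mult [simp]: "peval (p * q) x = peval p x * peval q x"
  and peval_uminus [simp]: "peval (- p) x = - peval p x"
  and peval_diff [simp]: "peval (p - q) x = peval p x - peval q x"
  and peval_power [simp]: "peval (p ^ k) x = peval p x ^ k"
  and peval_Var [simp]: "peval (Var i) x = x $ i"
  and peval_sum: "peval (sum g S) x = (\<Sum>s\<in>S. peval (g s) x)"
  and peval_prod: "peval (prod g' S) x = (\<Prod>s\<in>S. peval (g' s) x)"
  and peval_single: "peval (Poly_Mapping.single m c) x =
    c * (\<Prod>i\<in>UNIV. (x $ i) ^ Poly_Mapping.lookup m i)"
  by (simp_all add: peval_mev coeff_hom.mev_zero[OF coeff_hom_id] coeff_hom.mev_one[OF coeff_hom_id]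
      coeff_hom.mev_add[OF coeff_hom_id] coeff_hom.mev_mult[OF coeff_hom_id]
      coeff_hom.mev_uminus[OF coeff_hom_id] coeff_hom.mev_diff[OF coeff_hom_id]
      coeff_hom.mev_power[OF coeff_hom_id] coeff_hom.mev_Var[OF coeff_hom_id]
      coeff_hom.mev_sum[OF coeff_hom_id] coeff_hom.mev_prod[OF coeff_hom_id]
      coeff_hom.mev_single[OF coeff_hom_id])

lemma peval_const [simp]: "peval (Poly_Mapping.single 0 c) x = c"
  by (simp add: peval_single)

lemma peval_numeral [simp]: "peval (numeral k) x = numeral k"
  using peval_const[of "numeral k" x] by simp

lemma poly_mev:
  "poly (mev (\<lambda>c. [:c:]) q g) e = peval g (\<chi> i. poly (q i) e)"
  by (simp add: mev_def peval_def poly_sum poly_prod)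

lemma peval_mev_mpoly:
  "peval (mev (\<lambda>c. Poly_Mapping.single 0 c) q g) x = peval g (\<chi> i. peval (q i) x)"
  by (simp add: mev_def peval_def[of g] peval_sum peval_prod)

subsection \<open>Partial derivatives\<close>

lemma partial_single:
  "partial i (Poly_Mapping.single m c) =
    Poly_Mapping.single (m - Poly_Mapping.single i 1) (of_nat (Poly_Mapping.lookup m i) * c)"
  by (cases "c = 0") (simp_all add: partial_def)

lemma partial_add: "partial i (p + q) = partial i p + partial i q"
  unfolding partial_def by (rule sum_keys_add) (simp_all add: single_add algebra_simps)

lemma lookup_partial:
  "Poly_Mapping.lookup (partial i g) m =
    of_nat (Poly_Mapping.lookup m i + 1) * Poly_Mapping.lookup g (m + Poly_Mapping.single i 1)"
proof (induction g rule: mpoly_induct)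
  case (single m' c)
  show ?case
  proof (cases "Poly_Mapping.lookup m' i = 0")
    case True
    then have "m' \<noteq> m + Poly_Mapping.single i 1"
      by (metis lookup_add lookup_single_eq add_is_0 one_neq_zero)
    with True show ?thesis
      by (simp add: partial_single lookup_single)
  next
    case False
    have "m' - Poly_Mapping.single i 1 = m \<longleftrightarrow> m' = m + Poly_Mapping.single i 1"
      using False by (auto simp: poly_mapping_eq_iff fun_eq_iff lookup_add lookup_minus lookup_single when_def)
    with False show ?thesis
      by (auto simp: partial_single lookup_single when_def lookup_add)
  qed
qed (simp add: partial_add lookup_add algebra_simps)

text \<open>The chain rule along a polynomial curve. Both sides are additive in \<open>g\<close>, so
  only a monomial remains, where the product rule differentiates one power at a time.\<close>

lemma pderiv_mev:
  fixes q :: "'n::finite \<Rightarrow> 'a::{comm_ring_1, semiring_no_zero_divisors} poly"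
  shows "pderiv (mev (\<lambda>c. [:c:]) q g) =
    (\<Sum>i\<in>UNIV. mev (\<lambda>c. [:c:]) q (partial i g) * pderiv (q i))"
proof (induction g rule: mpoly_induct)
  case (single m c)
  let ?l = "Poly_Mapping.lookup m"
  have *: "[:of_nat (?l i) * c:] * (\<Prod>j\<in>UNIV. q j ^ Poly_Mapping.lookup (m - Poly_Mapping.single i 1) j)
      * pderiv (q i) = [:c:] * ((\<Prod>j\<in>UNIV - {i}. q j ^ ?l j) * pderiv (q i ^ ?l i))" for i
  proof -
    have "(\<Prod>j\<in>UNIV. q j ^ Poly_Mapping.lookup (m - Poly_Mapping.single i 1) j) =
        q i ^ (?l i - 1) * (\<Prod>j\<in>UNIV - {i}. q j ^ ?l j)"
      by (subst prod.remove[of _ i]) (auto simp: lookup_minus lookup_single when_def intro!: prod.cong)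
    then show ?thesis
      by (simp add: pderiv_power of_nat_poly[symmetric] algebra_simps smult_add_right)
  qed
  show ?case
    unfolding partial_single coeff_hom.mev_single[OF coeff_hom_poly] * pderiv_mult pderiv_prod
    by (simp add: pderiv_pCons sum_distrib_left del: mult_pCons_left)
qed (simp add: partial_add coeff_hom.mev_add[OF coeff_hom_poly] pderiv_add distrib_right sum.distrib)


definition cpt :: "('n::finite \<Rightarrow> 'a::comm_ring_1 poly) \<Rightarrow> 'a \<Rightarrow> 'a ^ 'n"
  where "cpt q e = (\<chi> i. poly (q i) e)"

lemma cpt_nth [simp]: "cpt q e $ i = poly (q i) e"
  by (simp add: cpt_def)

lemma poly_pderiv_mev:
  fixes q :: "'n::finite \<Rightarrow> 'a::{comm_ring_1, semiring_no_zero_divisors} poly"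
  shows "poly (pderiv (mev (\<lambda>c. [:c:]) q g)) e =
    (\<Sum>i\<in>UNIV. grad g (cpt q e) $ i * poly (pderiv (q i)) e)"
  by (simp add: pderiv_mev poly_sum poly_mev grad_def cpt_def)

text \<open>Exceptional parameters will always form a finite set, so this is what carries an
  identity from general parameters to a chosen one.\<close>

lemma poly_eq_zero_if_cofinite:
  fixes p :: "'a::{idom, ring_char_0} poly"
  assumes "finite S" "\<And>e. e \<notin> S \<Longrightarrow> poly p e = 0"
  shows "p = 0"
proof (rule ccontr)
  assume "p \<noteq> 0"
  then have "finite {e. poly p e = 0}"
    by (rule poly_roots_finite)
  moreover have "UNIV \<subseteq> S \<union> {e. poly p e = 0}"
    using assms(2) by auto
  ultimately show False
    using assms(1) infinite_UNIV_char_0[where 'a='a] by (meson finite_Un finite_subset)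
qed

lemma grad_curve_zero:
  fixes q :: "'n::finite \<Rightarrow> 'a::{idom, ring_char_0} poly"
  assumes "finite S" and "\<And>e. e \<notin> S \<Longrightarrow> peval g (cpt q e) = 0"
  shows "(\<Sum>i\<in>UNIV. grad g (cpt q e) $ i * poly (pderiv (q i)) e) = 0"
proof -
  have "mev (\<lambda>c. [:c:]) q g = 0"
    using assms by (intro poly_eq_zero_if_cofinite[of S]) (auto simp: poly_mev cpt_def)
  then show ?thesis
    by (metis poly_pderiv_mev pderiv_0 poly_0)
qed

lemma peval_curve_zero:
  fixes q :: "'n::finite \<Rightarrow> 'a::{idom, ring_char_0} poly"
  assumes "finite S" and "\<And>e. e \<notin> S \<Longrightarrow> peval g (cpt q e) = 0"
  shows "peval g (cpt q e) = 0"
proof -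
  have "mev (\<lambda>c. [:c:]) q g = 0"
    using assms by (intro poly_eq_zero_if_cofinite[of S]) (auto simp: poly_mev cpt_def)
  then show ?thesis
    by (metis poly_mev cpt_def poly_0)
qed

definition line :: "'a::comm_ring_1 ^ 'n \<Rightarrow> 'a ^ 'n \<Rightarrow> 'n \<Rightarrow> 'a poly"
  where "line x y i = [:x $ i, y $ i:]"

lemma cpt_line: "cpt (line x y) e = x + e *s y"
  by (simp add: vec_eq_iff line_def)

lemma poly_pderiv_line [simp]:
  "poly (pderiv (line x y i)) e = (y :: 'a::{comm_ring_1, semiring_no_zero_divisors} ^ 'n) $ i"
  by (simp add: line_def pderiv_pCons)

text \<open>Induction on a bound for the total degree. Vanishing as a function passes to every
  partial derivative by differentiating along coordinate lines; these are then zero polynomials, and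
  characteristic zero leaves only a constant term.\<close>

lemma peval_eq_zero_imp_zero:
  fixes g :: "('a::{idom, ring_char_0}, 'n::finite) mpoly"
  assumes "\<And>x. peval g x = 0"
  shows "g = 0"
proof -
  have "g = 0" if "\<forall>m\<in>Poly_Mapping.keys g. (\<Sum>i\<in>UNIV. Poly_Mapping.lookup m i) \<le> d" "\<And>x. peval g x = 0"
    for d and g :: "('a, 'n) mpoly"
    using that
  proof (induction d arbitrary: g)
    case 0
    then have "Poly_Mapping.keys g \<subseteq> {0}"
      by (auto simp: poly_mapping_eq_iff fun_eq_iff)
    then have "g = Poly_Mapping.single 0 (Poly_Mapping.lookup g 0)"
      by (intro poly_mapping_eqI) (auto simp: lookup_single when_def in_keys_iff)
    then show ?case
      using 0(2) peval_const by (metis single_zero)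
  next
    case (Suc d)
    have zero: "partial i g = 0" for i
    proof (rule Suc.IH)
      have "(\<Sum>j\<in>UNIV. Poly_Mapping.lookup m j) \<le> d" if "m \<in> Poly_Mapping.keys (partial i g)" for m
      proof -
        have "m + Poly_Mapping.single i 1 \<in> Poly_Mapping.keys g"
          using that by (auto simp: in_keys_iff lookup_partial)
        with Suc.prems(1) have "(\<Sum>j\<in>UNIV. Poly_Mapping.lookup (m + Poly_Mapping.single i 1) j) \<le> Suc d"
          by blast
        then show ?thesis
          by (simp add: lookup_add sum.distrib lookup_single when_def)
      qed
      then show "\<forall>m\<in>Poly_Mapping.keys (partial i g). (\<Sum>i\<in>UNIV. Poly_Mapping.lookup m i) \<le> d"
        by blast
      show "peval (partial i g) x = 0" for x
      proof -
        have "(\<Sum>j\<in>UNIV. grad g (cpt (line x (axis i 1)) 0) $ j * axis i 1 $ j) = 0"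
          using grad_curve_zero[of "{}" g "line x (axis i 1)" 0] Suc.prems(2) by simp
        then show ?thesis
          by (simp add: cpt_line grad_def axis_def if_distrib[of "(*) _"] cong: if_cong)
      qed
    qed
    have "Poly_Mapping.lookup g m = 0" if m: "m \<noteq> 0" for m
    proof -
      obtain i where i: "Poly_Mapping.lookup m i > 0"
        using m by (auto simp: poly_mapping_eq_iff fun_eq_iff)
      have "m - Poly_Mapping.single i 1 + Poly_Mapping.single i 1 = m"
        using i by (auto simp: poly_mapping_eq_iff fun_eq_iff lookup_add lookup_minus lookup_single when_def)
      then show ?thesis
        using lookup_partial[of i g "m - Poly_Mapping.single i 1"] zero[of i]
        by (metis lookup_zero mult_eq_0_iff of_nat_eq_0_iff add_is_0 one_neq_zero)
    qed
    then have "g = Poly_Mapping.single 0 (Poly_Mapping.lookup g 0)"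
      by (intro poly_mapping_eqI) (auto simp: lookup_single when_def)
    then show ?case
      using Suc.prems(2) peval_const by (metis single_zero)
  qed
  moreover have "\<exists>d. \<forall>m\<in>Poly_Mapping.keys g. (\<Sum>i\<in>UNIV. Poly_Mapping.lookup m i) \<le> d"
    by (rule exI[of _ "Max ((\<lambda>m. \<Sum>i\<in>UNIV. Poly_Mapping.lookup m i) ` Poly_Mapping.keys g)"]) simp
  ultimately show ?thesis
    using assms by blast
qed

lemma peval_eq_imp_eq:
  fixes g h :: "('a::{idom, ring_char_0}, 'n::finite) mpoly"
  assumes "\<And>x. peval g x = peval h x"
  shows "g = h"
  using peval_eq_zero_imp_zero[of "g - h"] assms by simp

subsection \<open>Functions given by polynomials and by forms\<close>

text \<open>Working with functions lets polynomiality, and for \<open>formfun\<close> the degree, be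
  derived by closure rules from the shape of an expression. The zero function is a form of every
  degree.\<close>

definition polyfun :: "('a::comm_ring_1 ^ 'n::finite \<Rightarrow> 'a) \<Rightarrow> bool"
  where "polyfun \<phi> \<longleftrightarrow> (\<exists>g. \<forall>x. peval g x = \<phi> x)"

definition formfun :: "nat \<Rightarrow> ('a::comm_ring_1 ^ 'n::finite \<Rightarrow> 'a) \<Rightarrow> bool"
  where "formfun d \<phi> \<longleftrightarrow> (\<exists>g. form d g \<and> (\<forall>x. peval g x = \<phi> x))"

lemma form_mult: "form d p \<Longrightarrow> form e q \<Longrightarrow> form (d + e) (p * q)"
  using keys_mult[of p q] by (fastforce simp: form_def lookup_add sum.distrib)

lemma form_add: "form d p \<Longrightarrow> form d q \<Longrightarrow> form d (p + q)"
  using keys_add[of p q] by (fastforce simp: form_def)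

lemma form_const: "form 0 (Poly_Mapping.single 0 c)"
  by (simp add: form_def)

lemma form_zero [simp]: "form d 0"
  by (simp add: form_def)

lemma form_Var: "form 1 (Var i)"
  by (simp add: form_def Var_def lookup_single when_def)

lemma polyfun_peval [simp]: "polyfun (peval g)"
  by (auto simp: polyfun_def)

lemma polyfun_const: "polyfun (\<lambda>x. c)"
  by (auto simp: polyfun_def intro!: exI[of _ "Poly_Mapping.single 0 c"])

lemma polyfun_nth: "polyfun (\<lambda>x. x $ i)"
  by (auto simp: polyfun_def intro!: exI[of _ "Var i"])

lemma polyfun_add: "polyfun \<phi> \<Longrightarrow> polyfun \<psi> \<Longrightarrow> polyfun (\<lambda>x. \<phi> x + \<psi> x)"
  and polyfun_mult: "polyfun \<phi> \<Longrightarrow> polyfun \<psi> \<Longrightarrow> polyfun (\<lambda>x. \<phi> x * \<psi> x)"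
  and polyfun_diff: "polyfun \<phi> \<Longrightarrow> polyfun \<psi> \<Longrightarrow> polyfun (\<lambda>x. \<phi> x - \<psi> x)"
  and polyfun_uminus: "polyfun \<phi> \<Longrightarrow> polyfun (\<lambda>x. - \<phi> x)"
  and polyfun_power: "polyfun \<phi> \<Longrightarrow> polyfun (\<lambda>x. \<phi> x ^ k)"
  unfolding polyfun_def
  by (metis peval_add) (metis peval_mult, metis peval_diff, metis peval_uminus, metis peval_power)

lemma polyfun_sum: "(\<And>s. s \<in> S \<Longrightarrow> polyfun (\<phi> s)) \<Longrightarrow> polyfun (\<lambda>x. \<Sum>s\<in>S. \<phi> s x)"
  by (induction S rule: infinite_finite_induct) (auto intro: polyfun_const polyfun_add)

lemma polyfun_matrix: "polyfun (\<lambda>x. (M *v x) $ i)"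
  by (simp add: matrix_vector_mult_def)
    (intro polyfun_sum polyfun_mult polyfun_const polyfun_nth)

lemma polyfun_comp:
  fixes \<phi> :: "'a::comm_ring_1 ^ 'm::finite \<Rightarrow> 'a ^ 'n::finite"
  assumes "polyfun \<psi>" "\<And>i. polyfun (\<lambda>x. \<phi> x $ i)"
  shows "polyfun (\<lambda>x. \<psi> (\<phi> x))"
proof -
  obtain g where g: "\<forall>x. peval g x = \<psi> x"
    using assms(1) by (auto simp: polyfun_def)
  obtain q where q: "\<And>i x. peval (q i) x = \<phi> x $ i"
    using assms(2) unfolding polyfun_def by metis
  have "peval (mev (\<lambda>c. Poly_Mapping.single 0 c) q g) x = \<psi> (\<phi> x)" for x
    by (simp add: peval_mev_mpoly q g)
  then show ?thesis
    by (auto simp: polyfun_def)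
qed

lemma polyfun_curve:
  assumes "polyfun \<phi>"
  obtains p where "\<And>e. poly p e = \<phi> (cpt q e)"
  using assms by (auto simp: polyfun_def cpt_def) (metis poly_mev)

text \<open>Affine space is irreducible: on the line from \<open>a\<close> to \<open>b\<close> the
  product is the zero polynomial, and the first factor is nonzero at \<open>a\<close>.\<close>

lemma polyfun_mult_eq_zero:
  fixes \<phi> \<psi> :: "'a::{idom, ring_char_0} ^ 'n::finite \<Rightarrow> 'a"
  assumes \<phi>: "polyfun \<phi>" and \<psi>: "polyfun \<psi>" and "\<And>x. \<phi> x = 0 \<or> \<psi> x = 0" and "\<phi> a \<noteq> 0"
  shows "\<psi> b = 0"
proof -
  obtain p where p: "\<And>e. poly p e = \<phi> (cpt (line a (b - a)) e)"
    using polyfun_curve[OF \<phi>] by blast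
  obtain q where q: "\<And>e. poly q e = \<psi> (cpt (line a (b - a)) e)"
    using polyfun_curve[OF \<psi>] by blast
  have "p * q = 0"
    using assms(3) by (intro poly_eq_zero_if_cofinite[of "{}"]) (auto simp: p q)
  moreover have "p \<noteq> 0"
    using assms(4) p[of 0] by (auto simp: cpt_line)
  ultimately have "q = 0"
    by simp
  then show ?thesis
    using q[of 1] by (simp add: cpt_line)
qed

lemma formfun_const: "formfun 0 (\<lambda>x. c)"
  unfolding formfun_def by (intro exI[of _ "Poly_Mapping.single 0 c"] conjI form_const) simp

lemma formfun_zero: "formfun d (\<lambda>x. 0)"
  unfolding formfun_def by (intro exI[of _ 0]) simp

lemma formfun_nth: "formfun 1 (\<lambda>x. x $ i)"
  unfolding formfun_def by (intro exI[of _ "Var i"] conjI form_Var) simp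

lemma formfun_add: "formfun d \<phi> \<Longrightarrow> formfun d \<psi> \<Longrightarrow> formfun d (\<lambda>x. \<phi> x + \<psi> x)"
  unfolding formfun_def using form_add by (metis peval_add)

lemma formfun_mult: "formfun d \<phi> \<Longrightarrow> formfun e \<psi> \<Longrightarrow> d + e = k \<Longrightarrow> formfun k (\<lambda>x. \<phi> x * \<psi> x)"
  unfolding formfun_def using form_mult by (metis peval_mult)

lemma formfun_cmult: "formfun d \<phi> \<Longrightarrow> formfun d (\<lambda>x. c * \<phi> x)"
  using formfun_mult[OF formfun_const, of d \<phi> d c] by simp

lemma formfun_uminus: "formfun d \<phi> \<Longrightarrow> formfun d (\<lambda>x. - \<phi> x)"
  using formfun_cmult[of d \<phi> "-1"] by simp

lemma formfun_diff: "formfun d \<phi> \<Longrightarrow> formfun d \<psi> \<Longrightarrow> formfun d (\<lambda>x. \<phi> x - \<psi> x)"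
  using formfun_add[OF _ formfun_uminus, of d \<phi> \<psi>] by simp

lemma formfun_power: "formfun d \<phi> \<Longrightarrow> d * k = e \<Longrightarrow> formfun e (\<lambda>x. \<phi> x ^ k)"
proof (induction k arbitrary: e)
  case (Suc k)
  then show ?case
    using formfun_mult[of d \<phi> "d * k"] by simp
qed (simp add: formfun_const)

lemma formfun_sum: "(\<And>s. s \<in> S \<Longrightarrow> formfun d (\<phi> s)) \<Longrightarrow> formfun d (\<lambda>x. \<Sum>s\<in>S. \<phi> s x)"
  by (induction S rule: infinite_finite_induct) (auto intro: formfun_zero formfun_add)

lemma formfun_matrix: "formfun 1 (\<lambda>x. (M *v x) $ i)"
  unfolding matrix_vector_mult_def vec_lambda_beta
  by (intro formfun_sum formfun_cmult formfun_nth)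

lemma formfun_imp_polyfun: "formfun d \<phi> \<Longrightarrow> polyfun \<phi>"
  by (auto simp: formfun_def polyfun_def)

lemma formfun_scale:
  assumes "formfun d \<phi>"
  shows "\<phi> (c *s x) = c ^ d * \<phi> x"
proof -
  obtain g where g: "form d g" "\<And>x. peval g x = \<phi> x"
    using assms by (auto simp: formfun_def)
  have "Poly_Mapping.lookup g m * (\<Prod>i\<in>UNIV. ((c *s x) $ i) ^ Poly_Mapping.lookup m i) =
      c ^ d * (Poly_Mapping.lookup g m * (\<Prod>i\<in>UNIV. (x $ i) ^ Poly_Mapping.lookup m i))"
    if "m \<in> Poly_Mapping.keys g" for m
  proof -
    have "d = (\<Sum>i\<in>UNIV. Poly_Mapping.lookup m i)"
      using g(1) that by (auto simp: form_def)
    then show ?thesis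
      by (simp add: power_mult_distrib prod.distrib power_sum)
  qed
  then have "peval g (c *s x) = c ^ d * peval g x"
    by (simp add: peval_def sum_distrib_left)
  then show ?thesis
    by (simp add: g)
qed

lemma polyfun_homogeneous_sum:
  assumes "polyfun \<phi>"
  shows "\<exists>K \<phi>s. (\<forall>d. formfun d (\<phi>s d)) \<and> (\<forall>x. \<phi> x = (\<Sum>d\<le>(K::nat). \<phi>s d x))"
proof -
  obtain g where g: "\<And>x. peval g x = \<phi> x"
    using assms by (auto simp: polyfun_def)
  have "\<exists>K \<phi>s. (\<forall>d. formfun d (\<phi>s d)) \<and> (\<forall>x. peval g x = (\<Sum>d\<le>(K::nat). \<phi>s d x))"
  proof (induction g rule: mpoly_induct)
    case (single m c)
    let ?K = "\<Sum>i\<in>UNIV. Poly_Mapping.lookup m i"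
    let ?f = "\<lambda>d x. if d = ?K then peval (Poly_Mapping.single m c) x else 0"
    have "formfun d (?f d)" for d
      by (cases "d = ?K")
        (auto simp: formfun_zero formfun_def form_def intro!: exI[of _ "Poly_Mapping.single m c"] split: if_splits)
    then show ?case
      by (intro exI[of _ ?K] exI[of _ ?f]) auto
  next
    case (add p q)
    then obtain K \<phi>s L \<psi>s where *: "\<forall>d. formfun d (\<phi>s d)" "\<forall>x. peval p x = (\<Sum>d\<le>(K::nat). \<phi>s d x)"
      "\<forall>d. formfun d (\<psi>s d)" "\<forall>x. peval q x = (\<Sum>d\<le>(L::nat). \<psi>s d x)"
      by blast
    let ?f = "\<lambda>d x. (if d \<le> K then \<phi>s d x else 0) + (if d \<le> L then \<psi>s d x else 0)"
    have "formfun d (?f d)" for d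
      by (rule formfun_add; cases "d \<le> K"; cases "d \<le> L") (use * in \<open>auto simp: formfun_zero\<close>)
    moreover have "(\<Sum>d\<le>K. \<phi>s d x) = (\<Sum>d\<le>max K L. if d \<le> K then \<phi>s d x else 0)"
      "(\<Sum>d\<le>L. \<psi>s d x) = (\<Sum>d\<le>max K L. if d \<le> L then \<psi>s d x else 0)" for x
      by (rule sum.mono_neutral_cong_left; auto)+
    ultimately show ?case
      using * by (intro exI[of _ "max K L"] exI[of _ ?f]) (simp add: sum.distrib)
  qed
  then show ?thesis
    by (simp add: g)
qed

section \<open>Closed and irreducible sets\<close>

lemma zariski_closed_forms:
  assumes "\<And>\<phi>. \<phi> \<in> \<Phi> \<Longrightarrow> \<exists>d. formfun d \<phi>"
  shows "zariski_closed {x. x \<noteq> 0 \<and> (\<forall>\<phi>\<in>\<Phi>. \<phi> x = 0)}"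
proof -
  let ?G = "{g. homogeneous g \<and> peval g \<in> \<Phi>}"
  have "\<exists>g. homogeneous g \<and> peval g = \<phi>" if "\<phi> \<in> \<Phi>" for \<phi>
    using assms[OF that] by (auto simp: formfun_def homogeneous_def fun_eq_iff)
  then have "{x. x \<noteq> 0 \<and> (\<forall>\<phi>\<in>\<Phi>. \<phi> x = 0)} = {x. x \<noteq> 0 \<and> (\<forall>g\<in>?G. peval g x = 0)}"
    by blast
  then show ?thesis
    unfolding zariski_closed_def by (intro exI[of _ ?G]) auto
qed

lemma zariski_closed_form: "formfun d \<phi> \<Longrightarrow> zariski_closed {x. x \<noteq> 0 \<and> \<phi> x = 0}"
  using zariski_closed_forms[of "{\<phi>}"] by auto

lemma zariski_closed_nonzero: "zariski_closed {x. x \<noteq> 0}"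
  using zariski_closed_forms[of "{}"] by auto

lemma zariski_closedE:
  assumes "zariski_closed A"
  obtains \<Phi> where "\<And>\<phi>. \<phi> \<in> \<Phi> \<Longrightarrow> \<exists>d. formfun d \<phi>" "A = {x. x \<noteq> 0 \<and> (\<forall>\<phi>\<in>\<Phi>. \<phi> x = 0)}"
proof -
  obtain G where G: "\<forall>g\<in>G. homogeneous g" "A = {x. x \<noteq> 0 \<and> (\<forall>g\<in>G. peval g x = 0)}"
    using assms by (auto simp: zariski_closed_def)
  show ?thesis
    by (rule that[of "peval ` G"]) (use G in \<open>fastforce simp: homogeneous_def formfun_def\<close>)+
qed

lemma zariski_closed_0: "zariski_closed A \<Longrightarrow> 0 \<notin> A"
  by (auto simp: zariski_closed_def)

lemma zariski_closed_scale:
  fixes x :: "'a::field ^ 'n::finite"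
  assumes "zariski_closed A" "x \<in> A" "c \<noteq> 0"
  shows "c *s x \<in> A"
proof -
  obtain \<Phi> where \<Phi>: "\<And>\<phi>. \<phi> \<in> \<Phi> \<Longrightarrow> \<exists>d. formfun d \<phi>"
    and A: "A = {x. x \<noteq> 0 \<and> (\<forall>\<phi>\<in>\<Phi>. \<phi> x = 0)}"
    using zariski_closedE[OF assms(1)] by blast
  have "\<phi> (c *s x) = 0" if \<phi>: "\<phi> \<in> \<Phi>" for \<phi>
  proof -
    obtain d where "formfun d \<phi>"
      using \<Phi>[OF \<phi>] by blast
    then show ?thesis
      using formfun_scale[of d \<phi> c x] assms(2) A \<phi> by simp
  qed
  then show ?thesis
    using assms(2,3) A by auto
qed

lemma zariski_closure_iff:
  "x \<in> zariski_closure S \<longleftrightarrow>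
    x \<noteq> 0 \<and> (\<forall>d \<phi>. formfun d \<phi> \<longrightarrow> (\<forall>y\<in>S - {0}. \<phi> y = 0) \<longrightarrow> \<phi> x = 0)" (is "?L \<longleftrightarrow> ?R")
proof
  assume L: ?L
  then have "x \<in> {x. x \<noteq> 0}"
    unfolding zariski_closure_def using zariski_closed_nonzero by blast
  moreover have "\<phi> x = 0" if "formfun d \<phi>" "\<forall>y\<in>S - {0}. \<phi> y = 0" for d \<phi>
  proof -
    have "S - {0} \<subseteq> {x. x \<noteq> 0 \<and> \<phi> x = 0}"
      using that(2) by auto
    then show ?thesis
      using L zariski_closed_form[OF that(1)] unfolding zariski_closure_def by blast
  qed
  ultimately show ?R
    by blast
next
  assume R: ?R
  have "x \<in> A" if A: "zariski_closed A" "S - {0} \<subseteq> A" for A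
  proof -
    obtain \<Phi> where \<Phi>: "\<And>\<phi>. \<phi> \<in> \<Phi> \<Longrightarrow> \<exists>d. formfun d \<phi>"
      and AE: "A = {x. x \<noteq> 0 \<and> (\<forall>\<phi>\<in>\<Phi>. \<phi> x = 0)}"
      using zariski_closedE[OF A(1)] by blast
    have "\<phi> x = 0" if "\<phi> \<in> \<Phi>" for \<phi>
      using R \<Phi>[OF that] A(2) that AE by blast
    then show ?thesis
      using R AE by blast
  qed
  then show ?L
    unfolding zariski_closure_def by blast
qed

lemma zariski_closure_closed: "zariski_closed (zariski_closure S)"
proof -
  have "zariski_closure S =
      {x. x \<noteq> 0 \<and> (\<forall>\<phi>\<in>{\<phi>. (\<exists>d. formfun d \<phi>) \<and> (\<forall>y\<in>S - {0}. \<phi> y = 0)}. \<phi> x = 0)}"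
    unfolding set_eq_iff mem_Collect_eq zariski_closure_iff by blast
  then show ?thesis
    by (simp only:) (rule zariski_closed_forms, blast)
qed

lemma zariski_closure_superset: "S - {0} \<subseteq> zariski_closure S"
  by (auto simp: zariski_closure_iff)

lemma zariski_closure_minimal: "zariski_closed A \<Longrightarrow> S - {0} \<subseteq> A \<Longrightarrow> zariski_closure S \<subseteq> A"
  unfolding zariski_closure_def by blast

lemma zariski_closure_id: "zariski_closed A \<Longrightarrow> zariski_closure A = A"
  using zariski_closure_minimal[of A A] zariski_closure_superset[of A] zariski_closed_0[of A] by blast

lemma zariski_closure_form_zero:
  "x \<in> zariski_closure S \<Longrightarrow> formfun d \<phi> \<Longrightarrow> (\<And>y. y \<in> S \<Longrightarrow> \<phi> y = 0) \<Longrightarrow> \<phi> x = 0"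
  by (auto simp: zariski_closure_iff)

text \<open>A form that vanishes along the curve for nonzero parameters vanishes at its starting
  point. Parameters where the curve meets the origin are discarded through the roots of one
  coordinate.\<close>

lemma zariski_closure_curve:
  fixes q :: "'n::finite \<Rightarrow> 'a::field_char_0 poly"
  assumes "cpt q 0 \<noteq> 0" and "\<And>e. e \<noteq> 0 \<Longrightarrow> cpt q e \<in> S"
  shows "cpt q 0 \<in> zariski_closure S"
  unfolding zariski_closure_iff
proof (intro conjI allI impI assms)
  fix d and \<phi> :: "'a ^ 'n \<Rightarrow> 'a"
  assume \<phi>: "formfun d \<phi>" and zero: "\<forall>y\<in>S - {0}. \<phi> y = 0"
  obtain g where g: "\<And>x. peval g x = \<phi> x"
    using \<phi> by (auto simp: formfun_def)
  obtain i where i: "poly (q i) 0 \<noteq> 0"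
    using assms(1) by (auto simp: vec_eq_iff)
  have "peval g (cpt q 0) = 0"
  proof (rule peval_curve_zero)
    show "finite ({0} \<union> {e. poly (q i) e = 0})"
      using i by (auto intro!: poly_roots_finite)
    fix e assume e: "e \<notin> {0} \<union> {e. poly (q i) e = 0}"
    then have "cpt q e \<noteq> 0"
      by (auto simp: vec_eq_iff)
    then show "peval g (cpt q e) = 0"
      using e assms(2)[of e] zero g by auto
  qed
  then show "\<phi> (cpt q 0) = 0"
    by (simp add: g)
qed

text \<open>Two closed sets covering \<open>S\<close> may be replaced by two single forms: one from
  the second set that is nonzero somewhere on \<open>S\<close>, and any one from the first.\<close>

lemma zariski_irreducibleI:
  assumes "S \<noteq> {}" "0 \<notin> S"
    and "\<And>d e \<phi> \<psi> x y. \<lbrakk>formfun d \<phi>; formfun e \<psi>; \<forall>x\<in>S. \<phi> x = 0 \<or> \<psi> x = 0; x \<in> S; \<phi> x \<noteq> 0; y \<in> S\<rbrakk>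
      \<Longrightarrow> \<psi> y = 0"
  shows "zariski_irreducible S"
  unfolding zariski_irreducible_def
proof (intro conjI allI impI assms(1))
  fix A B assume "zariski_closed A \<and> zariski_closed B \<and> S \<subseteq> A \<union> B"
  then have AB: "zariski_closed A" "zariski_closed B" "S \<subseteq> A \<union> B" by auto
  obtain \<Phi> where \<Phi>: "\<And>\<phi>. \<phi> \<in> \<Phi> \<Longrightarrow> \<exists>d. formfun d \<phi>"
    and A: "A = {x. x \<noteq> 0 \<and> (\<forall>\<phi>\<in>\<Phi>. \<phi> x = 0)}"
    using zariski_closedE[OF AB(1)] by blast
  obtain \<Psi> where \<Psi>: "\<And>\<psi>. \<psi> \<in> \<Psi> \<Longrightarrow> \<exists>d. formfun d \<psi>"
    and B: "B = {x. x \<noteq> 0 \<and> (\<forall>\<psi>\<in>\<Psi>. \<psi> x = 0)}"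
    using zariski_closedE[OF AB(2)] by blast
  show "S \<subseteq> A \<or> S \<subseteq> B"
  proof (rule disjCI)
    assume "\<not> S \<subseteq> B"
    then obtain x \<psi> where x: "x \<in> S" "\<psi> \<in> \<Psi>" "\<psi> x \<noteq> 0"
      using assms(2) B by auto
    have "\<phi> y = 0" if y: "y \<in> S" "\<phi> \<in> \<Phi>" for y \<phi>
    proof -
      have "\<forall>z\<in>S. \<psi> z = 0 \<or> \<phi> z = 0"
        using AB(3) A B x(2) y(2) by blast
      then show ?thesis
        using assms(3) \<Phi>[OF y(2)] \<Psi>[OF x(2)] x y(1) by blast
    qed
    then show "S \<subseteq> A"
      using A assms(2) by auto
  qed
qed

lemma zariski_irreducibleD:
  assumes "zariski_irreducible S" "0 \<notin> S" "formfun d \<phi>" "formfun e \<psi>"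
    and "\<And>x. x \<in> S \<Longrightarrow> \<phi> x = 0 \<or> \<psi> x = 0" and "x \<in> S" "\<phi> x \<noteq> 0" "y \<in> S"
  shows "\<psi> y = 0"
proof -
  have "S \<subseteq> {x. x \<noteq> 0 \<and> \<phi> x = 0} \<union> {x. x \<noteq> 0 \<and> \<psi> x = 0}"
    using assms(2,5) by auto
  then have "S \<subseteq> {x. x \<noteq> 0 \<and> \<phi> x = 0} \<or> S \<subseteq> {x. x \<noteq> 0 \<and> \<psi> x = 0}"
    using assms(1) zariski_closed_form[OF assms(3)] zariski_closed_form[OF assms(4)]
    unfolding zariski_irreducible_def by blast
  then show ?thesis
    using assms(6-8) by auto
qed

lemma zariski_irreducible_closure:
  assumes "zariski_irreducible S" "0 \<notin> S"
  shows "zariski_irreducible (zariski_closure S)"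
proof -
  have S: "S \<subseteq> zariski_closure S"
    using zariski_closure_superset[of S] assms(2) by auto
  show ?thesis
    unfolding zariski_irreducible_def
  proof (intro conjI allI impI)
    show "zariski_closure S \<noteq> {}"
      using S assms(1) by (auto simp: zariski_irreducible_def)
    fix A B assume AB: "zariski_closed A \<and> zariski_closed B \<and> zariski_closure S \<subseteq> A \<union> B"
    then have "S \<subseteq> A \<or> S \<subseteq> B"
      using assms(1) S unfolding zariski_irreducible_def by blast
    then show "zariski_closure S \<subseteq> A \<or> zariski_closure S \<subseteq> B"
      using AB zariski_closure_minimal[of A S] zariski_closure_minimal[of B S] by blast
  qed
qed

lemma zariski_irreducible_image:
  fixes \<phi> :: "'a::field_char_0 ^ 'm::finite \<Rightarrow> 'a ^ 'n::finite"
  assumes \<phi>: "\<And>i. polyfun (\<lambda>x. \<phi> x $ i)" and "\<phi> a \<noteq> 0"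
  shows "zariski_irreducible {y. y \<noteq> 0 \<and> (\<exists>p. y = \<phi> p)}"
proof (rule zariski_irreducibleI)
  show "{y. y \<noteq> 0 \<and> (\<exists>p. y = \<phi> p)} \<noteq> {}"
    using assms(2) by blast
  show "0 \<notin> {y. y \<noteq> 0 \<and> (\<exists>p. y = \<phi> p)}"
    by blast
  fix d e f g x y
  assume f: "formfun d f" and g: "formfun e g"
    and fg: "\<forall>x\<in>{y. y \<noteq> 0 \<and> (\<exists>p. y = \<phi> p)}. f x = 0 \<or> g x = 0"
    and x: "x \<in> {y. y \<noteq> 0 \<and> (\<exists>p. y = \<phi> p)}" "f x \<noteq> 0" and y: "y \<in> {y. y \<noteq> 0 \<and> (\<exists>p. y = \<phi> p)}"
  obtain p q where p: "x = \<phi> p" and q: "y = \<phi> q"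
    using x y by blast
  obtain i where i: "x $ i \<noteq> 0"
    using x(1) by (auto simp: vec_eq_iff)
  have "g (\<phi> q) = 0"
  \<comment> \<open>The coordinate factor absorbs the parameters mapped to the origin, where nothing
    is known about \<open>f\<close> and \<open>g\<close>.\<close>
  proof (rule polyfun_mult_eq_zero[where \<phi> = "\<lambda>p. f (\<phi> p) * \<phi> p $ i" and \<psi> = "\<lambda>p. g (\<phi> p)" and a = p])
    show "polyfun (\<lambda>p. f (\<phi> p) * \<phi> p $ i)"
      by (rule polyfun_mult[OF polyfun_comp[OF formfun_imp_polyfun[OF f] \<phi>] \<phi>])
    show "polyfun (\<lambda>p. g (\<phi> p))"
      by (rule polyfun_comp[OF formfun_imp_polyfun[OF g] \<phi>])
    show "f (\<phi> z) * \<phi> z $ i = 0 \<or> g (\<phi> z) = 0" for z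
      using fg by (cases "\<phi> z = 0") auto
    show "f (\<phi> p) * \<phi> p $ i \<noteq> 0"
      using x(2) i p by simp
  qed
  then show "g y = 0"
    by (simp add: q)
qed

subsection \<open>Dimension\<close>

text \<open>Irreducibility speaks about forms, while \<open>P\<close> is any polynomial. Replacing a
  point by its multiples turns \<open>g z * P z = 0\<close> into a polynomial identity in the
  scaling factor, and its coefficients separate the homogeneous parts of \<open>P\<close>.\<close>

lemma irreducible_nonzero_divisor:
  fixes C :: "('a::field_char_0 ^ 'n::finite) set"
  assumes C: "zariski_closed C" "zariski_irreducible C" and g: "formfun e g" and "x \<in> C" "g x \<noteq> 0"
    and P: "polyfun P" and zero: "\<And>z. z \<in> C \<Longrightarrow> g z * P z = 0" and y: "y \<in> C"
  shows "P y = 0"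
proof -
  obtain K P' where P': "\<And>d. formfun d (P' d)" and PP': "\<And>x. P x = (\<Sum>d\<le>(K::nat). P' d x)"
    using polyfun_homogeneous_sum[OF P] by blast
  have gP': "g z = 0 \<or> P' d z = 0" if z: "z \<in> C" and d: "d \<le> K" for z d
  proof -
    let ?p = "\<Sum>d\<le>K. Polynomial.monom (g z * P' d z) (e + d)"
    have "?p = 0"
    proof (rule poly_eq_zero_if_cofinite[of "{0}"])
      fix c :: 'a assume "c \<notin> {0}"
      then have "g (c *s z) * P (c *s z) = 0"
        using zero zariski_closed_scale[OF C(1) z] by auto
      moreover have "g (c *s z) * P (c *s z) = (\<Sum>d\<le>K. (c ^ e * g z) * (c ^ d * P' d z))"
        by (simp only: PP' formfun_scale[OF g] formfun_scale[OF P'] sum_distrib_left)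
      moreover have "\<dots> = poly ?p c"
        unfolding poly_sum poly_monom by (rule sum.cong) (simp_all add: power_add mult_ac)
      ultimately show "poly ?p c = 0"
        by simp
    qed simp
    then have "coeff ?p (e + d) = 0"
      by simp
    then have "g z * P' d z = 0"
      using d by (simp add: coeff_sum)
    then show ?thesis
      by simp
  qed
  have "P' d y = 0" if "d \<le> K" for d
    using zariski_irreducibleD[OF C(2) zariski_closed_0[OF C(1)] g P', of d x y] gP' that assms(4,5) y
    by blast
  then show ?thesis
    by (simp add: PP')
qed

text \<open>Each exponent is bounded separately, which makes the number of products exactly
  \<open>(d + 1) ^ n\<close>.\<close>

definition expts :: "nat \<Rightarrow> nat \<Rightarrow> nat list set"
  where "expts d n = {\<alpha>. set \<alpha> \<subseteq> {..d} \<and> length \<alpha> = n}"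

fun mon :: "('b \<Rightarrow> 'a::comm_ring_1) list \<Rightarrow> nat list \<Rightarrow> 'b \<Rightarrow> 'a" where
  "mon (g # gs) (j # \<alpha>) x = g x ^ j * mon gs \<alpha> x"
| "mon _ _ x = 1"

text \<open>A chain \<open>C\<^sub>0 \<subset> \<dots> \<subset> C\<^sub>n\<close> of irreducible closed sets provides \<open>n + 1\<close> forms whose products are
  linearly independent on \<open>C\<^sub>n\<close>. If \<open>C\<^sub>n\<close> lies in the image of a polynomial map on \<open>K\<^sup>m\<close>, there are at
  most as many such products as monomials in \<open>m\<close> variables, and comparing growth rates gives \<open>n < m\<close>.\<close>

definition indep_mons :: "('b \<Rightarrow> 'a::comm_ring_1) list \<Rightarrow> 'b set \<Rightarrow> nat \<Rightarrow> bool"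
  where "indep_mons gs S d \<longleftrightarrow>
    (\<forall>c. (\<forall>x\<in>S. (\<Sum>\<alpha>\<in>expts d (length gs). c \<alpha> * mon gs \<alpha> x) = 0) \<longrightarrow>
      (\<forall>\<alpha>\<in>expts d (length gs). c \<alpha> = 0))"

lemma finite_expts: "finite (expts d n)"
  unfolding expts_def by (rule finite_lists_length_eq) simp

lemma card_expts: "card (expts d n) = (d + 1) ^ n"
  unfolding expts_def by (subst card_lists_length_eq) auto

lemma expts_0: "expts d 0 = {[]}"
  by (auto simp: expts_def)

lemma sum_expts_Suc: "(\<Sum>\<alpha>\<in>expts d (Suc n). h \<alpha>) = (\<Sum>j\<le>d. \<Sum>\<alpha>\<in>expts d n. h (j # \<alpha>))"
proof -
  have *: "expts d (Suc n) = (\<lambda>(j, \<alpha>). j # \<alpha>) ` ({..d} \<times> expts d n)"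
    by (auto simp: expts_def length_Suc_conv image_iff)
  show ?thesis
    unfolding *
    by (subst sum.reindex) (auto simp: inj_on_def sum.cartesian_product case_prod_unfold)
qed

lemma polyfun_mon:
  fixes gs :: "('a::comm_ring_1 ^ 'b::finite \<Rightarrow> 'a) list"
  shows "(\<And>g. g \<in> set gs \<Longrightarrow> polyfun g) \<Longrightarrow> polyfun (mon gs \<alpha>)"
proof (induction gs arbitrary: \<alpha>)
  case Nil
  have "mon [] \<alpha> = (\<lambda>x :: 'a ^ 'b. 1)"
    by (rule ext) simp
  then show ?case
    by (simp add: polyfun_const)
next
  case (Cons g gs)
  show ?case
  proof (cases \<alpha>)
    case Nil
    then have "mon (g # gs) \<alpha> = (\<lambda>x. 1)"
      by (intro ext) simp
    then show ?thesis
      by (simp add: polyfun_const)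
  next
    case (Cons j \<beta>)
    then have "mon (g # gs) \<alpha> = (\<lambda>x. g x ^ j * mon gs \<beta> x)"
      by (intro ext) simp
    then show ?thesis
      using Cons.IH[of \<beta>] Cons.prems by (auto intro!: polyfun_mult polyfun_power)
  qed
qed

text \<open>A relation is read as a polynomial in \<open>g\<close> whose coefficients are
  combinations of products of \<open>gs\<close>. On \<open>S\<close>, where \<open>g\<close>
  vanishes, only the constant coefficient survives, so it is zero; then \<open>g\<close> is
  cancelled on \<open>S'\<close> and the argument repeats.\<close>

lemma indep_mons_Cons:
  fixes g :: "'a::comm_ring_1 ^ 'n::finite \<Rightarrow> 'a"
  assumes gs: "indep_mons gs S d" "\<And>g. g \<in> set gs \<Longrightarrow> polyfun g" and g: "polyfun g"
    and SS': "\<And>P x. polyfun P \<Longrightarrow> (\<And>x. x \<in> S' \<Longrightarrow> P x = 0) \<Longrightarrow> x \<in> S \<Longrightarrow> P x = 0"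
    and gS: "\<And>x. x \<in> S \<Longrightarrow> g x = 0"
    and gS': "\<And>P x. polyfun P \<Longrightarrow> (\<And>x. x \<in> S' \<Longrightarrow> g x * P x = 0) \<Longrightarrow> x \<in> S' \<Longrightarrow> P x = 0"
  shows "indep_mons (g # gs) S' d"
proof -
  have key: "\<forall>j<m. \<forall>x\<in>S. Q j x = 0"
    if "\<And>j. polyfun (Q j)" "\<And>j. (\<forall>x\<in>S. Q j x = 0) \<Longrightarrow> (\<forall>x. Q j x = 0)"
      "\<And>x. x \<in> S' \<Longrightarrow> (\<Sum>j<m. g x ^ j * Q j x) = 0" for m :: nat and Q
    using that
  proof (induction m arbitrary: Q)
    case (Suc m)
    have "(\<Sum>j<Suc m. g x ^ j * Q j x) = 0" if "x \<in> S" for x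
      by (rule SS'[OF _ Suc.prems(3) that])
        (intro polyfun_sum polyfun_mult polyfun_power g Suc.prems)
    moreover have "(\<Sum>j<Suc m. g x ^ j * Q j x) = Q 0 x" if "x \<in> S" for x
      using gS[OF that] by (subst sum.lessThan_Suc_shift) (simp add: sum.neutral)
    ultimately have "\<forall>x\<in>S. Q 0 x = 0"
      by auto
    then have Q0: "Q 0 x = 0" for x
      using Suc.prems(2)[of 0] by blast
    have "(\<Sum>j<m. g x ^ j * Q (Suc j) x) = 0" if "x \<in> S'" for x
    proof (rule gS'[OF _ _ that, where P = "\<lambda>x. \<Sum>j<m. g x ^ j * Q (Suc j) x"])
      show "polyfun (\<lambda>x. \<Sum>j<m. g x ^ j * Q (Suc j) x)"
        by (intro polyfun_sum polyfun_mult polyfun_power g Suc.prems)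
      fix x assume x: "x \<in> S'"
      show "g x * (\<Sum>j<m. g x ^ j * Q (Suc j) x) = 0"
        using Suc.prems(3)[OF x] Q0[of x] unfolding sum.lessThan_Suc_shift
        by (simp add: sum_distrib_left algebra_simps)
    qed
    then have "\<forall>j<m. \<forall>x\<in>S. Q (Suc j) x = 0"
      using Suc.IH[of "\<lambda>j. Q (Suc j)"] Suc.prems(1,2) by blast
    then show ?case
      using Q0 by (auto simp: less_Suc_eq_0_disj)
  qed simp
  show ?thesis
    unfolding indep_mons_def
  proof (intro allI impI)
    fix c assume c: "\<forall>x\<in>S'. (\<Sum>\<alpha>\<in>expts d (length (g # gs)). c \<alpha> * mon (g # gs) \<alpha> x) = 0"
    let ?Q = "\<lambda>j x. if j \<le> d then \<Sum>\<alpha>\<in>expts d (length gs). c (j # \<alpha>) * mon gs \<alpha> x else 0"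
    have c0: "\<forall>\<alpha>\<in>expts d (length gs). c (j # \<alpha>) = 0" if "\<forall>x\<in>S. ?Q j x = 0" "j \<le> d" for j
      using gs(1) that unfolding indep_mons_def by (auto dest: spec[of _ "\<lambda>\<alpha>. c (j # \<alpha>)"])
    have "\<forall>j<Suc d. \<forall>x\<in>S. ?Q j x = 0"
    proof (rule key)
      show "polyfun (?Q j)" for j
        by (cases "j \<le> d")
          (simp_all add: polyfun_const polyfun_sum[OF polyfun_mult[OF polyfun_const polyfun_mon[OF gs(2)]]])
      show "\<forall>x. ?Q j x = 0" if "\<forall>x\<in>S. ?Q j x = 0" for j
        using c0[OF that] by auto
      fix x assume "x \<in> S'"
      then show "(\<Sum>j<Suc d. g x ^ j * ?Q j x) = 0"
        using c by (auto simp: sum_expts_Suc lessThan_Suc_atMost sum_distrib_left algebra_simps)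
    qed
    then have "c (j # \<alpha>) = 0" if "j \<le> d" "\<alpha> \<in> expts d (length gs)" for j \<alpha>
      using c0[of j] that by auto
    then show "\<forall>\<alpha>\<in>expts d (length (g # gs)). c \<alpha> = 0"
      by (auto simp: expts_def length_Suc_conv)
  qed
qed

text \<open>Unknowns and equations are indexed by finite sets and not by types, since their number
  will depend on a degree bound. The induction removes one equation by eliminating one pivot
  unknown.\<close>

lemma homogeneous_system_nontrivial:
  fixes M :: "'x \<Rightarrow> 'y \<Rightarrow> 'a::field"
  assumes "finite Y" "finite X" "card Y < card X"
  shows "\<exists>c. (\<exists>x\<in>X. c x \<noteq> 0) \<and> (\<forall>y\<in>Y. (\<Sum>x\<in>X. c x * M x y) = 0)"
  using assms
proof (induction Y arbitrary: X M rule: finite_induct)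
  case empty
  then have "X \<noteq> {}" by auto
  then show ?case by (intro exI[of _ "\<lambda>_. 1"]) auto
next
  case (insert b Y)
  show ?case
  proof (cases "\<forall>x\<in>X. M x b = 0")
    case True
    obtain c where "\<exists>x\<in>X. c x \<noteq> 0" "\<forall>y\<in>Y. (\<Sum>x\<in>X. c x * M x y) = 0"
      using insert.IH[of X M] insert.prems insert.hyps by auto
    then show ?thesis
      using True by (intro exI[of _ c]) auto
  next
    case False
    then obtain a where a: "a \<in> X" "M a b \<noteq> 0" by blast
    let ?X = "X - {a}" and ?M = "\<lambda>x y. M x y - M x b / M a b * M a y"
    have "card Y < card ?X"
      using insert.prems insert.hyps a by auto
    then obtain c where c: "\<exists>x\<in>?X. c x \<noteq> 0" "\<forall>y\<in>Y. (\<Sum>x\<in>?X. c x * ?M x y) = 0"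
      using insert.IH[of ?X ?M] insert.prems by auto
    define c' where "c' = c(a := - (\<Sum>x\<in>?X. c x * M x b) / M a b)"
    have split: "(\<Sum>x\<in>X. c' x * M x y) = c' a * M a y + (\<Sum>x\<in>?X. c x * M x y)" for y
    proof -
      have "(\<Sum>x\<in>?X. c' x * M x y) = (\<Sum>x\<in>?X. c x * M x y)"
        by (rule sum.cong) (auto simp: c'_def)
      then show ?thesis
        using insert.prems a by (simp add: sum.remove[of X a])
    qed
    have ca: "c' a = - (\<Sum>x\<in>?X. c x * M x b) / M a b"
      by (simp add: c'_def)
    have "(\<Sum>x\<in>X. c' x * M x y) = 0" if "y \<in> Y" for y
    proof -
      have "(\<Sum>x\<in>?X. c x * ?M x y) = (\<Sum>x\<in>?X. c x * M x y) - (\<Sum>x\<in>?X. c x * M x b) / M a b * M a y"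
        unfolding right_diff_distrib sum_subtractf sum_divide_distrib sum_distrib_right
        by (intro arg_cong2[of _ _ _ _ "(-)"] sum.cong) simp_all
      then show ?thesis
        using c(2) that by (simp add: split ca)
    qed
    moreover have "(\<Sum>x\<in>X. c' x * M x b) = 0"
      using a(2) by (simp add: split ca)
    moreover have "\<exists>x\<in>X. c' x \<noteq> 0"
      using c(1) by (auto simp: c'_def)
    ultimately show ?thesis
      by blast
  qed
qed

definition vdeg_le :: "nat \<Rightarrow> ('a::comm_ring_1, 'n) mpoly \<Rightarrow> bool"
  where "vdeg_le k p \<longleftrightarrow> (\<forall>m\<in>Poly_Mapping.keys p. \<forall>i. Poly_Mapping.lookup m i \<le> k)"

lemma vdeg_le_mult: "vdeg_le k p \<Longrightarrow> vdeg_le l q \<Longrightarrow> vdeg_le (k + l) (p * q)"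
  using keys_mult[of p q] by (fastforce simp: vdeg_le_def lookup_add intro: add_mono)

lemma vdeg_le_mono: "vdeg_le k p \<Longrightarrow> k \<le> l \<Longrightarrow> vdeg_le l p"
  unfolding vdeg_le_def by (meson order_trans)

lemma vdeg_le_one: "vdeg_le k 1"
  by (simp add: vdeg_le_def)

lemma vdeg_le_power: "vdeg_le k p \<Longrightarrow> vdeg_le (k * j) (p ^ j)"
  by (induction j) (auto simp: vdeg_le_one intro: vdeg_le_mult)

lemma vdeg_le_exists: "\<exists>k. vdeg_le k (p :: ('a::comm_ring_1, 'n::finite) mpoly)"
proof -
  let ?S = "(\<lambda>(m, i). Poly_Mapping.lookup m i) ` (Poly_Mapping.keys p \<times> UNIV)"
  have "Poly_Mapping.lookup m i \<le> Max ?S" if "m \<in> Poly_Mapping.keys p" for m i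
    by (rule Max_ge) (use that in auto)
  then show ?thesis
    by (auto simp: vdeg_le_def)
qed

lemma card_vdeg_monomials:
  "finite {m :: 'm::finite \<Rightarrow>\<^sub>0 nat. \<forall>i. Poly_Mapping.lookup m i \<le> k}" (is "finite ?M")
  "card {m :: 'm::finite \<Rightarrow>\<^sub>0 nat. \<forall>i. Poly_Mapping.lookup m i \<le> k} \<le> (k + 1) ^ CARD('m)"
proof -
  let ?P = "Pi\<^sub>E (UNIV :: 'm set) (\<lambda>_. {..k})"
  have P: "finite ?P" "card ?P = (k + 1) ^ CARD('m)"
    by (simp_all add: finite_PiE card_PiE)
  have inj: "inj_on Poly_Mapping.lookup ?M"
    by (rule inj_onI) (rule poly_mapping_eqI, simp)
  have sub: "Poly_Mapping.lookup ` ?M \<subseteq> ?P"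
    by (auto simp: PiE_def)
  show "finite ?M"
    using finite_imageD[OF finite_subset[OF sub P(1)] inj] .
  show "card ?M \<le> (k + 1) ^ CARD('m)"
    using card_inj_on_le[OF inj sub P(1)] P(2) by simp
qed

lemma indep_mons_card_le:
  fixes \<phi> :: "'a::field_char_0 ^ 'm::finite \<Rightarrow> 'a ^ 'n::finite"
  assumes gs: "\<And>g. g \<in> set gs \<Longrightarrow> polyfun g" and indep: "\<And>d. indep_mons gs S d"
    and \<phi>: "\<And>i. polyfun (\<lambda>x. \<phi> x $ i)" and S: "S \<subseteq> range \<phi>"
  shows "length gs \<le> CARD('m)"
proof (rule ccontr)
  assume less: "\<not> length gs \<le> CARD('m)"
  have "\<forall>g\<in>set gs. \<exists>q. \<forall>x. peval q x = g (\<phi> x)"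
    using polyfun_comp[OF gs \<phi>] by (simp add: polyfun_def)
  from bchoice[OF this] obtain r where r: "\<forall>g\<in>set gs. \<forall>x. peval (r g) x = g (\<phi> x)" ..
  have "\<forall>g. \<exists>k. vdeg_le k (r g)"
    using vdeg_le_exists by blast
  from choice[OF this] obtain k where k: "\<forall>g. vdeg_le (k g) (r g)" ..
  define E where "E = (\<Sum>g\<in>set gs. k g)"
  have E: "\<forall>g\<in>set gs. \<exists>q. vdeg_le E q \<and> (\<forall>x. peval q x = g (\<phi> x))"
  proof
    fix g assume g: "g \<in> set gs"
    have "vdeg_le E (r g)"
      by (rule vdeg_le_mono[OF k[rule_format]]) (use g in \<open>simp add: E_def member_le_sum\<close>)
    then show "\<exists>q. vdeg_le E q \<and> (\<forall>x. peval q x = g (\<phi> x))"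
      using r g by blast
  qed
  have rep: "\<exists>q. vdeg_le (length gs * (E * d)) q \<and> (\<forall>x. peval q x = mon gs \<alpha> (\<phi> x))"
    if "\<alpha> \<in> expts d (length gs)" for d \<alpha>
    using that E
  proof (induction gs arbitrary: \<alpha>)
    case Nil
    then show ?case
      by (intro exI[of _ 1]) (auto simp: vdeg_le_one)
  next
    case (Cons g gs)
    obtain j \<beta> where \<alpha>: "\<alpha> = j # \<beta>" "j \<le> d" "\<beta> \<in> expts d (length gs)"
      using Cons.prems(1) by (auto simp: expts_def length_Suc_conv)
    obtain q where q: "vdeg_le (length gs * (E * d)) q" "\<forall>x. peval q x = mon gs \<beta> (\<phi> x)"
      using Cons.IH[OF \<alpha>(3)] Cons.prems(2) by auto
    obtain r where r: "vdeg_le E r" "\<forall>x. peval r x = g (\<phi> x)"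
      using Cons.prems(2) by auto
    have "vdeg_le (E * d) (r ^ j)"
      by (rule vdeg_le_mono[OF vdeg_le_power[OF r(1)]]) (use \<alpha>(2) in simp)
    then show ?case
      using vdeg_le_mult[OF _ q(1)] q(2) r(2) \<alpha>(1) by (intro exI[of _ "r ^ j * q"]) auto
  qed
  have bound: "(d + 1) ^ length gs \<le> (length gs * (E * d) + 1) ^ CARD('m)" for d
  proof (rule ccontr)
    assume asm: "\<not> (d + 1) ^ length gs \<le> (length gs * (E * d) + 1) ^ CARD('m)"
    let ?X = "expts d (length gs)"
    let ?Y = "{m :: 'm \<Rightarrow>\<^sub>0 nat. \<forall>i. Poly_Mapping.lookup m i \<le> length gs * (E * d)}"
    have "\<forall>\<alpha>\<in>?X. \<exists>q. vdeg_le (length gs * (E * d)) q \<and> (\<forall>x. peval q x = mon gs \<alpha> (\<phi> x))"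
      using rep by blast
    from bchoice[OF this] obtain q where q: "\<And>\<alpha>. \<alpha> \<in> ?X \<Longrightarrow> vdeg_le (length gs * (E * d)) (q \<alpha>) \<and>
        (\<forall>x. peval (q \<alpha>) x = mon gs \<alpha> (\<phi> x))"
      by blast
    have "card ?Y < card ?X"
      using asm card_vdeg_monomials(2)[of "length gs * (E * d)", where 'm='m] by (simp add: card_expts)
    then obtain c where c: "\<exists>\<alpha>\<in>?X. c \<alpha> \<noteq> 0" "\<forall>m\<in>?Y. (\<Sum>\<alpha>\<in>?X. c \<alpha> * Poly_Mapping.lookup (q \<alpha>) m) = 0"
      using homogeneous_system_nontrivial[OF card_vdeg_monomials(1) finite_expts,
        where M = "\<lambda>\<alpha>. Poly_Mapping.lookup (q \<alpha>)"] by blast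
    have "(\<Sum>\<alpha>\<in>?X. Poly_Mapping.single 0 (c \<alpha>) * q \<alpha>) = 0"
    proof (rule poly_mapping_eqI)
      fix m
      have *: "Poly_Mapping.lookup (Poly_Mapping.single 0 a * p) m = a * Poly_Mapping.lookup p m"
        for a and p :: "('a, 'm) mpoly"
        by (simp add: mult_map_scale_conv_mult[symmetric] Poly_Mapping.map.rep_eq when_def)
      show "Poly_Mapping.lookup (\<Sum>\<alpha>\<in>?X. Poly_Mapping.single 0 (c \<alpha>) * q \<alpha>) m = Poly_Mapping.lookup 0 m"
      proof (cases "m \<in> ?Y")
        case True
        then show ?thesis
          using c(2) by (simp add: lookup_sum *)
      next
        case False
        then have "Poly_Mapping.lookup (q \<alpha>) m = 0" if "\<alpha> \<in> ?X" for \<alpha>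
          using q[OF that] unfolding vdeg_le_def by (auto simp: in_keys_iff)
        then show ?thesis
          by (simp add: lookup_sum *)
      qed
    qed
    then have "(\<Sum>\<alpha>\<in>?X. peval (Poly_Mapping.single 0 (c \<alpha>) * q \<alpha>) x) = 0" for x
      by (simp only: peval_sum[symmetric] peval_zero)
    then have "(\<Sum>\<alpha>\<in>?X. c \<alpha> * mon gs \<alpha> (\<phi> x)) = 0" for x
      using q by simp
    then have "\<forall>x\<in>S. (\<Sum>\<alpha>\<in>?X. c \<alpha> * mon gs \<alpha> x) = 0"
      using S by auto
    then show False
      using indep[of d] c(1) unfolding indep_mons_def by blast
  qed
  \<comment> \<open>With m the number of variables, this choice turns the bound
    \<open>(K * (d + 1)) ^ m\<close> into \<open>d * (d + 1) ^ m\<close>, which is below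
    \<open>(d + 1) ^ (m + 1)\<close>.\<close>
  define K where "K = length gs * E + 1"
  define d where "d = K ^ CARD('m)"
  have "(d + 1) ^ (CARD('m) + 1) \<le> (d + 1) ^ length gs"
    using less by (intro power_increasing) auto
  also have "\<dots> \<le> (length gs * (E * d) + 1) ^ CARD('m)"
    by (rule bound)
  also have "\<dots> \<le> (K * (d + 1)) ^ CARD('m)"
    by (rule power_mono) (auto simp: K_def algebra_simps)
  also have "\<dots> = d * (d + 1) ^ CARD('m)"
    by (simp only: power_mult_distrib d_def)
  finally have "(d + 1) * (d + 1) ^ CARD('m) \<le> d * (d + 1) ^ CARD('m)"
    by (simp only: power_add power_one_right mult.commute)
  then show False
    unfolding mult_le_cancel2 by simp
qed

lemma chain_length_bound:
  fixes C :: "nat \<Rightarrow> ('a::field_char_0 ^ 'n::finite) set" and \<phi> :: "'a ^ 'm::finite \<Rightarrow> 'a ^ 'n"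
  assumes C: "\<And>i. i \<le> n \<Longrightarrow> zariski_closed (C i)" "\<And>i. i \<le> n \<Longrightarrow> zariski_irreducible (C i)"
    and chain: "\<And>i. i < n \<Longrightarrow> C i \<subset> C (Suc i)"
    and \<phi>: "\<And>i. polyfun (\<lambda>x. \<phi> x $ i)" and Cn: "C n \<subseteq> range \<phi>"
  shows "n < CARD('m)"
proof -
  have "\<exists>gs. length gs = Suc i \<and> (\<forall>g\<in>set gs. polyfun g) \<and> (\<forall>d. indep_mons gs (C i) d)" if "i \<le> n" for i
    using that
  proof (induction i)
    case 0
    have C0: "zariski_closed (C 0)" "zariski_irreducible (C 0)"
      using C by simp_all
    obtain x where x: "x \<in> C 0"
      using C(2)[of 0] by (auto simp: zariski_irreducible_def)
    then have "x \<noteq> 0"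
      using zariski_closed_0[OF C0(1)] by auto
    then obtain i where i: "x $ i \<noteq> 0"
      by (auto simp: vec_eq_iff)
    \<comment> \<open>The origin acts as an extra bottom step of the chain: a polynomial vanishing
      on the cone \<open>C 0\<close> also vanishes at its apex. This is why n inclusions yield n + 1
      forms.\<close>
    have "indep_mons [\<lambda>x. x $ i] (C 0) d" for d
    proof (rule indep_mons_Cons[where S = "{0}"])
      show "indep_mons [] {0 :: 'a ^ 'n} d"
        by (simp add: indep_mons_def expts_0)
      fix P :: "'a ^ 'n \<Rightarrow> 'a" and z
      assume P: "polyfun P"
      show "P z = 0" if zero: "\<And>x. x \<in> C 0 \<Longrightarrow> P x = 0" and "z \<in> {0}"
      proof -
        obtain p where p: "\<And>e. poly p e = P (cpt (line 0 x) e)"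
          using polyfun_curve[OF P] by blast
        have "p = 0"
        proof (rule poly_eq_zero_if_cofinite[of "{0}"])
          fix e :: 'a assume "e \<notin> {0}"
          then have "e *s x \<in> C 0"
            using zariski_closed_scale[OF C0(1) x] by simp
          then show "poly p e = 0"
            using zero by (simp add: p cpt_line)
        qed simp
        then show ?thesis
          using p[of 0] \<open>z \<in> {0}\<close> by (simp add: cpt_line)
      qed
      show "P z = 0" if "\<And>x. x \<in> C 0 \<Longrightarrow> x $ i * P x = 0" "z \<in> C 0"
        by (rule irreducible_nonzero_divisor[OF C0 formfun_nth x i P that])
    qed (auto simp: polyfun_nth)
    then show ?case
      by (intro exI[of _ "[\<lambda>x. x $ i]"]) (auto simp: polyfun_nth)
  next
    case (Suc k)
    have Ck: "zariski_closed (C (Suc k))" "zariski_irreducible (C (Suc k))"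
      using C Suc.prems by simp_all
    have sub: "C k \<subset> C (Suc k)" and closed: "zariski_closed (C k)"
      using chain C Suc.prems by simp_all
    obtain gs where gs: "length gs = Suc k" "\<forall>g\<in>set gs. polyfun g" "\<forall>d. indep_mons gs (C k) d"
      using Suc.IH[OF Suc_leD[OF Suc.prems]] by blast
    obtain x where x: "x \<in> C (Suc k)" "x \<notin> C k"
      using sub by blast
    have "x \<noteq> 0"
      using x(1) zariski_closed_0[OF Ck(1)] by blast
    moreover have "x \<notin> zariski_closure (C k)"
      using x(2) zariski_closure_id[OF closed] by simp
    ultimately obtain e g where g: "formfun e g" "\<forall>y\<in>C k - {0}. g y = 0" "g x \<noteq> 0"
      unfolding zariski_closure_iff by blast
    have gC: "g y = 0" if "y \<in> C k" for y
      using g(2) that zariski_closed_0[OF closed] by blast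
    have "indep_mons (g # gs) (C (Suc k)) d" for d
    proof (rule indep_mons_Cons[where S = "C k"])
      fix P :: "'a ^ 'n \<Rightarrow> 'a" and z
      assume P: "polyfun P"
      show "P z = 0" if "\<And>x. x \<in> C (Suc k) \<Longrightarrow> P x = 0" "z \<in> C k"
        using that sub by blast
      show "P z = 0" if "\<And>x. x \<in> C (Suc k) \<Longrightarrow> g x * P x = 0" "z \<in> C (Suc k)"
        by (rule irreducible_nonzero_divisor[OF Ck g(1) x(1) g(3) P that])
    qed (use gs gC formfun_imp_polyfun[OF g(1)] in auto)
    then show ?case
      using gs formfun_imp_polyfun[OF g(1)] by (intro exI[of _ "g # gs"]) auto
  qed
  from this[OF order_refl] obtain gs where gs: "length gs = Suc n" "\<forall>g\<in>set gs. polyfun g"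
    "\<forall>d. indep_mons gs (C n) d"
    by blast
  have "length gs \<le> CARD('m)"
    by (rule indep_mons_card_le[OF bspec[OF gs(2)] spec[OF gs(3)] \<phi> Cn])
  then show ?thesis
    using gs(1) by simp
qed

text \<open>The chain gives the lower bound. The upper bound comes from a parametrisation by an
  affine space of one dimension more, the dimension of the cone over \<open>S\<close>.\<close>

lemma proj_dim_eqI:
  fixes C :: "nat \<Rightarrow> ('a::field_char_0 ^ 'n::finite) set" and \<phi> :: "'a ^ 'm::finite \<Rightarrow> 'a ^ 'n"
  assumes "\<And>i. i \<le> n \<Longrightarrow> zariski_closed (C i)" "\<And>i. i \<le> n \<Longrightarrow> zariski_irreducible (C i)"
    and "\<And>i. i < n \<Longrightarrow> C i \<subset> C (Suc i)" and "\<And>i. i \<le> n \<Longrightarrow> C i \<subseteq> S"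
    and "\<And>i. polyfun (\<lambda>x. \<phi> x $ i)" "S \<subseteq> range \<phi>" "CARD('m) = Suc n"
  shows "proj_dim S = n"
  unfolding proj_dim_def
proof (rule cSup_eq_maximum)
  show "n \<in> {n. \<exists>C. (\<forall>i\<le>n. zariski_closed (C i) \<and> zariski_irreducible (C i) \<and> C i \<subseteq> S) \<and>
      (\<forall>i<n. C i \<subset> C (Suc i))}"
    by (rule CollectI, rule exI[of _ C], intro conjI allI impI) (erule assms(1-4))+
  fix k assume "k \<in> {n. \<exists>C. (\<forall>i\<le>n. zariski_closed (C i) \<and> zariski_irreducible (C i) \<and> C i \<subseteq> S) \<and>
      (\<forall>i<n. C i \<subset> C (Suc i))}"
  then obtain C' where C'': "\<forall>i\<le>k. zariski_closed (C' i) \<and> zariski_irreducible (C' i) \<and> C' i \<subseteq> S"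
    "\<forall>i<k. C' i \<subset> C' (Suc i)"
    by (elim CollectE exE conjE)
  then have C': "\<And>i. i \<le> k \<Longrightarrow> zariski_closed (C' i)" "\<And>i. i \<le> k \<Longrightarrow> zariski_irreducible (C' i)"
    and "C' k \<subseteq> S"
    by blast+
  have "k < CARD('m)"
    by (rule chain_length_bound[OF C' C''(2)[rule_format] assms(5) order_trans[OF \<open>C' k \<subseteq> S\<close> assms(6)]])
  then show "k \<le> n"
    using assms(7) by simp
qed

section \<open>Linear algebra\<close>

lemma vec_linearI:
  assumes "\<And>x y. f (x + y) = f x + f y" "\<And>c x. f (c *s x) = c *s f x"
  shows "Vector_Spaces.linear (*s) (*s) (f :: 'a::field ^ 'n \<Rightarrow> 'a ^ 'm)"
  by unfold_locales (simp_all add: assms)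

lemma span_Int_disjoint:
  fixes A C :: "('a::field ^ 'n) set"
  assumes "vec.independent (A \<union> C)" "A \<inter> C = {}" "x \<in> vec.span A" "x \<in> vec.span C"
  shows "x = 0"
proof -
  have fin: "finite A" "finite C"
    using vec.independent_bound_general[OF assms(1)] by auto
  have ind: "vec.independent A" "vec.independent C"
    using assms(1) vec.independent_mono by blast+
  have "{x + y |x y. x \<in> vec.span A \<and> y \<in> vec.span C} = vec.span (A \<union> C)"
    by (auto simp: vec.span_Un)
  moreover have "vec.dim (vec.span (A \<union> C)) = card A + card C"
    using assms(1,2) fin by (simp add: vec.dim_span_eq_card_independent card_Un_disjoint del: vec.dim_span)
  ultimately have "vec.dim (vec.span A \<inter> vec.span C) = 0"
    using vec.dim_sums_Int[of "vec.span A" "vec.span C"] ind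
    by (simp add: vec.dim_span_eq_card_independent del: vec.dim_span)
  then have "vec.span A \<inter> vec.span C \<subseteq> {0}"
    by simp
  then show ?thesis
    using assms(3,4) by blast
qed

lemma vec_rank_nullity:
  fixes A :: "'a::field ^ 'n ^ 'm" and S :: "('a ^ 'n) set"
  assumes S: "vec.subspace S"
  shows "vec.dim ((*v) A ` S) + vec.dim {x\<in>S. A *v x = 0} = vec.dim S"
proof -
  let ?K = "{x\<in>S. A *v x = 0}"
  obtain B where B: "B \<subseteq> ?K" "vec.independent B" "?K \<subseteq> vec.span B" "card B = vec.dim ?K"
    using vec.basis_exists by blast
  have "B \<subseteq> S"
    using B(1) by auto
  then obtain C where C: "B \<subseteq> C" "C \<subseteq> S" "vec.independent C" "S \<subseteq> vec.span C"
    using vec.maximal_independent_subset_extend[OF _ B(2)] by blast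
  let ?D = "C - B"
  have finC: "finite C"
    using C(3) vec.independent_bound_general by blast
  have spanC: "vec.span C = S"
    using C(2,4) S vec.span_minimal[of C S] by blast
  have D: "vec.independent ?D"
    using C(3) vec.independent_mono by blast
  have inj: "inj_on ((*v) A) (vec.span ?D)"
  proof (rule inj_onI)
    fix x y assume x: "x \<in> vec.span ?D" and y: "y \<in> vec.span ?D" and eq: "A *v x = A *v y"
    have xy: "x - y \<in> vec.span ?D"
      using x y vec.span_diff by blast
    have "vec.span ?D \<subseteq> S"
      using vec.span_mono[of ?D C] spanC by blast
    then have "x - y \<in> ?K"
      using xy eq by (auto simp: matrix_vector_mult_diff_distrib)
    then have "x - y \<in> vec.span B"
      using B(3) by blast
    then have "x - y = 0"
      using span_Int_disjoint[of B ?D "x - y"] xy C(1,3) by (simp add: Un_absorb1)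
    then show "x = y"
      by simp
  qed
  have "(*v) A ` S = vec.span ((*v) A ` C)"
    by (simp add: spanC[symmetric] vec.span_image)
  also have "\<dots> = vec.span ((*v) A ` ?D)"
  proof
    have "(*v) A ` C \<subseteq> insert 0 ((*v) A ` ?D)"
      using B(1) by auto
    then show "vec.span ((*v) A ` C) \<subseteq> vec.span ((*v) A ` ?D)"
      using vec.span_mono[of "(*v) A ` C" "insert 0 ((*v) A ` ?D)"] by simp
    show "vec.span ((*v) A ` ?D) \<subseteq> vec.span ((*v) A ` C)"
      by (intro vec.span_mono image_mono) auto
  qed
  finally have "vec.dim ((*v) A ` S) = vec.dim ((*v) A ` ?D)"
    by simp
  also have "\<dots> = vec.dim ?D"
    by (rule vec.dim_image_eq[OF matrix_vector_mul_linear_gen inj])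
  also have "\<dots> = card C - card B"
    using D C(1) finC by (simp add: vec.dim_eq_card_independent card_Diff_subset finite_subset)
  finally show ?thesis
    using B(4) C(1,3) finC spanC vec.dim_span_eq_card_independent[OF C(3)] card_mono[OF finC C(1)] by simp
qed

section \<open>Perturbation of singular matrices and families of kernel vectors\<close>

lemma subspace_range: "vec.subspace (range ((*v) (A :: 'a::field ^ 'n ^ 'm)))"
  using vec.subspace_image[OF vec.subspace_UNIV] by blast

text \<open>\<open>B\<close> sends a basis of the kernel of \<open>M\<close> bijectively to vectors
  completing a basis of the image of \<open>M\<close>, and a complementary basis to zero. Then the
  two images meet only in 0, and so do the two kernels.\<close>

lemma invertible_complement:
  fixes M :: "'a::field ^ 'n ^ 'n"
  obtains B :: "'a ^ 'n ^ 'n" where "invertible (M + B)"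
    "vec.dim (range ((*v) B)) + vec.dim (range ((*v) M)) \<le> CARD('n)"
proof -
  let ?K = "{x. M *v x = 0}" and ?R = "range ((*v) M)"
  have rn: "vec.dim ?R + vec.dim ?K = CARD('n)"
    using vec_rank_nullity[of UNIV M] by (simp add: card_cart_basis)
  have subK: "vec.subspace ?K"
    by (auto simp: vec.subspace_def matrix_vector_right_distrib vector_scalar_commute)
  obtain BK where BK: "BK \<subseteq> ?K" "vec.independent BK" "?K \<subseteq> vec.span BK" "card BK = vec.dim ?K"
    by (rule vec.basis_exists)
  have spanBK: "vec.span BK = ?K"
    using BK(1,3) vec.span_minimal[OF _ subK] by blast
  obtain E where E: "BK \<subseteq> E" "vec.independent E" "UNIV \<subseteq> vec.span E"
    by (rule vec.maximal_independent_subset_extend[OF subset_UNIV BK(2)])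
  obtain BR where BR: "BR \<subseteq> ?R" "vec.independent BR" "?R \<subseteq> vec.span BR" "card BR = vec.dim ?R"
    by (rule vec.basis_exists)
  obtain G where G: "BR \<subseteq> G" "vec.independent G" "UNIV \<subseteq> vec.span G"
    by (rule vec.maximal_independent_subset_extend[OF subset_UNIV BR(2)])
  have fin: "finite G" "finite E"
    using G(2) E(2) vec.independent_bound_general by blast+
  have "card G = CARD('n)"
    using vec.basis_card_eq_dim[OF subset_UNIV G(3,2)] by (simp add: card_cart_basis)
  then have cardD: "card (G - BR) = card BK"
    using rn BR(4) BK(4) card_Diff_subset[OF finite_subset[OF G(1) fin(1)] G(1)] by linarith
  obtain \<beta> where \<beta>: "bij_betw \<beta> BK (G - BR)"
    using finite_same_card_bij[OF finite_subset[OF E(1) fin(2)] finite_Diff[OF fin(1)] cardD[symmetric]]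
    by blast
  obtain g where g: "Vector_Spaces.linear (*s) (*s) g" "\<forall>x\<in>E. g x = (if x \<in> BK then \<beta> x else 0)"
    using vec.linear_independent_extend[OF E(2), of "\<lambda>x. if x \<in> BK then \<beta> x else 0"] by blast
  define B where "B = matrix g"
  have Bg: "(*v) B = g"
    using matrix_works[OF g(1)] by (auto simp: B_def)
  have gBK: "g ` BK = G - BR"
    using image_cong[OF refl, of BK g \<beta>] g(2) E(1) bij_betw_imp_surj_on[OF \<beta>] by (simp add: subset_iff)
  have "g x \<in> insert 0 (G - BR)" if "x \<in> E" for x
  proof (cases "x \<in> BK")
    case True
    then show ?thesis
      unfolding gBK[symmetric] by blast
  qed (use g(2) that in simp)
  then have "g ` E \<subseteq> insert 0 (G - BR)"
    by blast
  then have "vec.span (g ` E) \<subseteq> vec.span (G - BR)"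
    using vec.span_mono[of "g ` E" "insert 0 (G - BR)"] by simp
  moreover have "vec.span E = UNIV"
    using E(3) by blast
  ultimately have "range g \<subseteq> vec.span (G - BR)"
    using vec.linear_span_image[OF g(1), of E] by simp
  then have rangeB: "range ((*v) B) \<subseteq> vec.span (G - BR)"
    by (simp add: Bg)
  then have "vec.dim (range ((*v) B)) \<le> card (G - BR)"
    using vec.dim_le_card fin by blast
  then have dim: "vec.dim (range ((*v) B)) + vec.dim ?R \<le> CARD('n)"
    using cardD BK(4) rn by simp
  have indD: "vec.independent (G - BR)"
    using G(2) vec.independent_mono by blast
  have kerB: "vec.dim {x\<in>?K. B *v x = 0} = 0"
  proof -
    have "(*v) B ` ?K = vec.span (G - BR)"
      unfolding spanBK[symmetric] Bg vec.linear_span_image[OF g(1), symmetric] gBK ..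
    then have "vec.dim ((*v) B ` ?K) = vec.dim ?K"
      using indD cardD BK(4) by (simp add: vec.dim_eq_card_independent)
    then show ?thesis
      using vec_rank_nullity[OF subK, of B] by simp
  qed
  have "v = 0" if v: "(M + B) *v v = 0" for v
  proof -
    have MB: "M *v v = B *v (- v)"
      using v by (simp add: matrix_vector_mult_add_rdistrib add_eq_0_iff2 vec.neg)
    then have "M *v v \<in> vec.span BR" "M *v v \<in> vec.span (G - BR)"
      using BR(3) subsetD[OF rangeB rangeI[of _ "- v"]] unfolding MB[symmetric] by blast+
    then have "M *v v = 0"
      using span_Int_disjoint[of BR "G - BR" "M *v v"] G(1,2) by (simp add: Un_absorb1)
    then have "v \<in> {x\<in>?K. B *v x = 0}"
      using v by (simp add: matrix_vector_mult_add_rdistrib)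
    then show "v = 0"
      using kerB by auto
  qed
  then have "invertible (M + B)"
    by (simp add: invertible_left_inverse matrix_left_invertible_ker)
  then show ?thesis
    using that dim by blast
qed

lemma poly_det: "poly (det M) e = det (\<chi> i j. poly (M $ i $ j) e)"
  by (simp add: det_def poly_sum poly_prod of_int_poly)

text \<open>If \<open>M\<^sub>0\<close> has maximal rank in the pencil, a kernel vector extends to a polynomial family of kernel
  vectors: perturb by a complement \<open>B\<close> of minimal rank and solve with Cramer's rule. Minimality of
  the ranks makes the images of \<open>M\<^sub>0 + \<epsilon> M\<^sub>1\<close> and \<open>B\<close> intersect trivially.\<close>

lemma kernel_section:
  fixes M0 M1 :: "'a::{field, ring_char_0} ^ 'n ^ 'n"
  assumes max: "\<And>e. vec.dim (range ((*v) (M0 + mat e ** M1))) \<le> vec.dim (range ((*v) M0))"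
    and k: "M0 *v k = 0"
  obtains q S where "finite S" "0 \<notin> S" "cpt q 0 = k"
    "\<And>e. e \<notin> S \<Longrightarrow> vec.dim (range ((*v) (M0 + mat e ** M1))) = vec.dim (range ((*v) M0))"
    "\<And>e. e \<notin> S \<Longrightarrow> (M0 + mat e ** M1) *v cpt q e = 0"
proof -
  obtain B where B: "invertible (M0 + B)"
    "vec.dim (range ((*v) B)) + vec.dim (range ((*v) M0)) \<le> CARD('n)"
    using invertible_complement by blast
  define P :: "'a poly ^ 'n ^ 'n" where "P = (\<chi> i j. [:M0 $ i $ j + B $ i $ j, M1 $ i $ j:])"
  define b where "b = B *v k"
  define M where "M e = M0 + mat e ** M1" for e
  have M_nth: "M e $ i $ j = M0 $ i $ j + e * M1 $ i $ j" for e i j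
    by (simp add: M_def matrix_matrix_mult_def mat_def if_distrib[of "\<lambda>x. x * _"] cong: if_cong)
  have MB: "(\<chi> i j. poly (P $ i $ j) e) = M e + B" for e
    by (simp add: P_def vec_eq_iff M_nth)
  define S where "S = {e. poly (det P) e = 0}"
  have det_P: "poly (det P) e = det (M e + B)" for e
    by (simp add: poly_det MB)
  have M0: "M 0 = M0"
    by (simp add: vec_eq_iff M_nth)
  have "det P \<noteq> 0"
    using det_P[of 0] B(1) by (auto simp: M0 invertible_det_nz)
  then have finS: "finite S"
    unfolding S_def by (rule poly_roots_finite)
  have S0: "0 \<notin> S"
    using B(1) by (simp add: S_def det_P M0 invertible_det_nz)
  \<comment> \<open>Cramer's rule divides by \<open>det (M e + B)\<close>. Dividing by its value at
    0 instead keeps the family polynomial and still makes it start at \<open>k\<close>; rescaling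
    does not affect being a kernel vector.\<close>
  define c where "c = inverse (det (M0 + B))"
  define q where "q = (\<lambda>k. smult c (det (\<chi> i j. if j = k then [:b $ i:] else P $ i $ j)))"
  have q: "cpt q e = (\<chi> k. c * det (\<chi> i j. if j = k then b $ i else (M e + B) $ i $ j))" for e
  proof -
    have "(\<chi> i j. poly (if j = k then [:b $ i:] else P $ i $ j) e) =
        (\<chi> i j. if j = k then b $ i else (M e + B) $ i $ j)" for k
      using MB[of e] by (auto simp: vec_eq_iff)
    then show ?thesis
      by (simp add: vec_eq_iff q_def poly_det cong: if_cong)
  qed
  have sol: "(M e + B) *v cpt q e = (c * det (M e + B)) *s b" if "e \<notin> S" for e
  proof -
    let ?y = "(\<chi> k. det (\<chi> i j. if j = k then b $ i else (M e + B) $ i $ j) / det (M e + B)) :: 'a ^ 'n"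
    have nz: "det (M e + B) \<noteq> 0"
      using that by (simp add: S_def det_P)
    have "(M e + B) *v ?y = b"
      using cramer[OF nz] by blast
    moreover have "cpt q e = (c * det (M e + B)) *s ?y"
      using nz by (simp add: q vec_eq_iff)
    ultimately show ?thesis
      by (simp add: vector_scalar_commute)
  qed
  have key: "vec.dim (range ((*v) (M e))) = vec.dim (range ((*v) M0)) \<and>
      range ((*v) (M e)) \<inter> range ((*v) B) \<subseteq> {0}" if e: "e \<notin> S" for e
  proof -
    have "invertible (M e + B)"
      using e by (simp add: S_def det_P invertible_det_nz)
    then obtain C where "(M e + B) ** C = mat 1"
      by (auto simp: invertible_def)
    then have "v = M e *v (C *v v) + B *v (C *v v)" for v
      by (metis matrix_vector_mul_assoc matrix_vector_mul_lid matrix_vector_mult_add_rdistrib)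
    then have "{x + y |x y. x \<in> range ((*v) (M e)) \<and> y \<in> range ((*v) B)} = UNIV"
      by blast
    then have "CARD('n) + vec.dim (range ((*v) (M e)) \<inter> range ((*v) B)) =
        vec.dim (range ((*v) (M e))) + vec.dim (range ((*v) B))"
      using vec.dim_sums_Int[OF subspace_range[of "M e"] subspace_range[of B]]
      by (simp add: card_cart_basis)
    then have "vec.dim (range ((*v) (M e))) = vec.dim (range ((*v) M0))"
      "vec.dim (range ((*v) (M e)) \<inter> range ((*v) B)) = 0"
      using B(2) max[of e, folded M_def] by linarith+
    then show ?thesis
      unfolding vec.dim_eq_0 by blast
  qed
  have ker: "M e *v cpt q e = 0" if e: "e \<notin> S" for e
  proof -
    have "M e *v cpt q e = B *v ((c * det (M e + B)) *s k - cpt q e)"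
      using sol[OF e] by (simp add: matrix_vector_mult_add_rdistrib b_def matrix_vector_mult_diff_distrib
          vector_scalar_commute algebra_simps)
    then have "M e *v cpt q e \<in> range ((*v) (M e)) \<inter> range ((*v) B)"
      by (metis IntI rangeI)
    then show ?thesis
      using key[OF e] by blast
  qed
  have "(M0 + B) *v cpt q 0 = (M0 + B) *v k"
    using sol[OF S0] B(1) k
    by (simp add: M0 c_def invertible_det_nz b_def matrix_vector_mult_add_rdistrib)
  then have "cpt q 0 = k"
    using B(1) invertible_eq_bij[of "M0 + B"] by (simp add: bij_def inj_eq)
  then show ?thesis
    using that[OF finS S0, of q] key ker by (simp add: M_def)
qed

section \<open>Coordinates\<close>

definition dot :: "'a::comm_ring_1 ^ 'n::finite \<Rightarrow> 'a ^ 'n \<Rightarrow> 'a"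
  where "dot x y = (\<Sum>i\<in>UNIV. x $ i * y $ i)"

lemma dot_add_left: "dot (x + y) z = dot x z + dot y z"
  and dot_add_right: "dot z (x + y) = dot z x + dot z y"
  and dot_scale_left: "dot (c *s x) z = c * dot x z"
  and dot_scale_right: "dot z (c *s x) = c * dot z x"
  and dot_diff_left: "dot (x - y) z = dot x z - dot y z"
  and dot_diff_right: "dot z (x - y) = dot z x - dot z y"
  and dot_zero_left [simp]: "dot 0 z = 0"
  and dot_zero_right [simp]: "dot z 0 = 0"
  by (simp_all add: dot_def sum.distrib algebra_simps sum_distrib_left sum_subtractf)

lemmas dot_linear = dot_add_left dot_add_right dot_scale_left dot_scale_right dot_diff_left dot_diff_right

lemma dot_commute: "dot x y = dot y x"
  by (simp add: dot_def mult.commute)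

lemma dot_axis: "dot (axis i 1) x = x $ i"
  by (simp add: dot_def axis_def if_distrib[of "\<lambda>c. c * _"] cong: if_cong)

lemma dot_matrix: "dot (M *v x) y = dot x (transpose M *v y)"
  by (simp add: dot_def matrix_vector_mult_def transpose_def sum_distrib_left sum_distrib_right)
    (subst sum.swap, simp add: mult_ac)

lemma polyfun_dot: "polyfun (dot v)"
  unfolding dot_def by (intro polyfun_sum polyfun_mult polyfun_const polyfun_nth)

lemma dot_eq_0_imp: "(\<And>z. dot v z = 0) \<Longrightarrow> v = 0"
  by (metis dot_axis dot_commute vec_eq_iff zero_index)

lemma pderiv_sum:
  "pderiv (sum f A) = (\<Sum>x\<in>A. pderiv (f x :: 'a::{comm_semiring_1, semiring_no_zero_divisors} poly))"
  using higher_pderiv_sum[of 1 f A] by simp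

lemma exhaust_6: "(x::6) = 0 \<or> x = 1 \<or> x = 2 \<or> x = 3 \<or> x = 4 \<or> x = 5"
proof (induct x)
  case (of_int z)
  then have "z = 0 \<or> z = 1 \<or> z = 2 \<or> z = 3 \<or> z = 4 \<or> z = 5" by fastforce
  then show ?case by auto
qed

lemma UNIV_6: "(UNIV::6 set) = {0, 1, 2, 3, 4, 5}"
  using exhaust_6 by auto

lemma all_6: "(\<forall>i::6. P i) \<longleftrightarrow> P 0 \<and> P 1 \<and> P 2 \<and> P 3 \<and> P 4 \<and> P 5"
  by (metis exhaust_6)

lemma sum_6: "sum f (UNIV::6 set) = f 0 + f 1 + f 2 + f 3 + f 4 + f 5"
  unfolding UNIV_6 by (simp add: add.assoc)

definition vec6 :: "'a \<Rightarrow> 'a \<Rightarrow> 'a \<Rightarrow> 'a \<Rightarrow> 'a \<Rightarrow> 'a \<Rightarrow> 'a ^ 6"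
  where "vec6 a b c d e f = (\<chi> i. if i = 0 then a else if i = 1 then b else if i = 2 then c
    else if i = 3 then d else if i = 4 then e else f)"

lemma vec6_nth [simp]: "vec6 a b c d e f $ 0 = a" "vec6 a b c d e f $ 1 = b" "vec6 a b c d e f $ 2 = c"
  "vec6 a b c d e f $ 3 = d" "vec6 a b c d e f $ 4 = e" "vec6 a b c d e f $ 5 = f"
  by (simp_all add: vec6_def)

lemma vec6_eta: "vec6 (x $ 0) (x $ 1) (x $ 2) (x $ 3) (x $ 4) (x $ 5) = x"
  by (simp add: vec_eq_iff all_6)

lemma vec6_eq_iff: "x = y \<longleftrightarrow> x $ 0 = y $ 0 \<and> x $ 1 = y $ 1 \<and> x $ 2 = y $ 2 \<and>
    x $ 3 = y $ 3 \<and> x $ 4 = y $ 4 \<and> x $ 5 = (y $ 5 :: 'a)" for x y :: "'a ^ 6"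
  by (simp add: vec_eq_iff all_6)

lemma dot_6: "dot x y = x $ 0 * y $ 0 + x $ 1 * y $ 1 + x $ 2 * y $ 2 + x $ 3 * y $ 3 + x $ 4 * y $ 4 +
    x $ 5 * y $ 5" for x y :: "'a::comm_ring_1 ^ 6"
  by (simp add: dot_def sum_6)

section \<open>Cubic forms with vanishing hessian\<close>

text \<open>\<open>F\<close> is the polarisation of a cubic form on \<open>K\<^sup>6\<close>. The last two assumptions say that its hessian
  vanishes identically and that its zero set is not a cone.\<close>

locale hesse_cubic =
  fixes F :: "'a::{alg_closed_field, field_char_0} ^ 6 \<Rightarrow> 'a ^ 6 \<Rightarrow> 'a ^ 6 \<Rightarrow> 'a"
  assumes F_add: "F (x + x') y z = F x y z + F x' y z"
    and F_scale: "F (c *s x) y z = c * F x y z"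
    and F_12: "F x y z = F y x z"
    and F_23: "F x y z = F x z y"
    and F_hess: "\<exists>k. k \<noteq> 0 \<and> (\<forall>z. F x k z = 0)"
    and F_cone: "(\<And>y z. F v y z = 0) \<Longrightarrow> v = 0"
begin

section \<open>Trilinear algebra of \<open>F\<close> and the matrices \<open>H x\<close>\<close>

lemma F_13: "F x y z = F z y x"
  by (metis F_12 F_23)

lemma F_add2: "F x (y + y') z = F x y z + F x y' z"
  by (metis F_add F_12)

lemma F_add3: "F x y (z + z') = F x y z + F x y z'"
  by (metis F_add2 F_23)

lemma F_scale2: "F x (c *s y) z = c * F x y z"
  by (metis F_scale F_12)

lemma F_scale3: "F x y (c *s z) = c * F x y z"
  by (metis F_scale2 F_23)

lemmas F_lin = F_add F_add2 F_add3 F_scale F_scale2 F_scale3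

lemma F_zero [simp]: "F 0 y z = 0" "F x 0 z = 0"
  using F_scale[of 0 0 y z] F_scale2[of x 0 0 z] F_scale3[of x y 0 0] by simp_all

lemma F_diff: "F (x - x') y z = F x y z - F x' y z"
  using F_add[of "x - x'" x' y z] by simp

lemma F_minus2: "F x (- y) z = - F x y z"
  using F_add2[of x y "- y" z] by (simp add: eq_neg_iff_add_eq_0 add.commute)

lemma F_sum: "F (sum g A) y z = (\<Sum>i\<in>A. F (g i) y z)"
  by (induction A rule: infinite_finite_induct) (simp_all add: F_add)

lemma F_expand: "F x y z = (\<Sum>i\<in>UNIV. x $ i * F (axis i 1) y z)"
proof -
  have "x = (\<Sum>i\<in>UNIV. x $ i *s axis i 1)"
    by (simp add: vec_eq_iff axis_def if_distrib[of "\<lambda>c. _ * c"] cong: if_cong)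
  then have "F x y z = F (\<Sum>i\<in>UNIV. x $ i *s axis i 1) y z"
    by simp
  then show ?thesis
    by (simp add: F_sum F_scale)
qed

definition H :: "'a ^ 6 \<Rightarrow> 'a ^ 6 ^ 6"
  where "H x = (\<chi> i j. F x (axis i 1) (axis j 1))"

lemma H_nth: "(H x *v y) $ i = F x y (axis i 1)"
proof -
  have "F x y (axis i 1) = F y x (axis i 1)"
    by (rule F_12)
  also have "\<dots> = (\<Sum>j\<in>UNIV. y $ j * F (axis j 1) x (axis i 1))"
    by (rule F_expand)
  also have "\<dots> = (H x *v y) $ i"
    by (simp add: H_def matrix_vector_mult_def) (metis (no_types, lifting) F_12 F_23 mult.commute)
  finally show ?thesis ..
qed

lemma dot_H: "dot (H x *v y) z = F x y z"
  unfolding F_13[of x y z] F_expand[of z] by (simp add: dot_def H_nth F_13[of x y] mult.commute)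

lemma H_zero_iff: "H x *v y = 0 \<longleftrightarrow> (\<forall>z. F x y z = 0)"
  by (metis H_nth dot_H dot_zero_left vec_eq_iff zero_index)

lemma H_line: "H (x + e *s y) = H x + mat e ** H y"
proof -
  have "(mat e ** H y) $ i $ j = e * H y $ i $ j" for i j
    by (simp add: matrix_matrix_mult_def mat_def if_distrib[of "\<lambda>x. x * _"] cong: if_cong)
  then show ?thesis
    by (simp add: vec_eq_iff H_def F_lin)
qed

text \<open>Polarisation: a vector whose quadric vanishes identically would be a vertex. Most
  contradictions below are reached in this way.\<close>

lemma diagonal_zero:
  assumes "\<And>x. F v x x = 0"
  shows "v = 0"
proof (rule F_cone)
  fix y z
  have "2 * F v y z = F v (y + z) (y + z) - F v y y - F v z z"
    by (simp add: F_lin F_23[of v z y])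
  then show "F v y z = 0"
    by (simp add: assms)
qed

section \<open>Points of maximal rank and their kernel vectors\<close>

definition generic :: "'a ^ 6 \<Rightarrow> bool"
  where "generic x \<longleftrightarrow> (\<forall>x'. vec.dim (range ((*v) (H x'))) \<le> vec.dim (range ((*v) (H x))))"

definition inc :: "'a ^ 6 \<Rightarrow> 'a ^ 6 \<Rightarrow> bool"
  where "inc x k \<longleftrightarrow> generic x \<and> (\<forall>z. F x k z = 0)"

lemma generic_exists: "\<exists>x. generic x"
proof -
  have "vec.dim (range ((*v) (H y))) < 7" for y
    by (rule le_less_trans[OF dim_subset_UNIV_cart_gen]) simp
  then have "\<exists>x. \<forall>y. vec.dim (range ((*v) (H y))) \<le> vec.dim (range ((*v) (H x)))"
    using ex_has_greatest_nat[of "\<lambda>_. True" 0 "\<lambda>x. vec.dim (range ((*v) (H x)))" 7] by blast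
  then show ?thesis
    by (simp add: generic_def)
qed

lemma inc_exists: "generic x \<Longrightarrow> \<exists>k. k \<noteq> 0 \<and> inc x k"
  using F_hess[of x] by (auto simp: inc_def)

lemma inc_section:
  assumes "inc x k"
  obtains q S where "finite S" "0 \<notin> S" "cpt q 0 = k" "\<And>e. e \<notin> S \<Longrightarrow> inc (x + e *s y) (cpt q e)"
proof -
  have gx: "generic x" and kx: "H x *v k = 0"
    using assms by (auto simp: inc_def H_zero_iff)
  obtain q S where q: "finite S" "0 \<notin> S" "cpt q 0 = k"
    "\<And>e. e \<notin> S \<Longrightarrow> vec.dim (range ((*v) (H x + mat e ** H y))) = vec.dim (range ((*v) (H x)))"
    "\<And>e. e \<notin> S \<Longrightarrow> (H x + mat e ** H y) *v cpt q e = 0"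
    by (rule kernel_section[of "H x" "H y" k]) (use gx kx in \<open>auto simp: generic_def H_line[symmetric]\<close>)
  have "inc (x + e *s y) (cpt q e)" if "e \<notin> S" for e
    using q(4,5)[OF that] gx by (simp add: inc_def generic_def H_line[symmetric] H_zero_iff)
  then show ?thesis
    using that q by blast
qed

text \<open>On the line from a generic point to \<open>a\<close>, all but finitely many points are
  generic, and \<phi> has only finitely many zeros because it is nonzero at
  \<open>a\<close>.\<close>

lemma generic_avoid:
  assumes \<phi>: "polyfun \<phi>" and "\<phi> a \<noteq> 0"
  obtains x where "generic x" "\<phi> x \<noteq> 0"
proof -
  obtain x where x: "generic x"
    using generic_exists by blast
  then have "inc x 0"
    by (simp add: inc_def)
  then obtain q S where q: "finite S" "\<And>e. e \<notin> S \<Longrightarrow> inc (x + e *s (a - x)) (cpt q e)"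
    using inc_section by metis
  obtain p where p: "\<And>e. poly p e = \<phi> (cpt (line x (a - x)) e)"
    using polyfun_curve[OF \<phi>] by blast
  have "\<exists>e. e \<notin> S \<and> poly p e \<noteq> 0"
  proof (rule ccontr)
    assume "\<nexists>e. e \<notin> S \<and> poly p e \<noteq> 0"
    then have "p = 0"
      using q(1) by (intro poly_eq_zero_if_cofinite[of S]) auto
    then show False
      using p[of 1] assms(2) by (simp add: cpt_line)
  qed
  then show ?thesis
    using that q(2) p by (auto simp: inc_def cpt_line)
qed

text \<open>Let \<open>q\<close> be a family of kernel vectors through \<open>k\<close> over the
  line \<open>x + e *s y\<close>. The function \<open>F (x + e *s y) (cpt q e) k'\<close> vanishes,
  and its derivative at 0 is \<open>F y k k'\<close> plus a term that is zero because
  \<open>k'\<close> lies in the kernel at the same point \<open>x\<close>.\<close>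

lemma inc_isotropic:
  assumes "inc x k" "inc x k'"
  shows "F k k' y = 0"
proof -
  obtain q S where q: "finite S" "0 \<notin> S" "cpt q 0 = k" "\<And>e. e \<notin> S \<Longrightarrow> inc (x + e *s y) (cpt q e)"
    using inc_section[OF assms(1)] by metis
  define p where "p = (\<Sum>i\<in>UNIV. q i * [:F (axis i 1) x k', F (axis i 1) y k':])"
  have p: "poly p e = F (x + e *s y) (cpt q e) k'" for e
    unfolding F_12[of "x + e *s y"] F_expand[of "cpt q e"]
    by (simp add: p_def poly_sum F_lin algebra_simps)
  have "p = 0"
    using q by (intro poly_eq_zero_if_cofinite[of S]) (auto simp: p inc_def)
  then have "poly (pderiv p) 0 = 0"
    by simp
  moreover have "poly (pderiv p) 0 =
      (\<Sum>i\<in>UNIV. poly (pderiv (q i)) 0 * F (axis i 1) x k') + (\<Sum>i\<in>UNIV. poly (q i) 0 * F (axis i 1) y k')"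
    by (simp add: p_def pderiv_sum poly_sum pderiv_mult pderiv_pCons sum.distrib add.commute mult.commute
        del: mult_pCons_right)
  moreover have "F (axis i 1) x k' = 0" for i
    using assms(2) by (metis F_12 F_23 inc_def)
  moreover have "(\<Sum>i\<in>UNIV. poly (q i) 0 * F (axis i 1) y k') = F k y k'"
    unfolding q(3)[symmetric] F_expand[of "cpt q 0"] by simp
  ultimately show ?thesis
    by (simp add: F_23[of k k' y])
qed

text \<open>\<open>k1\<close> is the derivative at 0 of a family of kernel vectors. Its three
  properties are the derivatives of the kernel equation, of the isotropy of each member, and of any
  linear equation satisfied by all kernel vectors.\<close>

lemma inc_tangent:
  assumes "inc x k"
  obtains k1 where "\<And>z. F x k1 z = - F y k z" "\<And>z. F k k1 z = 0"
    "\<And>\<phi>. (\<And>x' k'. inc x' k' \<Longrightarrow> dot \<phi> k' = 0) \<Longrightarrow> dot \<phi> k1 = 0"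
proof -
  obtain q S where q: "finite S" "0 \<notin> S" "cpt q 0 = k" "\<And>e. e \<notin> S \<Longrightarrow> inc (x + e *s y) (cpt q e)"
    using inc_section[OF assms(1)] by metis
  define k1 where "k1 = (\<chi> i. poly (pderiv (q i)) 0)"
  have "F x k1 z = - F y k z" for z
  proof -
    define p where "p = (\<Sum>i\<in>UNIV. q i * [:F (axis i 1) x z, F (axis i 1) y z:])"
    have p: "poly p e = F (x + e *s y) (cpt q e) z" for e
      unfolding F_12[of "x + e *s y"] F_expand[of "cpt q e"]
      by (simp add: p_def poly_sum F_lin algebra_simps)
    have "p = 0"
      using q by (intro poly_eq_zero_if_cofinite[of S]) (auto simp: p inc_def)
    then have "poly (pderiv p) 0 = 0"
      by simp
    moreover have "poly (pderiv p) 0 =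
        (\<Sum>i\<in>UNIV. k1 $ i * F (axis i 1) x z) + (\<Sum>i\<in>UNIV. cpt q 0 $ i * F (axis i 1) y z)"
      by (simp add: p_def pderiv_sum poly_sum pderiv_mult pderiv_pCons sum.distrib add.commute mult.commute
          k1_def del: mult_pCons_right)
    ultimately have "F k1 x z + F k y z = 0"
      unfolding F_expand[of k1] F_expand[of k] q(3) by simp
    then show ?thesis
      by (simp add: F_12[of x k1] F_12[of y k] add_eq_0_iff2)
  qed
  moreover have "F k k1 z = 0" for z
  proof -
    define p where "p = (\<Sum>i\<in>UNIV. q i * (\<Sum>j\<in>UNIV. q j * [:F (axis i 1) (axis j 1) z:]))"
    have p: "poly p e = F (cpt q e) (cpt q e) z" for e
    proof -
      have "F (cpt q e) (cpt q e) z = (\<Sum>i\<in>UNIV. poly (q i) e * F (cpt q e) (axis i 1) z)"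
        unfolding F_expand[of "cpt q e" "cpt q e"] by (simp add: F_12)
      also have "\<dots> = (\<Sum>i\<in>UNIV. poly (q i) e * (\<Sum>j\<in>UNIV. poly (q j) e * F (axis j 1) (axis i 1) z))"
        unfolding F_expand[of "cpt q e" "axis _ 1"] by simp
      also have "\<dots> = poly p e"
        by (simp add: p_def poly_sum F_12 mult.commute)
      finally show ?thesis ..
    qed
    have "p = 0"
      using q by (intro poly_eq_zero_if_cofinite[of S]) (auto simp: p intro: inc_isotropic)
    then have "poly (pderiv p) 0 = 0"
      by simp
    moreover have "poly (pderiv p) 0 =
        (\<Sum>i\<in>UNIV. cpt q 0 $ i * (\<Sum>j\<in>UNIV. k1 $ j * F (axis j 1) (axis i 1) z)) +
        (\<Sum>i\<in>UNIV. k1 $ i * (\<Sum>j\<in>UNIV. cpt q 0 $ j * F (axis j 1) (axis i 1) z))"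
      by (simp add: p_def pderiv_sum poly_sum pderiv_mult pderiv_pCons sum.distrib k1_def
          F_12 mult.commute add.commute del: mult_pCons_right)
    moreover have "(\<Sum>i\<in>UNIV. cpt q 0 $ i * (\<Sum>j\<in>UNIV. k1 $ j * F (axis j 1) (axis i 1) z)) = F k k1 z"
      unfolding F_expand[of k1, symmetric] q(3) F_12[of k1] F_expand[of k k1] ..
    moreover have "(\<Sum>i\<in>UNIV. k1 $ i * (\<Sum>j\<in>UNIV. cpt q 0 $ j * F (axis j 1) (axis i 1) z)) = F k k1 z"
      unfolding q(3) F_expand[of k, symmetric] F_12[of k] F_expand[of k1 k] ..
    ultimately show ?thesis
      by simp
  qed
  moreover have "dot \<phi> k1 = 0" if \<phi>: "\<And>x' k'. inc x' k' \<Longrightarrow> dot \<phi> k' = 0" for \<phi>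
  proof -
    define p where "p = (\<Sum>i\<in>UNIV. [:\<phi> $ i:] * q i)"
    have p: "poly p e = dot \<phi> (cpt q e)" for e
      by (simp add: p_def poly_sum dot_def)
    have "p = 0"
      using q \<phi> by (intro poly_eq_zero_if_cofinite[of S]) (auto simp: p)
    then have "poly (pderiv p) 0 = 0"
      by simp
    then show ?thesis
      by (simp add: p_def pderiv_sum poly_sum pderiv_smult k1_def dot_def)
  qed
  ultimately show ?thesis
    using that by blast
qed

text \<open>The derivatives \<open>k1 y\<close> together with \<open>k\<close> span a space
  \<open>T\<close> in the kernel of \<open>H k\<close>, while \<open>H x\<close> maps
  \<open>T\<close> over the image of \<open>H k\<close> and kills \<open>k\<close>. So the rank of
  \<open>H k\<close> is less than \<open>dim T\<close>, which is at most 6 minus that rank.\<close>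

lemma rank_le_2:
  assumes "inc x k"
  shows "vec.dim (range ((*v) (H k))) \<le> 2"
proof (cases "k = 0")
  case True
  then have "H k *v y = 0" for y
    by (simp add: H_zero_iff)
  then have "range ((*v) (H k)) \<subseteq> {0}"
    by blast
  then have "vec.dim (range ((*v) (H k))) = 0"
    unfolding vec.dim_eq_0 .
  then show ?thesis
    by linarith
next
  case False
  have "\<exists>k1. \<forall>y. (\<forall>z. F x (k1 y) z = - F y k z) \<and> (\<forall>z. F k (k1 y) z = 0)"
    by (rule choice, rule allI, rule inc_tangent[OF assms]) blast
  then obtain k1 where k1: "\<And>y z. F x (k1 y) z = - F y k z" "\<And>y z. F k (k1 y) z = 0"
    by blast
  define T where "T = vec.span (insert k (range k1))"
  have T: "vec.subspace T"
    by (simp add: T_def vec.subspace_span)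
  have subK: "vec.subspace {t. H k *v t = 0}"
    by (auto simp: vec.subspace_def matrix_vector_right_distrib vector_scalar_commute)
  have "insert k (range k1) \<subseteq> {t. H k *v t = 0}"
    using k1(2) inc_isotropic[OF assms assms] by (auto simp: H_zero_iff)
  then have "T \<subseteq> {t. H k *v t = 0}"
    unfolding T_def using vec.span_minimal subK by blast
  then have "vec.dim T \<le> vec.dim {t. H k *v t = 0}"
    by (rule vec.dim_subset)
  moreover have "vec.dim (range ((*v) (H k))) + vec.dim {t. H k *v t = 0} = 6"
    using vec_rank_nullity[OF vec.subspace_UNIV, of "H k"] by (simp add: card_cart_basis)
  moreover have "vec.dim ((*v) (H x) ` T) + vec.dim {t\<in>T. H x *v t = 0} = vec.dim T"
    by (rule vec_rank_nullity[OF T])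
  moreover have "vec.dim {t\<in>T. H x *v t = 0} \<noteq> 0"
  proof -
    have "k \<in> {t\<in>T. H x *v t = 0}"
      using assms by (auto simp: T_def inc_def H_zero_iff intro: vec.span_base)
    then show ?thesis
      using False unfolding vec.dim_eq_0 by blast
  qed
  moreover have "vec.dim (range ((*v) (H k))) \<le> vec.dim ((*v) (H x) ` T)"
  proof (rule vec.dim_subset, clarify)
    fix y
    have "H k *v y = H x *v (- k1 y)"
    proof (rule vec_eq_iff[THEN iffD2], rule allI)
      fix i
      show "(H k *v y) $ i = (H x *v (- k1 y)) $ i"
        using k1(1)[of y "axis i 1"] by (simp add: H_nth F_minus2 F_12[of k y])
    qed
    moreover have "- k1 y \<in> T"
      by (simp add: T_def vec.span_base vec.span_neg)
    ultimately show "H k *v y \<in> (*v) (H x) ` T"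
      by blast
  qed
  ultimately show ?thesis
    by linarith
qed

section \<open>Isotropy of kernel vectors at different points\<close>

lemma dim_3_vectors:
  fixes R :: "('a ^ 6) set"
  assumes "vec.subspace R" "vec.dim R \<le> 2" "u \<in> R" "v \<in> R" "w \<in> R" "u \<noteq> 0" "w \<notin> vec.span {u, v}"
  obtains c where "v = c *s u"
proof -
  have "v \<in> vec.span {u}"
  proof (rule ccontr)
    assume "v \<notin> vec.span {u}"
    then have "vec.dim {v, u} = 2"
      using assms(6) by (subst vec.dim_insert) simp
    then have "vec.dim {w, v, u} = 3"
      using assms(7) by (subst vec.dim_insert) (simp add: insert_commute)
    moreover have "vec.dim {w, v, u} \<le> vec.dim R"
      using assms(3-5) by (intro vec.dim_subset) auto
    ultimately show False
      using assms(2) by simp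
  qed
  then show ?thesis
    using that by (auto simp: vec.span_singleton)
qed

text \<open>\<open>H k *v k'\<close> and \<open>H k *v x'\<close> are orthogonal to
  \<open>k'\<close>, by isotropy and by the kernel equation at \<open>x'\<close>, but
  \<open>H k *v y\<close> is not. Rank at most two then makes the second a multiple of the first,
  and the first is orthogonal to \<open>x'\<close>.\<close>

lemma pair_zero_or:
  assumes "inc x k" "inc x' k'" "F k k' y \<noteq> 0"
  shows "F k x' x' = 0"
proof -
  let ?R = "range ((*v) (H k))" and ?u = "H k *v k'" and ?v = "H k *v x'" and ?w = "H k *v y"
  have u: "dot ?u k' = 0"
    using inc_isotropic[OF assms(2,2), of k] by (simp add: dot_H F_13)
  have v: "dot ?v k' = 0"
    using assms(2) by (simp add: dot_H inc_def) (metis F_12 F_13)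
  have ux: "dot ?u x' = 0"
    using assms(2) by (simp add: dot_H inc_def) (metis F_12 F_13)
  have "dot z k' = 0" if "z \<in> vec.span {?u, ?v}" for z
    using that u v by (auto simp: vec.span_insert dot_linear)
      (metis add_0_right diff_eq_eq dot_add_left dot_scale_left mult_zero_right)
  moreover have "dot ?w k' \<noteq> 0"
    using assms(3) by (simp add: dot_H F_23)
  ultimately have "?w \<notin> vec.span {?u, ?v}"
    by blast
  moreover have "?u \<noteq> 0"
    using assms(3) by (metis H_zero_iff)
  ultimately obtain c where "?v = c *s ?u"
    using dim_3_vectors[OF subspace_range rank_le_2[OF assms(1)], of ?u ?v ?w] by blast
  then have "dot ?v x' = c * dot ?u x'"
    by (simp add: dot_scale_left)
  then show ?thesis
    using ux by (simp add: dot_H)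
qed

lemma quadratic_cofinite:
  assumes "finite S" "\<And>e. e \<notin> S \<Longrightarrow> F w (x + e *s d) (x + e *s d) = 0"
  shows "F w (x + d) (x + d) = 0"
proof -
  let ?p = "[:F w x x, 2 * F w x d, F w d d:]"
  have p: "poly ?p e = F w (x + e *s d) (x + e *s d)" for e
    by (simp add: F_lin F_23[of w d x] algebra_simps)
  have "?p = 0"
    using assms by (intro poly_eq_zero_if_cofinite[of S]) (auto simp only: p)
  then show ?thesis
    using p[of 1] by simp
qed

text \<open>A nonzero value persists for almost all parameters when \<open>x'\<close> moves along a
  line together with its kernel vector. Hence \<open>F k x1 x1\<close> vanishes at almost all points
  of every line through \<open>x'\<close>, so for all \<open>x1\<close>, and \<open>k\<close> would
  be zero.\<close>

lemma pair_isotropic: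
  assumes "inc x k" "inc x' k'"
  shows "F k k' y = 0"
proof (rule ccontr)
  assume nz: "F k k' y \<noteq> 0"
  have "F k x1 x1 = 0" for x1
  proof -
    obtain q S where q: "finite S" "0 \<notin> S" "cpt q 0 = k'"
      "\<And>e. e \<notin> S \<Longrightarrow> inc (x' + e *s (x1 - x')) (cpt q e)"
      using inc_section[OF assms(2)] by metis
    define p where "p = (\<Sum>i\<in>UNIV. q i * [:F (axis i 1) k y:])"
    have p: "poly p e = F k (cpt q e) y" for e
      unfolding F_12[of k] F_expand[of "cpt q e"] by (simp add: p_def poly_sum mult.commute)
    have "p \<noteq> 0"
      using p[of 0] nz q(3) by auto
    then have fin: "finite (S \<union> {e. poly p e = 0})"
      using q(1) poly_roots_finite by blast
    have "F k (x' + (x1 - x')) (x' + (x1 - x')) = 0"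
      by (rule quadratic_cofinite[OF fin]) (use q(4) pair_zero_or[OF assms(1)] p in auto)
    then show ?thesis
      by simp
  qed
  then have "k = 0"
    by (rule diagonal_zero)
  then show False
    using nz by simp
qed

text \<open>The linear span of all kernel vectors, described by the linear equations it satisfies so that it
  visibly contains the derivatives of families of kernel vectors.\<close>

definition U :: "('a ^ 6) set"
  where "U = {u. \<forall>\<phi>. (\<forall>x k. inc x k \<longrightarrow> dot \<phi> k = 0) \<longrightarrow> dot \<phi> u = 0}"

lemma subspace_U: "vec.subspace U"
  by (auto simp: vec.subspace_def U_def dot_linear)

lemma inc_U: "inc x k \<Longrightarrow> k \<in> U"
  by (auto simp: U_def)

text \<open>Isotropy passes from kernel vectors to \<open>U\<close> in one argument at a time: with
  the other arguments fixed it is a linear equation of the kind that defines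
  \<open>U\<close>.\<close>

lemma U_isotropic:
  assumes "u \<in> U" "u' \<in> U"
  shows "F u u' z = 0"
proof -
  have 1: "F k v z = 0" if "inc x k" "v \<in> U" for x k v
  proof -
    have "\<forall>x' k'. inc x' k' \<longrightarrow> dot (H k *v z) k' = 0"
      using pair_isotropic[OF that(1)] by (simp add: dot_H F_23[of k z])
    then have "dot (H k *v z) v = 0"
      using that(2) by (auto simp: U_def)
    then show ?thesis
      by (simp add: dot_H F_23[of k z])
  qed
  have "\<forall>x' k'. inc x' k' \<longrightarrow> dot (H u *v z) k' = 0"
    using 1 assms(1) by (auto simp: dot_H) (metis F_12 F_13)
  then have "dot (H u *v z) u' = 0"
    using assms(2) by (auto simp: U_def)
  then show ?thesis
    by (simp add: dot_H F_23[of u z])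
qed

section \<open>Bounds on the dimension of \<open>U\<close> and on the rank of
  \<open>H k\<close>\<close>

lemma subset_pair_if_card_le_2:
  assumes "finite C" "card C \<le> 2"
  shows "\<exists>a b. C \<subseteq> {a, b}"
proof -
  consider "card C = 0" | "card C = 1" | "card C = 2"
    using assms(2) by linarith
  then show ?thesis
    by cases (use assms(1) in \<open>auto simp: card_1_singleton_iff card_2_iff\<close>)
qed

text \<open>By isotropy the quadratic form of \<open>u\<close> depends on its arguments only modulo
  \<open>U\<close>. If two vectors \<open>a\<close>, \<open>b\<close> complete \<open>U\<close>, it
  is given by three coefficients, which determine \<open>u\<close> by \<open>diagonal_zero\<close>;
  so a space of dimension at least four would embed in dimension three.\<close>

lemma dim_U: "vec.dim U \<le> 3"
proof (rule ccontr)
  assume "\<not> vec.dim U \<le> 3"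
  then have dimU: "vec.dim U \<ge> 4"
    by simp
  obtain B where B: "B \<subseteq> U" "vec.independent B" "U \<subseteq> vec.span B" "card B = vec.dim U"
    by (rule vec.basis_exists)
  obtain C where C: "B \<subseteq> C" "vec.independent C" "UNIV \<subseteq> vec.span C"
    by (rule vec.maximal_independent_subset_extend[OF subset_UNIV B(2)])
  have fin: "finite C"
    using C(2) vec.independent_bound_general by blast
  have "card C = 6"
    using vec.basis_card_eq_dim[OF subset_UNIV C(3,2)] by (simp add: card_cart_basis)
  then have "card (C - B) \<le> 2"
    using card_Diff_subset[OF finite_subset[OF C(1) fin] C(1)] B(4) dimU by linarith
  then obtain a b where ab: "C - B \<subseteq> {a, b}"
    using subset_pair_if_card_le_2[of "C - B"] fin by blast
  then have "C \<subseteq> insert a (insert b B)"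
    by blast
  then have span: "v \<in> vec.span (insert a (insert b B))" for v
    using C(3) vec.span_mono by blast
  have spanB: "vec.span B \<subseteq> U"
    using vec.span_minimal[OF B(1) subspace_U] .
  have dec: "\<exists>u s t. u \<in> U \<and> v = u + s *s a + t *s b" for v
  proof -
    obtain s where s: "v - s *s a \<in> vec.span (insert b B)"
      using span[of v] vec.span_breakdown_eq by blast
    then obtain t where "v - s *s a - t *s b \<in> vec.span B"
      using vec.span_breakdown_eq by blast
    then have "v - s *s a - t *s b \<in> U"
      using spanB by blast
    then show ?thesis
      by (intro exI[of _ "v - s *s a - t *s b"] exI[of _ s] exI[of _ t]) simp
  qed
  define L where "L u = vec6 (F u a a) (F u a b) (F u b b) 0 0 0" for u
  have lin: "Vector_Spaces.linear (*s) (*s) L"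
    by (rule vec_linearI) (simp_all add: L_def vec6_eq_iff F_add F_scale)
  have L_mat: "(*v) (matrix L) = L"
    using matrix_works[OF lin] by auto
  have "u = 0" if u: "u \<in> U" "L u = 0" for u
  proof (rule diagonal_zero)
    fix v
    obtain w s t where v: "w \<in> U" "v = w + s *s a + t *s b"
      using dec by blast
    have "F u a a = 0" "F u a b = 0" "F u b b = 0"
      using u(2) by (simp_all add: L_def vec6_eq_iff)
    moreover have "F u w z = 0" "F u z w = 0" for z
      using U_isotropic[OF u(1) v(1), of z] by (simp_all add: F_23[of u z w])
    ultimately show "F u v v = 0"
      by (simp add: v(2) F_lin F_23[of u b a])
  qed
  then have "{u\<in>U. L u = 0} \<subseteq> {0}"
    by blast
  then have "vec.dim {u\<in>U. L u = 0} = 0"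
    unfolding vec.dim_eq_0 .
  moreover have "vec.dim (L ` U) \<le> vec.dim {x::'a^6. \<forall>i. i \<notin> {0, 1, 2} \<longrightarrow> x $ i = 0}"
    by (rule vec.dim_subset) (auto simp: L_def vec6_def)
  moreover have "vec.dim {x::'a^6. \<forall>i. i \<notin> {0, 1, 2} \<longrightarrow> x $ i = 0} = 3"
    by (subst dim_substandard_cart) simp
  ultimately show False
    using vec_rank_nullity[OF subspace_U, of "matrix L"] dimU unfolding L_mat by linarith
qed

text \<open>The nonzero minor gives \<open>H k\<close> rank at least two. Its image lies in the
  image of \<open>U\<close> under \<open>H x\<close>, which has dimension at most two since
  \<open>k\<close> is lost, so both agree. Writing \<open>H x *v w\<close> as
  \<open>H k *v y\<close> and pairing with \<open>x\<close> gives zero by the kernel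
  equation.\<close>

lemma large_rank_degenerate:
  assumes "inc x k" "F k u u' * F k v v' \<noteq> F k u v' * F k v u'" "w \<in> U"
  shows "F x x w = 0"
proof -
  let ?R = "range ((*v) (H k))" and ?HU = "(*v) (H x) ` U"
  have k: "k \<in> {u\<in>U. H x *v u = 0}" "k \<noteq> 0"
    using assms(1,2) inc_U by (auto simp: H_zero_iff inc_def)
  then have "vec.dim {u\<in>U. H x *v u = 0} \<noteq> 0"
    unfolding vec.dim_eq_0 by blast
  then have HU: "vec.dim ?HU \<le> 2"
    using vec_rank_nullity[OF subspace_U, of "H x"] dim_U by linarith
  have ne0: "H k *v u \<noteq> 0"
  proof
    assume "H k *v u = 0"
    then have "F k u z = 0" for z
      by (simp add: H_zero_iff)
    then show False
      using assms(2) by simp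
  qed
  have "H k *v v \<notin> vec.span {H k *v u}"
  proof
    assume "H k *v v \<in> vec.span {H k *v u}"
    then obtain c where "H k *v v = c *s (H k *v u)"
      by (auto simp: vec.span_singleton)
    then have "F k v z = c * F k u z" for z
      by (metis dot_H dot_scale_left)
    then show False
      using assms(2) by (simp add: mult_ac)
  qed
  then have "vec.dim {H k *v v, H k *v u} = 2"
    using ne0 by (subst vec.dim_insert) simp
  moreover have "vec.dim {H k *v v, H k *v u} \<le> vec.dim ?R"
    by (rule vec.dim_subset) blast
  ultimately have R: "vec.dim ?R \<ge> vec.dim ?HU"
    using HU by linarith
  have sub: "?R \<subseteq> ?HU"
  proof clarify
    fix y
    obtain k1 where k1: "\<And>z. F x k1 z = - F y k z"
      "\<And>\<phi>. (\<And>x' k'. inc x' k' \<Longrightarrow> dot \<phi> k' = 0) \<Longrightarrow> dot \<phi> k1 = 0"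
      using inc_tangent[OF assms(1)] by metis
    have "k1 \<in> U"
      using k1(2) by (auto simp: U_def)
    then have "- k1 \<in> U"
      using subspace_U vec.subspace_neg by blast
    moreover have "H k *v y = H x *v (- k1)"
      using k1(1) by (simp add: vec_eq_iff H_nth F_minus2 F_12[of k y])
    ultimately show "H k *v y \<in> ?HU"
      by blast
  qed
  have "?R = ?HU"
    using vec.subspace_dim_equal[OF subspace_range _ sub R] vec.subspace_image[OF subspace_U] by blast
  then obtain y where "H x *v w = H k *v y"
    using assms(3) by blast
  then have "F x w x = F k y x"
    by (metis dot_H)
  moreover have "F k y x = F x k y"
    by (metis F_12 F_23)
  ultimately show ?thesis
    using assms(1) by (simp add: inc_def F_23[of x w x])
qed

text \<open>A nonzero minor stays nonzero for almost all members of a family of kernel vectors. The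
  preceding degeneracy, applied along the family to the fixed vector \<open>k\<close> of
  \<open>U\<close>, gives \<open>F k x1 x1 = 0\<close> for every \<open>x1\<close>.\<close>

lemma rank_le_1:
  assumes "inc x k"
  shows "F k u u' * F k v v' = F k u v' * F k v u'"
proof (rule ccontr)
  assume ne: "F k u u' * F k v v' \<noteq> F k u v' * F k v u'"
  have "F k x1 x1 = 0" for x1
  proof -
    obtain q S where q: "finite S" "0 \<notin> S" "cpt q 0 = k"
      "\<And>e. e \<notin> S \<Longrightarrow> inc (x + e *s (x1 - x)) (cpt q e)"
      using inc_section[OF assms] by metis
    define p where "p y z = (\<Sum>i\<in>UNIV. q i * [:F (axis i 1) y z:])" for y z
    have p: "poly (p y z) e = F (cpt q e) y z" for e y z
      unfolding F_expand[of "cpt q e"] by (simp add: p_def poly_sum mult.commute)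
    define d where "d = p u u' * p v v' - p u v' * p v u'"
    have d: "poly d e = F (cpt q e) u u' * F (cpt q e) v v' - F (cpt q e) u v' * F (cpt q e) v u'" for e
      by (simp add: d_def p)
    have "poly d 0 \<noteq> 0"
      using ne by (simp add: d q(3))
    then have "d \<noteq> 0"
      by auto
    then have fin: "finite (S \<union> {e. poly d e = 0})"
      using q(1) poly_roots_finite by blast
    have "F k (x + (x1 - x)) (x + (x1 - x)) = 0"
    proof (rule quadratic_cofinite[OF fin])
      fix e assume e: "e \<notin> S \<union> {e. poly d e = 0}"
      then have "F (x + e *s (x1 - x)) (x + e *s (x1 - x)) k = 0"
        using large_rank_degenerate[OF q(4) _ inc_U[OF assms], of e u u' v v'] d by auto
      then show "F k (x + e *s (x1 - x)) (x + e *s (x1 - x)) = 0"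
        by (simp add: F_13)
    qed
    then show ?thesis
      by simp
  qed
  then have "k = 0"
    by (rule diagonal_zero)
  then show False
    using ne by simp
qed

text \<open>A symmetric matrix of rank one over an algebraically closed field is the square of a
  linear form: take \<open>H k *v u\<close> with \<open>F k u u\<close> nonzero and divide by a
  square root of that value.\<close>

lemma inc_square:
  assumes "inc x k" "k \<noteq> 0"
  obtains l where "l \<noteq> 0" "\<And>y z. F k y z = dot l y * dot l z"
proof -
  obtain u where u: "F k u u \<noteq> 0"
    using diagonal_zero[of k] assms(2) by blast
  obtain s where s: "s ^ 2 = F k u u"
    using nth_root_exists[of 2 "F k u u"] by auto
  then have s0: "s \<noteq> 0"
    using u by auto
  define l where "l = inverse s *s (H k *v u)"
  have l: "dot l y = inverse s * F k u y" for y
    by (simp add: l_def dot_scale_left dot_H)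
  have "F k y z = dot l y * dot l z" for y z
  proof -
    have "s ^ 2 * F k y z = F k u z * F k u y"
      unfolding s using rank_le_1[OF assms(1), of u u y z] by (simp add: F_23[of k y u])
    then show ?thesis
      using s0 by (simp add: l field_simps power2_eq_square)
  qed
  moreover have "l \<noteq> 0"
    using u l[of u] s0 by auto
  ultimately show ?thesis
    using that by blast
qed

section \<open>Three independent kernel vectors and their linear forms\<close>

lemma generic_avoid_dots:
  assumes "l \<noteq> 0" "m \<noteq> 0" "n \<noteq> 0"
  obtains x where "generic x" "dot l x \<noteq> 0" "dot m x \<noteq> 0" "dot n x \<noteq> 0"
proof -
  obtain a b c where abc: "dot l a \<noteq> 0" "dot m b \<noteq> 0" "dot n c \<noteq> 0"
    using assms dot_eq_0_imp by metis
  obtain d where d: "dot l d * dot m d \<noteq> 0"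
    using polyfun_mult_eq_zero[OF polyfun_dot polyfun_dot _ abc(1), of m b] abc(2) by auto
  obtain e where e: "dot l e * dot m e * dot n e \<noteq> 0"
    using polyfun_mult_eq_zero[OF polyfun_mult[OF polyfun_dot polyfun_dot] polyfun_dot _ d, of n c] abc(3)
    by auto
  obtain x where "generic x" "dot l x * dot m x * dot n x \<noteq> 0"
    using generic_avoid[OF polyfun_mult[OF polyfun_mult[OF polyfun_dot polyfun_dot] polyfun_dot] e] by metis
  then show ?thesis
    using that by auto
qed

text \<open>Three kernel vectors \<open>k\<^sub>1, k\<^sub>2, k\<^sub>3\<close> are picked successively. Each new base point avoids the zeros of
  the previous linear forms, which makes the kernel vectors independent; a fourth one would violate
  \<open>dim U \<le> 3\<close>, and this forces the third linear form into the span of the first two.\<close>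

lemma kernel_triple:
  obtains k1 l1 k2 l2 k3 a b where "\<And>y z. F k1 y z = dot l1 y * dot l1 z"
    "\<And>y z. F k2 y z = dot l2 y * dot l2 z"
    "\<And>y z. F k3 y z = (a * dot l1 y + b * dot l2 y) * (a * dot l1 z + b * dot l2 z)"
    "a \<noteq> 0" "b \<noteq> 0" "\<And>s t. s *s l1 + t *s l2 = 0 \<Longrightarrow> s = 0 \<and> t = 0"
    "k1 \<in> U" "k2 \<in> U" "k3 \<in> U"
proof -
  obtain x1 k1 where k1: "inc x1 k1" "k1 \<noteq> 0"
    using generic_exists inc_exists by blast
  obtain l1 where l1: "l1 \<noteq> 0" "\<And>y z. F k1 y z = dot l1 y * dot l1 z"
    using inc_square[OF k1] by metis
  obtain x2 where x2: "generic x2" "dot l1 x2 \<noteq> 0"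
    using generic_avoid_dots[OF l1(1) l1(1) l1(1)] by metis
  obtain k2 where k2: "inc x2 k2" "k2 \<noteq> 0"
    using inc_exists[OF x2(1)] by blast
  obtain l2 where l2: "l2 \<noteq> 0" "\<And>y z. F k2 y z = dot l2 y * dot l2 z"
    using inc_square[OF k2] by metis
  \<comment> \<open>Each linear form vanishes at its own base point, since \<open>x2\<close> is in
    the kernel of \<open>H k2\<close> by symmetry of \<open>F\<close>.\<close>
  have z2: "dot l2 x2 = 0"
  proof -
    have "F k2 x2 z = 0" for z
      using k2(1) by (simp add: inc_def F_12[of k2])
    then have "dot l2 x2 * dot l2 x2 = 0"
      using l2(2)[of x2 x2] by simp
    then show ?thesis
      by simp
  qed
  have indl: "s = 0 \<and> t = 0" if st: "s *s l1 + t *s l2 = 0" for s t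
  proof -
    have "dot (s *s l1 + t *s l2) x2 = 0"
      by (simp add: st)
    then have "s = 0"
      using z2 x2(2) by (simp add: dot_linear)
    then show ?thesis
      using st l2(1) by (simp add: vector_mul_eq_0)
  qed
  obtain x3 where x3: "generic x3" "dot l1 x3 \<noteq> 0" "dot l2 x3 \<noteq> 0"
    using generic_avoid_dots[OF l1(1) l1(1) l2(1)] by metis
  obtain k3 where k3: "inc x3 k3" "k3 \<noteq> 0"
    using inc_exists[OF x3(1)] by blast
  obtain l3 where l3: "l3 \<noteq> 0" "\<And>y z. F k3 y z = dot l3 y * dot l3 z"
    using inc_square[OF k3] by metis
  have F12: "F (s *s k1 + t *s k2) y z = dot ((s * dot l1 y) *s l1 + (t * dot l2 y) *s l2) z" for s t y z
    by (simp add: F_lin l1(2) l2(2) dot_linear)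
  have nk2: "k2 \<notin> vec.span {k1}"
  proof
    assume "k2 \<in> vec.span {k1}"
    then obtain c where "k2 = c *s k1"
      by (auto simp: vec.span_singleton)
    moreover have "F k2 x2 x2 = 0"
      by (simp add: l2(2) z2)
    ultimately have "c = 0"
      using x2(2) by (simp add: F_scale l1(2))
    then show False
      using k2(2) \<open>k2 = c *s k1\<close> by simp
  qed
  have nk3: "k3 \<notin> vec.span {k1, k2}"
  proof
    assume "k3 \<in> vec.span {k1, k2}"
    then obtain s where "k3 - s *s k1 \<in> vec.span {k2}"
      using vec.span_breakdown_eq by blast
    then obtain t where "k3 - s *s k1 = t *s k2"
      by (auto simp: vec.span_singleton)
    then have k3': "k3 = s *s k1 + t *s k2"
      by (simp add: algebra_simps)
    have "F k3 x3 z = 0" for z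
      using k3(1) by (simp add: inc_def F_12[of k3])
    then have "dot ((s * dot l1 x3) *s l1 + (t * dot l2 x3) *s l2) z = 0" for z
      by (simp add: F12 k3')
    then have "(s * dot l1 x3) *s l1 + (t * dot l2 x3) *s l2 = 0"
      by (rule dot_eq_0_imp)
    then have "s * dot l1 x3 = 0 \<and> t * dot l2 x3 = 0"
      by (rule indl)
    then have "k3 = 0"
      using x3 k3' by simp
    then show False
      using k3(2) by simp
  qed
  have "vec.dim {k1} = 1"
    using k1(2) by simp
  moreover have "vec.dim {k2, k1} = Suc (vec.dim {k1})"
    using nk2 by (subst vec.dim_insert) simp
  moreover have "vec.dim {k3, k1, k2} = Suc (vec.dim {k2, k1})"
    using nk3 by (subst vec.dim_insert) (simp add: insert_commute)
  moreover have KU: "vec.span {k3, k1, k2} \<subseteq> U"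
    using vec.span_minimal[OF _ subspace_U, of "{k3, k1, k2}"] k1 k2 k3 inc_U by blast
  ultimately have "vec.span {k3, k1, k2} = U"
    using vec.subspace_dim_equal[OF vec.subspace_span subspace_U KU] dim_U by simp
  moreover have "\<exists>a b. l3 = a *s l1 + b *s l2"
  proof (rule ccontr)
    assume no: "\<nexists>a b. l3 = a *s l1 + b *s l2"
    obtain x4 where x4: "generic x4" "dot l1 x4 \<noteq> 0" "dot l2 x4 \<noteq> 0" "dot l3 x4 \<noteq> 0"
      using generic_avoid_dots[OF l1(1) l2(1) l3(1)] by metis
    obtain k4 where k4: "inc x4 k4" "k4 \<noteq> 0"
      using inc_exists[OF x4(1)] by blast
    have "k4 \<in> vec.span {k3, k1, k2}"
      using inc_U[OF k4(1)] \<open>vec.span {k3, k1, k2} = U\<close> by simp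
    then obtain r where "k4 - r *s k3 \<in> vec.span {k1, k2}"
      using vec.span_breakdown_eq by blast
    then obtain s where "k4 - r *s k3 - s *s k1 \<in> vec.span {k2}"
      using vec.span_breakdown_eq by blast
    then obtain t where "k4 - r *s k3 - s *s k1 = t *s k2"
      by (auto simp: vec.span_singleton)
    then have k4': "k4 = (s *s k1 + t *s k2) + r *s k3"
      by (simp add: algebra_simps)
    \<comment> \<open>Expanding \<open>k4\<close> turns this into a linear relation between the
      three forms, whose coefficients contain their nonzero values at \<open>x4\<close>.\<close>
    have "F k4 x4 z = 0" for z
      using k4(1) by (simp add: inc_def F_12[of k4])
    then have "dot ((s * dot l1 x4) *s l1 + (t * dot l2 x4) *s l2 + (r * dot l3 x4) *s l3) z = 0" for z
      unfolding k4' F_add[of _ "r *s k3"] F12 by (simp add: F_scale l3(2) dot_linear mult.assoc)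
    then have 0: "(s * dot l1 x4) *s l1 + (t * dot l2 x4) *s l2 + (r * dot l3 x4) *s l3 = 0"
      by (rule dot_eq_0_imp)
    have r: "r = 0"
    proof (rule ccontr)
      assume "r \<noteq> 0"
      then have c: "r * dot l3 x4 \<noteq> 0"
        using x4(4) by simp
      have "l3 = (- (s * dot l1 x4) / (r * dot l3 x4)) *s l1 + (- (t * dot l2 x4) / (r * dot l3 x4)) *s l2"
      proof (rule vec_eq_iff[THEN iffD2], rule allI)
        fix i
        have "s * dot l1 x4 * l1 $ i + t * dot l2 x4 * l2 $ i + r * dot l3 x4 * l3 $ i = 0"
          using arg_cong[OF 0, of "\<lambda>v. v $ i"] by simp
        then have "l3 $ i * (r * dot l3 x4) = - (s * dot l1 x4 * l1 $ i + t * dot l2 x4 * l2 $ i)"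
          by algebra
        then have "l3 $ i = - (s * dot l1 x4 * l1 $ i + t * dot l2 x4 * l2 $ i) / (r * dot l3 x4)"
          using c by (simp add: nonzero_eq_divide_eq)
        also have "\<dots> = - (s * dot l1 x4) / (r * dot l3 x4) * l1 $ i + - (t * dot l2 x4) / (r * dot l3 x4) * l2 $ i"
          by (simp add: add_divide_distrib diff_divide_distrib)
        finally show "l3 $ i = ((- (s * dot l1 x4) / (r * dot l3 x4)) *s l1 +
            (- (t * dot l2 x4) / (r * dot l3 x4)) *s l2) $ i"
          by simp
      qed
      then show False
        using no by blast
    qed
    then have "s * dot l1 x4 = 0 \<and> t * dot l2 x4 = 0"
      using 0 by (intro indl) simp
    then have "k4 = 0"
      using x4 r k4' by simp
    then show False
      using k4(2) by simp
  qed
  then obtain a b where ab: "l3 = a *s l1 + b *s l2"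
    by blast
  have F3: "F k3 y z = (a * dot l1 y + b * dot l2 y) * (a * dot l1 z + b * dot l2 z)" for y z
    by (simp add: l3(2) ab dot_linear)
  \<comment> \<open>Otherwise \<open>k3\<close> and a multiple of \<open>k1\<close> would have the
    same quadratic form, and their difference would be a vertex.\<close>
  have "b \<noteq> 0"
  proof
    assume "b = 0"
    then have "F (k3 - (a * a) *s k1) y z = 0" for y z
      by (simp add: F_diff F_scale F3 l1(2) algebra_simps)
    then have "k3 - (a * a) *s k1 = 0"
      by (rule F_cone)
    then have "k3 \<in> vec.span {k1}"
      by (auto simp: vec.span_singleton)
    then show False
      using nk3 vec.span_mono[of "{k1}" "{k1, k2}"] by blast
  qed
  moreover have "a \<noteq> 0"
  proof
    assume "a = 0"
    then have "F (k3 - (b * b) *s k2) y z = 0" for y z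
      by (simp add: F_diff F_scale F3 l2(2) algebra_simps)
    then have "k3 - (b * b) *s k2 = 0"
      by (rule F_cone)
    then have "k3 \<in> vec.span {k2}"
      by (auto simp: vec.span_singleton)
    then show False
      using nk3 vec.span_mono[of "{k2}" "{k1, k2}"] by blast
  qed
  ultimately show ?thesis
    using that[of k1 l1 k2 l2 k3 a b] l1(2) l2(2) F3 indl inc_U[OF k1(1)] inc_U[OF k2(1)] inc_U[OF k3(1)]
    by blast
qed

section \<open>Adapted basis and normal form\<close>

lemma dual_vector:
  fixes l m :: "'a ^ 6"
  assumes "\<And>s t. s *s l + t *s m = 0 \<Longrightarrow> s = 0 \<and> t = 0"
  obtains v where "dot l v = 1" "dot m v = 0"
proof -
  have "\<exists>v. dot m v = 0 \<and> dot l v \<noteq> 0"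
  proof (rule ccontr)
    assume no: "\<nexists>v. dot m v = 0 \<and> dot l v \<noteq> 0"
    have "m \<noteq> 0"
      using assms[of 0 1] by auto
    then obtain w where w: "dot m w \<noteq> 0"
      using dot_eq_0_imp by blast
    have "dot (dot m w *s l + (- dot l w) *s m) v = 0" for v
    proof -
      have "dot m (dot m w *s v - dot m v *s w) = 0"
        by (simp add: dot_linear)
      then have "dot l (dot m w *s v - dot m v *s w) = 0"
        using no by blast
      then show ?thesis
        by (simp add: dot_linear algebra_simps)
    qed
    then have "dot m w *s l + (- dot l w) *s m = 0"
      by (rule dot_eq_0_imp)
    then show False
      using assms w by blast
  qed
  then obtain v where "dot m v = 0" "dot l v \<noteq> 0"
    by blast
  then show ?thesis
    using that[of "inverse (dot l v) *s v"] by (simp add: dot_linear)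
qed

theorem classification:
  obtains A :: "'a ^ 6 ^ 6" and c a1 a2 b1 b2 b3 d1 d2 d3 d4 where "invertible A"
    "\<And>y. F (A *v y) (A *v y) (A *v y) = y $ 0 * y $ 4 ^ 2 + 2 * y $ 1 * y $ 4 * y $ 5 + y $ 2 * y $ 5 ^ 2 +
      (c * y $ 3 ^ 3 + y $ 3 ^ 2 * (a1 * y $ 4 + a2 * y $ 5) +
       y $ 3 * (b1 * y $ 4 ^ 2 + b2 * (y $ 4 * y $ 5) + b3 * y $ 5 ^ 2) +
       (d1 * y $ 4 ^ 3 + d2 * (y $ 4 ^ 2 * y $ 5) + d3 * (y $ 4 * y $ 5 ^ 2) + d4 * y $ 5 ^ 3))"
proof -
  obtain k1 k2 k3 l1 l2 a b where k1: "\<And>y z. F k1 y z = dot l1 y * dot l1 z"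
    and k2: "\<And>y z. F k2 y z = dot l2 y * dot l2 z"
    and k3: "\<And>y z. F k3 y z = (a * dot l1 y + b * dot l2 y) * (a * dot l1 z + b * dot l2 z)"
    and ab: "a \<noteq> 0" "b \<noteq> 0" and ind: "\<And>s t. s *s l1 + t *s l2 = 0 \<Longrightarrow> s = 0 \<and> t = 0"
    and kU: "k1 \<in> U" "k2 \<in> U" "k3 \<in> U"
    by (rule kernel_triple) blast
  obtain e4 where e4: "dot l1 e4 = 1" "dot l2 e4 = 0"
    using dual_vector[OF ind] by metis
  obtain e5 where e5: "dot l2 e5 = 1" "dot l1 e5 = 0"
    using dual_vector[of l2 l1] ind by (metis add.commute)
  \<comment> \<open>The factor one third cancels the multiplicity of the mixed term when the cubic
    is expanded. In \<open>e1\<close> the square belonging to \<open>k3\<close> is stripped down to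
    the mixed product of \<open>l1\<close> and \<open>l2\<close>.\<close>
  define e0 where "e0 = inverse 3 *s k1"
  define e2 where "e2 = inverse 3 *s k2"
  define e1 where "e1 = inverse (3 * a * b) *s (k3 - (a * a) *s k1 - (b * b) *s k2)"
  have eU: "e0 \<in> U" "e1 \<in> U" "e2 \<in> U"
    unfolding e0_def e1_def e2_def using subspace_U kU
    by (intro vec.subspace_scale vec.subspace_diff; simp)+
  have F0: "3 * F e0 y z = dot l1 y * dot l1 z" for y z
    by (simp add: e0_def F_scale k1)
  have F2: "3 * F e2 y z = dot l2 y * dot l2 z" for y z
    by (simp add: e2_def F_scale k2)
  have F1: "3 * F e1 y z = dot l1 y * dot l2 z + dot l2 y * dot l1 z" for y z
  proof -
    have "F (k3 - (a * a) *s k1 - (b * b) *s k2) y z = (a * b) * (dot l1 y * dot l2 z + dot l2 y * dot l1 z)"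
      by (simp only: F_diff F_scale k1 k2 k3) (simp add: algebra_simps)
    moreover have "3 * (inverse (3 * a * b) * ((a * b) * X)) = X" for X
      using ab by (simp add: field_simps)
    ultimately show ?thesis
      unfolding e1_def F_scale by metis
  qed
  have lU: "dot l1 u = 0" "dot l2 u = 0" if "u \<in> U" for u
    using F0[of u u] F2[of u u] U_isotropic[OF eU(1) that, of u] U_isotropic[OF eU(3) that, of u] by simp_all
  \<comment> \<open>The common kernel of \<open>l1\<close> and \<open>l2\<close> has dimension at
    least four and therefore cannot lie in \<open>U\<close>.\<close>
  obtain e3 where e3: "dot l1 e3 = 0" "dot l2 e3 = 0" "e3 \<notin> U"
  proof -
    define L where "L v = vec6 (dot l1 v) (dot l2 v) 0 0 0 0" for v
    have lin: "Vector_Spaces.linear (*s) (*s) L"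
      by (rule vec_linearI) (simp_all add: L_def vec6_eq_iff dot_linear)
    have L_mat: "(*v) (matrix L) = L"
      using matrix_works[OF lin] by auto
    have "vec.dim (range L) \<le> vec.dim {x::'a^6. \<forall>i. i \<notin> {0, 1} \<longrightarrow> x $ i = 0}"
      by (rule vec.dim_subset) (auto simp: L_def vec6_def)
    moreover have "vec.dim {x::'a^6. \<forall>i. i \<notin> {0, 1} \<longrightarrow> x $ i = 0} = 2"
      by (subst dim_substandard_cart) simp
    ultimately have "vec.dim {v. L v = 0} \<ge> 4"
      using vec_rank_nullity[OF vec.subspace_UNIV, of "matrix L"]
      by (simp add: L_mat card_cart_basis)
    then have "\<not> {v. L v = 0} \<subseteq> U"
      using vec.dim_subset[of "{v. L v = 0}" U] dim_U by linarith
    then show ?thesis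
      using that by (auto simp: L_def vec6_eq_iff)
  qed
  define E where "E i = (if i = 0 then e0 else if i = 1 then e1 else if i = 2 then e2 else
    if i = 3 then e3 else if i = 4 then e4 else e5)" for i :: 6
  define A where "A = (\<chi> i j. E j $ i)"
  have A: "A *v y = (y $ 0 *s e0 + y $ 1 *s e1 + y $ 2 *s e2) + (y $ 3 *s e3 + y $ 4 *s e4 + y $ 5 *s e5)" for y
    by (simp add: vec_eq_iff A_def matrix_vector_mult_def sum_6 E_def algebra_simps)
  have uU: "y $ 0 *s e0 + y $ 1 *s e1 + y $ 2 *s e2 \<in> U" for y :: "'a ^ 6"
    using eU by (intro vec.subspace_add[OF subspace_U] vec.subspace_scale[OF subspace_U])
  have "y = 0" if y: "A *v y = 0" for y
  proof -
    have "dot l1 (A *v y) = y $ 4" "dot l2 (A *v y) = y $ 5"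
      using lU[OF uU[of y]] by (simp_all add: A dot_add_right[of _ "_ + _ + _"] dot_linear e3 e4 e5)
    then have y45: "y $ 4 = 0" "y $ 5 = 0"
      by (simp_all add: y)
    have y3: "y $ 3 = 0"
    proof (rule ccontr)
      assume nz: "y $ 3 \<noteq> 0"
      have "y $ 3 *s e3 = - (y $ 0 *s e0 + y $ 1 *s e1 + y $ 2 *s e2)"
        using y y45 by (simp add: A add_eq_0_iff)
      then have "y $ 3 *s e3 \<in> U"
        using vec.subspace_neg[OF subspace_U uU] by simp
      then have "inverse (y $ 3) *s (y $ 3 *s e3) \<in> U"
        by (rule vec.subspace_scale[OF subspace_U])
      then show False
        using nz e3(3) by (simp add: vector_smult_assoc)
    qed
    have "F (A *v y) v w = 0" for v w
      by (simp add: y)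
    then have "3 * (y $ 0 * F e0 v w + y $ 1 * F e1 v w + y $ 2 * F e2 v w) = 0" for v w
      by (simp add: A y45 y3 F_lin)
    then have *: "y $ 0 * (dot l1 v * dot l1 w) + y $ 1 * (dot l1 v * dot l2 w + dot l2 v * dot l1 w) +
        y $ 2 * (dot l2 v * dot l2 w) = 0" for v w
      unfolding F0[symmetric] F1[symmetric] F2[symmetric] by (simp add: algebra_simps)
    have "y $ 0 = 0" "y $ 1 = 0" "y $ 2 = 0"
      using *[of e4 e4] *[of e4 e5] *[of e5 e5] by (simp_all add: e4 e5)
    then show ?thesis
      using y45 y3 by (simp add: vec6_eq_iff)
  qed
  then have inv: "invertible A"
    by (simp add: invertible_left_inverse matrix_left_invertible_ker)
  have normal: "F (A *v y) (A *v y) (A *v y) =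
      y $ 0 * y $ 4 ^ 2 + 2 * y $ 1 * y $ 4 * y $ 5 + y $ 2 * y $ 5 ^ 2 +
      (F e3 e3 e3 * y $ 3 ^ 3 + y $ 3 ^ 2 * (3 * F e3 e3 e4 * y $ 4 + 3 * F e3 e3 e5 * y $ 5) +
       y $ 3 * (3 * F e3 e4 e4 * y $ 4 ^ 2 + 6 * F e3 e4 e5 * (y $ 4 * y $ 5) + 3 * F e3 e5 e5 * y $ 5 ^ 2) +
       (F e4 e4 e4 * y $ 4 ^ 3 + 3 * F e4 e4 e5 * (y $ 4 ^ 2 * y $ 5) + 3 * F e4 e5 e5 * (y $ 4 * y $ 5 ^ 2) +
        F e5 e5 e5 * y $ 5 ^ 3))" for y
  proof -
    define u where "u = y $ 0 *s e0 + y $ 1 *s e1 + y $ 2 *s e2"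
    define w where "w = y $ 3 *s e3 + y $ 4 *s e4 + y $ 5 *s e5"
    \<comment> \<open>Isotropy removes all terms of degree at least two in \<open>u\<close>; the
      part in \<open>w\<close> alone becomes the free cubic in y3, y4, y5.\<close>
    have "F u u z = 0" for z
      unfolding u_def by (rule U_isotropic[OF uU uU])
    then have "F (u + w) (u + w) (u + w) = 3 * F u w w + F w w w"
      by (simp add: F_lin F_23[of u w u] F_12[of w u] F_23[of w w u])
    moreover have "3 * F u w w = y $ 0 * (3 * F e0 w w) + y $ 1 * (3 * F e1 w w) + y $ 2 * (3 * F e2 w w)"
      by (simp add: u_def F_add F_scale algebra_simps)
    moreover have "dot l1 w = y $ 4" "dot l2 w = y $ 5"
      by (simp_all add: w_def dot_linear e3 e4 e5)
    ultimately have "F (A *v y) (A *v y) (A *v y) =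
        y $ 0 * y $ 4 ^ 2 + 2 * y $ 1 * y $ 4 * y $ 5 + y $ 2 * y $ 5 ^ 2 + F w w w"
      unfolding F0 F1 F2 A u_def[symmetric] w_def[symmetric]
      by (simp add: power2_eq_square algebra_simps)
    moreover have "F w w w =
      (F e3 e3 e3 * y $ 3 ^ 3 + y $ 3 ^ 2 * (3 * F e3 e3 e4 * y $ 4 + 3 * F e3 e3 e5 * y $ 5) +
       y $ 3 * (3 * F e3 e4 e4 * y $ 4 ^ 2 + 6 * F e3 e4 e5 * (y $ 4 * y $ 5) + 3 * F e3 e5 e5 * y $ 5 ^ 2) +
       (F e4 e4 e4 * y $ 4 ^ 3 + 3 * F e4 e4 e5 * (y $ 4 ^ 2 * y $ 5) + 3 * F e4 e5 e5 * (y $ 4 * y $ 5 ^ 2) +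
        F e5 e5 e5 * y $ 5 ^ 3))"
    proof -
      have sym: "F e3 e4 e3 = F e3 e3 e4" "F e4 e3 e3 = F e3 e3 e4" "F e3 e5 e3 = F e3 e3 e5"
        "F e5 e3 e3 = F e3 e3 e5" "F e4 e3 e4 = F e3 e4 e4" "F e4 e4 e3 = F e3 e4 e4"
        "F e5 e3 e5 = F e3 e5 e5" "F e5 e5 e3 = F e3 e5 e5" "F e3 e5 e4 = F e3 e4 e5"
        "F e4 e3 e5 = F e3 e4 e5" "F e4 e5 e3 = F e3 e4 e5" "F e5 e3 e4 = F e3 e4 e5"
        "F e5 e4 e3 = F e3 e4 e5" "F e4 e5 e4 = F e4 e4 e5" "F e5 e4 e4 = F e4 e4 e5"
        "F e5 e4 e5 = F e4 e5 e5" "F e5 e5 e4 = F e4 e5 e5"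
        by (simp_all add: F_12 F_23)
      show ?thesis
        unfolding w_def by (simp add: F_lin sym power2_eq_square power3_eq_cube algebra_simps)
    qed
    ultimately show ?thesis
      by simp
  qed
  show ?thesis
    by (rule that[OF inv normal])
qed

end

section \<open>Reduction to the normal form\<close>

lemma form_partial: "form (Suc d) g \<Longrightarrow> form d (partial i g)"
  unfolding form_def
proof
  fix m assume g: "\<forall>m\<in>Poly_Mapping.keys g. (\<Sum>i\<in>UNIV. Poly_Mapping.lookup m i) = Suc d"
    and m: "m \<in> Poly_Mapping.keys (partial i g)"
  have "m + Poly_Mapping.single i 1 \<in> Poly_Mapping.keys g"
    using m by (auto simp: in_keys_iff lookup_partial)
  then have "(\<Sum>j\<in>UNIV. Poly_Mapping.lookup (m + Poly_Mapping.single i 1) j) = Suc d"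
    using g by blast
  then show "(\<Sum>j\<in>UNIV. Poly_Mapping.lookup m j) = d"
    by (simp add: lookup_add sum.distrib lookup_single when_def)
qed

lemma partial_commute: "partial i (partial j g) = partial j (partial i g)"
proof (rule poly_mapping_eqI)
  fix m
  have "m + Poly_Mapping.single i 1 + Poly_Mapping.single j 1 =
      m + Poly_Mapping.single j 1 + Poly_Mapping.single i (1::nat)"
    by (simp add: add_ac)
  then show "Poly_Mapping.lookup (partial i (partial j g)) m = Poly_Mapping.lookup (partial j (partial i g)) m"
    by (cases "i = j") (simp_all add: lookup_partial lookup_add lookup_single)
qed

text \<open>Any univariate polynomial with the right values along a line gives the directional
  derivative, so concrete gradients are found without expanding \<open>partial\<close>.\<close>

lemma dot_grad_line:
  fixes g :: "('a::{idom, ring_char_0}, 'n::finite) mpoly"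
  assumes "\<And>e. poly p e = peval g (x + e *s v)"
  shows "dot (grad g x) v = poly (pderiv p) 0"
proof -
  have "mev (\<lambda>c. [:c:]) (line x v) g - p = 0"
    by (rule poly_eq_zero_if_cofinite[of "{}"])
      (auto simp: assms poly_mev cpt_line[symmetric] cpt_def)
  then have "p = mev (\<lambda>c. [:c:]) (line x v) g"
    by simp
  then have "poly (pderiv p) 0 = (\<Sum>i\<in>UNIV. grad g (cpt (line x v) 0) $ i * poly (pderiv (line x v i)) 0)"
    by (simp add: poly_pderiv_mev)
  then show ?thesis
    by (simp add: cpt_line dot_def)
qed

lemma form_scale:
  assumes "form d g"
  shows "peval g (c *s x) = c ^ d * peval g x"
  by (rule formfun_scale) (use assms in \<open>auto simp: formfun_def\<close>)

lemma euler_identity: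
  fixes g :: "('a::{idom, ring_char_0}, 'n::finite) mpoly"
  assumes "form d g"
  shows "(\<Sum>i\<in>UNIV. x $ i * peval (partial i g) x) = of_nat d * peval g x"
proof -
  have "dot (grad g x) x = poly (pderiv ([:1, 1:] ^ d * [:peval g x:])) 0"
  proof (rule dot_grad_line)
    fix e
    have "x + e *s x = (1 + e) *s x"
      by (simp add: vec_eq_iff algebra_simps)
    then show "poly ([:1, 1:] ^ d * [:peval g x:]) e = peval g (x + e *s x)"
      by (simp add: form_scale[OF assms] poly_power)
  qed
  also have "\<dots> = of_nat d * peval g x"
    by (simp add: pderiv_smult pderiv_power pderiv_pCons poly_power)
  finally show ?thesis
    by (simp add: dot_def grad_def mult.commute)
qed

lemma peval_of_int [simp]: "peval (of_int k) x = of_int k"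
  using peval_const[of "of_int k" x] by simp

lemma peval_det: "peval (det M) x = det (\<chi> i j. peval (M $ i $ j) x)"
  by (simp add: det_def peval_sum peval_prod)

lemma det_zero_kernel:
  fixes M :: "'a::field ^ 'n ^ 'n"
  assumes "det M = 0"
  obtains v where "v \<noteq> 0" "M *v v = 0"
proof -
  have "\<not> invertible M"
    using assms by (simp add: invertible_det_nz)
  then show ?thesis
    using that unfolding invertible_left_inverse matrix_left_invertible_ker by blast
qed

text \<open>The general ternary cubic. Its ten coefficients are the values of \<open>r\<close> at 0
  to 9, ordered by decreasing degree in \<open>u\<close>.\<close>

definition cubic_tail :: "(nat \<Rightarrow> 'a::comm_ring_1) \<Rightarrow> 'a \<Rightarrow> 'a \<Rightarrow> 'a \<Rightarrow> 'a"
  where "cubic_tail r u s t = r 0 * u ^ 3 + u ^ 2 * (r 1 * s + r 2 * t) +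
    u * (r 3 * s ^ 2 + r 4 * (s * t) + r 5 * t ^ 2) +
    (r 6 * s ^ 3 + r 7 * (s ^ 2 * t) + r 8 * (s * t ^ 2) + r 9 * t ^ 3)"

definition normal_cubic :: "(nat \<Rightarrow> 'a::comm_ring_1) \<Rightarrow> 'a ^ 6 \<Rightarrow> 'a"
  where "normal_cubic r y = y $ 0 * y $ 4 ^ 2 + 2 * y $ 1 * y $ 4 * y $ 5 + y $ 2 * y $ 5 ^ 2 +
    cubic_tail r (y $ 3) (y $ 4) (y $ 5)"

text \<open>Six times the polarisation of a cubic form. Evaluation at 0 is only a choice of point,
  because the third derivatives of a cubic form are constant.\<close>

definition third_derivative ::
    "('a::comm_ring_1, 'n::finite) mpoly \<Rightarrow> 'a ^ 'n \<Rightarrow> 'a ^ 'n \<Rightarrow> 'a ^ 'n \<Rightarrow> 'a"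
  where "third_derivative f x y z = (\<Sum>i\<in>UNIV. \<Sum>j\<in>UNIV. \<Sum>k\<in>UNIV.
    peval (partial i (partial j (partial k f))) 0 * x $ i * y $ j * z $ k)"

text \<open>Euler's identity contracts one argument at a time, first to the hessian, then to the
  gradient, then to the form itself; the factors 1, 2 and 3 multiply to 6.\<close>

lemma cubic_polarisation:
  fixes f :: "('a::{idom, ring_char_0}, 'n::finite) mpoly"
  assumes "form 3 f"
  shows "third_derivative f x y z =
      (\<Sum>j\<in>UNIV. \<Sum>k\<in>UNIV. peval (hessian f $ j $ k) x * y $ j * z $ k)"
    and "third_derivative f x x x = 6 * peval f x"
    and "third_derivative f x y z = third_derivative f y x z"
    and "third_derivative f x y z = third_derivative f x z y"
proof -
  let ?T = "third_derivative f"
  note T_def = third_derivative_def[of f]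
  have f2: "form (Suc (Suc (Suc 0))) f"
    using assms(1) by (simp add: numeral_3_eq_3)
  have const: "peval (partial i (partial j (partial k f))) x = peval (partial i (partial j (partial k f))) 0"
    for i j k x
    using form_scale[OF form_partial[OF form_partial[OF form_partial[OF f2]]], of i j k 0 x] by simp
  have h: "(\<Sum>i\<in>UNIV. peval (partial i (partial j (partial k f))) 0 * x $ i) = peval (partial j (partial k f)) x"
    for j k x
    using euler_identity[OF form_partial[OF form_partial[OF f2]], of x j k]
    by (simp add: const[of _ j k x] mult.commute)
  have g: "(\<Sum>j\<in>UNIV. peval (partial j (partial k f)) x * x $ j) = 2 * peval (partial k f) x" for k x
    using euler_identity[OF form_partial[OF f2], of x k] by (simp add: mult.commute)
  have e: "(\<Sum>k\<in>UNIV. peval (partial k f) x * x $ k) = 3 * peval f x" for x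
    using euler_identity[OF assms(1), of x] by (simp add: mult.commute)
  have T: "?T x y z = (\<Sum>j\<in>UNIV. \<Sum>k\<in>UNIV. peval (partial j (partial k f)) x * y $ j * z $ k)" for x y z
  proof -
    have "?T x y z = (\<Sum>j\<in>UNIV. \<Sum>i\<in>UNIV. \<Sum>k\<in>UNIV.
        peval (partial i (partial j (partial k f))) 0 * x $ i * y $ j * z $ k)"
      unfolding T_def by (rule sum.swap)
    also have "\<dots> = (\<Sum>j\<in>UNIV. \<Sum>k\<in>UNIV. \<Sum>i\<in>UNIV.
        peval (partial i (partial j (partial k f))) 0 * x $ i * y $ j * z $ k)"
      by (rule sum.cong[OF refl]) (rule sum.swap)
    finally show ?thesis
      by (simp add: h sum_distrib_right[symmetric])
  qed
  then show "?T x y z = (\<Sum>j\<in>UNIV. \<Sum>k\<in>UNIV. peval (hessian f $ j $ k) x * y $ j * z $ k)"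
    by (simp add: hessian_def)
  have "?T x x x = (\<Sum>k\<in>UNIV. (\<Sum>j\<in>UNIV. peval (partial j (partial k f)) x * x $ j) * x $ k)"
    unfolding T by (subst sum.swap) (simp add: sum_distrib_right)
  also have "\<dots> = (\<Sum>k\<in>UNIV. 2 * (peval (partial k f) x * x $ k))"
    by (simp add: g mult.assoc)
  also have "\<dots> = 6 * peval f x"
    by (simp add: sum_distrib_left[symmetric] e)
  finally show "?T x x x = 6 * peval f x" .
  show "?T x y z = ?T y x z"
    unfolding T_def by (subst sum.swap) (simp add: partial_commute[of _ _ "partial _ f"] mult_ac)
  show "?T x y z = ?T x z y"
    unfolding T_def
    by (rule sum.cong[OF refl], subst sum.swap) (simp add: partial_commute[of _ _ f] mult_ac)
qed

theorem vanishing_hessian_normal_form: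
  fixes f :: "('a::{alg_closed_field, field_char_0}, 6) mpoly"
  assumes "form 3 f" "vanishing_hessian f" "\<not> is_cone (hypersurface f)"
  obtains A :: "'a ^ 6 ^ 6" and r where "invertible A" "\<And>y. peval f (A *v y) = normal_cubic r y"
proof -
  let ?T = "third_derivative f"
  note T = cubic_polarisation[OF assms(1)]
  define F where "F x y z = ?T x y z / 6" for x y z
  have F_add: "F (x + x') y z = F x y z + F x' y z" for x x' y z
    by (simp add: F_def third_derivative_def sum.distrib algebra_simps add_divide_distrib)
  have F_scale: "F (k *s x) y z = k * F x y z" for k x y z
    by (simp add: F_def third_derivative_def sum_distrib_left mult_ac)
  have F_12: "F x y z = F y x z" for x y z
    unfolding F_def T(3)[of x y z] ..
  have F_23: "F x y z = F x z y" for x y z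
    unfolding F_def T(4)[of x y z] ..
  have F_diag: "F x x x = peval f x" for x
    by (simp add: F_def T(2))
  have hess: "\<exists>k. k \<noteq> 0 \<and> (\<forall>z. F x k z = 0)" for x
  proof -
    let ?M = "\<chi> i j. peval (hessian f $ i $ j) x"
    have "det ?M = 0"
      using assms(2) by (simp add: vanishing_hessian_def peval_det[symmetric])
    then obtain k where k: "k \<noteq> 0" "?M *v k = 0"
      by (rule det_zero_kernel)
    have "F x k z = 0" for z
    proof -
      have "?T x z k = (\<Sum>j\<in>UNIV. (?M *v k) $ j * z $ j)"
        by (simp add: T(1) matrix_vector_mult_def sum_distrib_right sum_distrib_left mult_ac)
      then show ?thesis
        by (simp add: F_def k T(4)[of x k z])
    qed
    then show ?thesis
      using k(1) by blast
  qed
  \<comment> \<open>Such a \<open>v\<close> would be a vertex: on the span of \<open>v\<close> and a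
    point \<open>q\<close> of the hypersurface the cubic is a multiple of its value at
    \<open>q\<close>.\<close>
  have cone: "v = 0" if v: "\<And>y z. F v y z = 0" for v
  proof (rule ccontr)
    assume v0: "v \<noteq> 0"
    have add2: "F x (y + y') z = F x y z + F x y' z" and scale2: "F x (k *s y) z = k * F x y z"
      for x y y' z k
      using F_add[of y y' x z] F_scale[of k y x z] by (simp_all add: F_12[of x])
    have add3: "F x y (z + z') = F x y z + F x y z'" and scale3: "F x y (k *s z) = k * F x y z"
      for x y z z' k
      using add2[of x z z' y] scale2[of x k z y] by (simp_all add: F_23[of x y])
    have v2: "F y v z = 0" and v3: "F y z v = 0" for y z
      using v by (metis F_12, metis F_12 F_23)
    have "peval f w = 0" if "q \<in> hypersurface f" "w \<in> vec.span {v, q}" for q w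
    proof -
      obtain a where "w - a *s v \<in> vec.span {q}"
        using \<open>w \<in> vec.span {v, q}\<close> vec.span_breakdown_eq by blast
      then obtain b where "w - a *s v = b *s q"
        by (auto simp: vec.span_singleton)
      then have "w = a *s v + b *s q"
        by (simp add: algebra_simps)
      then have "F w w w = b * (b * (b * F q q q))"
        by (simp add: F_add add2 add3 F_scale scale2 scale3 v v2 v3)
      then show ?thesis
        using \<open>q \<in> hypersurface f\<close> by (simp add: F_diag hypersurface_def)
    qed
    moreover have "v \<in> hypersurface f"
      using v[of v v] v0 by (simp add: F_diag hypersurface_def)
    ultimately have "is_cone (hypersurface f)"
      unfolding is_cone_def by (intro bexI[of _ v]) (auto simp: hypersurface_def)
    then show False
      using assms(3) by blast
  qed
  interpret hesse_cubic F
    by unfold_locales (fact F_add F_scale F_12 F_23 hess cone)+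
  obtain A :: "'a ^ 6 ^ 6" and c a1 a2 b1 b2 b3 d1 d2 d3 d4 where A: "invertible A"
    "\<And>y. F (A *v y) (A *v y) (A *v y) = y $ 0 * y $ 4 ^ 2 + 2 * y $ 1 * y $ 4 * y $ 5 + y $ 2 * y $ 5 ^ 2 +
      (c * y $ 3 ^ 3 + y $ 3 ^ 2 * (a1 * y $ 4 + a2 * y $ 5) +
       y $ 3 * (b1 * y $ 4 ^ 2 + b2 * (y $ 4 * y $ 5) + b3 * y $ 5 ^ 2) +
       (d1 * y $ 4 ^ 3 + d2 * (y $ 4 ^ 2 * y $ 5) + d3 * (y $ 4 * y $ 5 ^ 2) + d4 * y $ 5 ^ 3))"
    by (rule classification) blast
  have "peval f (A *v y) = normal_cubic ((!) [c, a1, a2, b1, b2, b3, d1, d2, d3, d4]) y" for y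
    by (simp add: F_diag[symmetric] A(2) normal_cubic_def cubic_tail_def)
  then show ?thesis
    using that A(1) by blast
qed

section \<open>Conics\<close>

definition vec3 :: "'a \<Rightarrow> 'a \<Rightarrow> 'a \<Rightarrow> 'a ^ 3"
  where "vec3 a b c = (\<chi> i. if i = 0 then a else if i = 1 then b else c)"

lemma vec3_nth [simp]: "vec3 a b c $ 0 = a" "vec3 a b c $ 1 = b" "vec3 a b c $ 2 = c"
  by (simp_all add: vec3_def)

lemma UNIV_3': "(UNIV :: 3 set) = {0, 1, 2}"
  using UNIV_3 by auto

lemma vec3_eq_iff: "x = y \<longleftrightarrow> x $ 0 = y $ 0 \<and> x $ 1 = y $ 1 \<and> x $ 2 = (y $ 2 :: 'a)" for x y :: "'a ^ 3"
proof -
  have "(\<forall>i::3. P i) \<longleftrightarrow> P 0 \<and> P 1 \<and> P 2" for P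
    using UNIV_3' by (metis UNIV_I insertE singletonD)
  then show ?thesis
    by (simp add: vec_eq_iff)
qed

lemma sum_3': "sum g (UNIV :: 3 set) = g 0 + g 1 + g 2"
  unfolding UNIV_3' by (simp add: add.assoc)

text \<open>Order and sign are those of the normal vector to the quadric \<eta>1^2 = 4 \<eta>0
  \<eta>2 at the point (s^2, 2 s t, t^2).\<close>

definition conic_point :: "'a::comm_ring_1 \<Rightarrow> 'a \<Rightarrow> 'a ^ 3"
  where "conic_point s t = vec3 (t ^ 2) (- (s * t)) (s ^ 2)"

text \<open>In the lemmas a left inverse \<open>L\<close> makes \<open>M\<close> injective and also
  supplies equations for the image. The matrix is a parameter because the conic occurs both in P^5
  and in Pluecker coordinates.\<close>

definition conic_set :: "'a::field ^ 3 ^ 'n \<Rightarrow> ('a ^ 'n) set"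
  where "conic_set M = {x. x \<noteq> 0 \<and> (\<exists>s t. x = M *v conic_point s t)}"

lemma conic_point_iff:
  fixes x :: "'a::alg_closed_field ^ 3"
  shows "(\<exists>s t. x = conic_point s t) \<longleftrightarrow> x $ 1 ^ 2 = x $ 0 * x $ 2"
proof
  assume eq: "x $ 1 ^ 2 = x $ 0 * x $ 2"
  obtain s t where st: "s ^ 2 = x $ 2" "t ^ 2 = x $ 0"
    using nth_root_exists[of 2] by (metis zero_less_numeral)
  have "(x $ 1) ^ 2 = (s * t) ^ 2"
    by (simp add: eq st power_mult_distrib mult.commute)
  then have "x $ 1 = s * t \<or> x $ 1 = - (s * t)"
    by (simp add: power2_eq_iff)
  then show "\<exists>s t. x = conic_point s t"
  proof
    assume "x $ 1 = s * t"
    then have "x = conic_point (- s) t"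
      using st by (simp add: vec3_eq_iff conic_point_def)
    then show ?thesis by blast
  next
    assume "x $ 1 = - (s * t)"
    then have "x = conic_point s t"
      using st by (simp add: vec3_eq_iff conic_point_def)
    then show ?thesis by blast
  qed
qed (auto simp: conic_point_def power_mult_distrib mult.commute)

lemma conic_set_iff:
  fixes M :: "'a::alg_closed_field ^ 3 ^ 'n"
  assumes LM: "L ** M = mat 1"
  shows "x \<in> conic_set M \<longleftrightarrow> x \<noteq> 0 \<and> M *v (L *v x) = x \<and> (L *v x) $ 1 ^ 2 = (L *v x) $ 0 * (L *v x) $ 2"
proof -
  have "L *v (M *v y) = y" for y
    by (simp add: matrix_vector_mul_assoc LM)
  then show ?thesis
    unfolding conic_set_def mem_Collect_eq conic_point_iff[symmetric] by metis
qed

lemma zariski_closed_conic: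
  fixes M :: "'a::alg_closed_field ^ 3 ^ 'n"
  assumes LM: "L ** M = mat 1"
  shows "zariski_closed (conic_set M)"
proof -
  let ?\<Phi> = "insert (\<lambda>x. (L *v x) $ 1 ^ 2 - (L *v x) $ 0 * (L *v x) $ 2)
    (range (\<lambda>i x. ((M ** L) *v x) $ i - x $ i))"
  have "formfun 2 (\<lambda>x. (L *v x) $ 1 ^ 2 - (L *v x) $ 0 * (L *v x) $ 2)"
    by (intro formfun_diff formfun_mult[OF formfun_matrix formfun_matrix]
        formfun_power[OF formfun_matrix]) simp_all
  moreover have "formfun 1 (\<lambda>x. ((M ** L) *v x) $ i - x $ i)" for i
    by (intro formfun_diff formfun_matrix formfun_nth)
  ultimately have "\<exists>d. formfun d \<phi>" if "\<phi> \<in> ?\<Phi>" for \<phi>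
    using that by blast
  then have "zariski_closed {x. x \<noteq> 0 \<and> (\<forall>\<phi>\<in>?\<Phi>. \<phi> x = 0)}"
    by (rule zariski_closed_forms)
  moreover have "{x. x \<noteq> 0 \<and> (\<forall>\<phi>\<in>?\<Phi>. \<phi> x = 0)} = conic_set M"
    unfolding set_eq_iff conic_set_iff[OF LM] mem_Collect_eq
    by (auto simp: vec_eq_iff matrix_vector_mul_assoc[symmetric])
  ultimately show ?thesis
    by simp
qed

lemma polyfun_if: "(b \<Longrightarrow> polyfun \<phi>) \<Longrightarrow> (\<not> b \<Longrightarrow> polyfun \<psi>) \<Longrightarrow> polyfun (\<lambda>x. if b then \<phi> x else \<psi> x)"
  by (cases b) simp_all

lemma polyfun_matrix_comp:
  assumes "\<And>i. polyfun (\<lambda>x. \<phi> x $ i)"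
  shows "polyfun (\<lambda>x. (M *v \<phi> x) $ i)"
  unfolding matrix_vector_mult_def vec_lambda_beta
  by (intro polyfun_sum polyfun_mult polyfun_const assms)

lemma proj_dim_conic:
  fixes M :: "'a::{alg_closed_field, field_char_0} ^ 3 ^ 'n"
  assumes LM: "L ** M = mat 1"
  shows "proj_dim (conic_set M) = 1"
proof -
  have LM': "L *v (M *v y) = y" for y
    by (simp add: matrix_vector_mul_assoc LM)
  have inj: "M *v y = 0 \<longleftrightarrow> y = 0" for y
    by (metis LM' matrix_vector_mult_0_right)
  define \<phi> :: "'a ^ 2 \<Rightarrow> 'a ^ 'n" where "\<phi> p = M *v conic_point (p $ 0) (p $ 1)" for p
  define \<psi> :: "'a ^ 2 \<Rightarrow> 'a ^ 'n" where "\<psi> p = M *v conic_point 0 (p $ 1)" for p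
  have "polyfun (\<lambda>p :: 'a ^ 2. conic_point (p $ 0) (p $ 1) $ i)" for i
    unfolding conic_point_def vec3_def vec_lambda_beta
    by (intro polyfun_if polyfun_power polyfun_uminus polyfun_mult polyfun_nth)
  then have \<phi>: "polyfun (\<lambda>p. \<phi> p $ i)" for i
    unfolding \<phi>_def by (rule polyfun_matrix_comp)
  have "polyfun (\<lambda>p :: 'a ^ 2. conic_point 0 (p $ 1) $ i)" for i
    unfolding conic_point_def vec3_def vec_lambda_beta
    by (intro polyfun_if polyfun_power polyfun_uminus polyfun_mult polyfun_nth polyfun_const)
  then have \<psi>: "polyfun (\<lambda>p. \<psi> p $ i)" for i
    unfolding \<psi>_def by (rule polyfun_matrix_comp)
  have conic: "conic_set M = {x. x \<noteq> 0 \<and> (\<exists>p. x = \<phi> p)}"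
  proof -
    have "(\<exists>p. x = \<phi> p) \<longleftrightarrow> (\<exists>s t. x = M *v conic_point s t)" for x
    proof
      assume "\<exists>s t. x = M *v conic_point s t"
      then obtain s t where "x = M *v conic_point s t" by blast
      then have "x = \<phi> (\<chi> i. if i = 0 then s else t)"
        by (simp add: \<phi>_def)
      then show "\<exists>p. x = \<phi> p" by blast
    qed (auto simp: \<phi>_def)
    then show ?thesis
      by (simp add: conic_set_def)
  qed
  \<comment> \<open>One point of the conic, the lower end of the chain. All nonzero multiples of its
    vector are reached because every scalar is a square.\<close>
  define P where "P = {x. x \<noteq> 0 \<and> (\<exists>p. x = \<psi> p)}"
  have P: "P = {x. x \<noteq> 0 \<and> (\<forall>\<phi>\<in>insert (\<lambda>x. (L *v x) $ 1) (insert (\<lambda>x. (L *v x) $ 2)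
      (range (\<lambda>i x. ((M ** L) *v x) $ i - x $ i))). \<phi> x = 0)}" (is "_ = ?P")
  proof (rule set_eqI)
    fix x
    have "x \<in> ?P \<longleftrightarrow> x \<noteq> 0 \<and> (L *v x) $ 1 = 0 \<and> (L *v x) $ 2 = 0 \<and> M *v (L *v x) = x"
      by (auto simp: vec_eq_iff matrix_vector_mul_assoc[symmetric])
    moreover have "(\<exists>p. x = \<psi> p) \<longleftrightarrow> (L *v x) $ 1 = 0 \<and> (L *v x) $ 2 = 0 \<and> M *v (L *v x) = x"
    proof
      assume R: "(L *v x) $ 1 = 0 \<and> (L *v x) $ 2 = 0 \<and> M *v (L *v x) = x"
      obtain t where "t ^ 2 = (L *v x) $ 0"
        using nth_root_exists[of 2] by (metis zero_less_numeral)
      then have "L *v x = conic_point 0 t"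
        using R by (simp add: vec3_eq_iff conic_point_def)
      then have "x = \<psi> (\<chi> i. t)"
        using R by (simp add: \<psi>_def)
      then show "\<exists>p. x = \<psi> p" by blast
    qed (auto simp: \<psi>_def LM' conic_point_def)
    ultimately show "x \<in> P \<longleftrightarrow> x \<in> ?P"
      by (simp add: P_def)
  qed
  have Pclosed: "zariski_closed P"
    unfolding P
  proof (rule zariski_closed_forms)
    fix \<theta> assume "\<theta> \<in> insert (\<lambda>x. (L *v x) $ 1) (insert (\<lambda>x. (L *v x) $ 2)
      (range (\<lambda>i x. ((M ** L) *v x) $ i - x $ i)))"
    moreover have "formfun 1 (\<lambda>x. ((M ** L) *v x) $ i - x $ i)" for i
      by (intro formfun_diff formfun_matrix formfun_nth)
    ultimately show "\<exists>d. formfun d \<theta>"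
      using formfun_matrix by blast
  qed
  have Pirr: "zariski_irreducible P"
    unfolding P_def
  proof (rule zariski_irreducible_image[OF \<psi>])
    show "\<psi> (\<chi> i. 1) \<noteq> 0"
      by (simp add: \<psi>_def inj conic_point_def vec3_eq_iff)
  qed
  have Cirr: "zariski_irreducible (conic_set M)"
    unfolding conic
  proof (rule zariski_irreducible_image[OF \<phi>])
    show "\<phi> (\<chi> i. 1) \<noteq> 0"
      by (simp add: \<phi>_def inj conic_point_def vec3_eq_iff)
  qed
  have sub: "P \<subseteq> conic_set M"
    by (auto simp: P_def \<psi>_def conic_set_def)
  have "M *v conic_point 1 1 \<in> conic_set M"
  proof -
    have "M *v conic_point 1 1 \<noteq> 0"
      unfolding inj by (simp add: conic_point_def vec3_eq_iff)
    then show ?thesis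
      unfolding conic_set_def by blast
  qed
  moreover have "M *v conic_point 1 1 \<notin> P"
    by (auto simp: P LM' conic_point_def)
  ultimately have psub: "P \<subset> conic_set M"
    using sub by blast
  show ?thesis
  proof (rule proj_dim_eqI[where C = "\<lambda>i. if i = 0 then P else conic_set M" and \<phi> = \<phi>])
    show "conic_set M \<subseteq> range \<phi>"
      unfolding conic by blast
  qed (use Pclosed Pirr Cirr sub psub zariski_closed_conic[OF LM] \<phi> in \<open>auto split: if_splits\<close>)
qed

section \<open>The polar image\<close>

lemma dot_ext: "(\<And>w. dot a w = dot b w) \<Longrightarrow> a = b"
  using dot_eq_0_imp[of "a - b"] by (simp add: dot_linear)

lemma dim_hyperplane:
  fixes w :: "'a::field ^ 'n"
  assumes "w \<noteq> 0"
  shows "vec.dim {v. dot w v = 0} + 1 = CARD('n)"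
proof -
  let ?H = "{v. dot w v = 0}"
  obtain a where a: "dot w a \<noteq> 0"
    using assms dot_eq_0_imp by blast
  have sub: "vec.subspace ?H"
    by (auto simp: vec.subspace_def dot_linear)
  have "v \<in> vec.span (insert a ?H)" for v
  proof -
    have "v - (dot w v / dot w a) *s a \<in> ?H"
      using a by (simp add: dot_linear)
    then have "v - (dot w v / dot w a) *s a \<in> vec.span ?H"
      by (rule vec.span_base)
    then show ?thesis
      unfolding vec.span_breakdown_eq by blast
  qed
  then have "vec.span (insert a ?H) = UNIV"
    by blast
  then have "vec.dim (insert a ?H) = CARD('n)"
    by (metis vec.dim_span vec_dim_card)
  moreover have "a \<notin> vec.span ?H"
    using a sub vec.span_minimal[OF order_refl sub] by blast
  ultimately show ?thesis
    by (simp add: vec.dim_insert)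
qed

lemma dual_space_hyperplane:
  fixes w :: "'a::field ^ 'n"
  assumes "w \<noteq> 0"
  shows "dual_space {v. dot w v = 0} = vec.span {w}"
proof (rule set_eqI)
  fix p
  obtain a where a: "dot w a \<noteq> 0"
    using assms dot_eq_0_imp by blast
  have "p \<in> dual_space {v. dot w v = 0} \<longleftrightarrow> (\<forall>v. dot w v = 0 \<longrightarrow> dot v p = 0)"
    by (simp add: dual_space_def dot_def)
  also have "\<dots> \<longleftrightarrow> p \<in> vec.span {w}"
  proof
    assume p: "\<forall>v. dot w v = 0 \<longrightarrow> dot v p = 0"
    have "p = (dot a p / dot w a) *s w"
    proof (rule dot_ext)
      fix v
      have "dot w (v - (dot w v / dot w a) *s a) = 0"
        using a by (simp add: dot_linear)
      then have "dot (v - (dot w v / dot w a) *s a) p = 0"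
        using p by blast
      then show "dot p v = dot ((dot a p / dot w a) *s w) v"
        by (simp add: dot_linear dot_commute[of v p])
    qed
    then show "p \<in> vec.span {w}"
      by (metis rangeI vec.span_singleton)
  qed (auto simp: vec.span_singleton dot_linear dot_commute)
  finally show "p \<in> dual_space {v. dot w v = 0} \<longleftrightarrow> p \<in> vec.span {w}" .
qed

lemma tangent_space_dot:
  "tangent_space Z z = {v. \<forall>g. homogeneous g \<and> (\<forall>x\<in>Z. peval g x = 0) \<longrightarrow> dot (grad g z) v = 0}"
  by (simp add: tangent_space_def dot_def)

text \<open>Lower bounds on tangent spaces come from velocities of curves inside the set; upper
  bounds come from single equations.\<close>

lemma tangent_space_curve:
  fixes q :: "'n::finite \<Rightarrow> 'a::field_char_0 poly"
  assumes "\<And>e. cpt q e \<noteq> 0 \<Longrightarrow> cpt q e \<in> Z" "cpt q 0 \<noteq> 0"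
  shows "(\<chi> i. poly (pderiv (q i)) 0) \<in> tangent_space Z (cpt q 0)"
  unfolding tangent_space_dot
proof (intro CollectI allI impI)
  fix g assume g: "homogeneous g \<and> (\<forall>x\<in>Z. peval g x = 0)"
  obtain i where i: "poly (q i) 0 \<noteq> 0"
    using assms(2) by (auto simp: vec_eq_iff)
  have "(\<Sum>i\<in>UNIV. grad g (cpt q 0) $ i * poly (pderiv (q i)) 0) = 0"
  proof (rule grad_curve_zero[of "{e. poly (q i) e = 0}"])
    show "finite {e. poly (q i) e = 0}"
      using i by (auto intro!: poly_roots_finite)
    fix e assume "e \<notin> {e. poly (q i) e = 0}"
    then have "cpt q e \<noteq> 0"
      by (auto simp: vec_eq_iff)
    then show "peval g (cpt q e) = 0"
      using assms(1) g by blast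
  qed
  then show "dot (grad g (cpt q 0)) (\<chi> i. poly (pderiv (q i)) 0) = 0"
    by (simp add: dot_def)
qed

lemma tangent_space_line:
  fixes x v :: "'a::field_char_0 ^ 'n::finite"
  assumes "\<And>e. x + e *s v \<noteq> 0 \<Longrightarrow> x + e *s v \<in> Z" "x \<noteq> 0"
  shows "v \<in> tangent_space Z x"
proof -
  have "(\<chi> i. poly (pderiv (line x v i)) 0) \<in> tangent_space Z (cpt (line x v) 0)"
    by (rule tangent_space_curve) (simp_all add: cpt_line assms)
  moreover have "(\<chi> i. poly (pderiv (line x v i)) 0) = v"
    by (simp add: vec_eq_iff)
  ultimately show ?thesis
    by (simp add: cpt_line)
qed

lemma subspace_tangent_space: "vec.subspace (tangent_space Z z)"
  by (auto simp: vec.subspace_def tangent_space_dot dot_linear)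

definition vec5 :: "'a \<Rightarrow> 'a \<Rightarrow> 'a \<Rightarrow> 'a \<Rightarrow> 'a \<Rightarrow> 'a ^ 5"
  where "vec5 a b c d e = (\<chi> i. if i = 0 then a else if i = 1 then b else if i = 2 then c
    else if i = 3 then d else e)"

lemma vec5_nth [simp]: "vec5 a b c d e $ 0 = a" "vec5 a b c d e $ 1 = b" "vec5 a b c d e $ 2 = c"
  "vec5 a b c d e $ 3 = d" "vec5 a b c d e $ 4 = e"
  by (simp_all add: vec5_def)

text \<open>\<open>A\<close> brings \<open>f\<close> to normal form and \<open>B\<close> is its
  inverse. Points are described by the coordinates \<open>B *v x\<close>, points of the dual space
  by the contragredient coordinates \<open>At *v z\<close>.\<close>

locale cubic_normal_form =
  fixes f :: "('a::{alg_closed_field, field_char_0}, 6) mpoly" and A B :: "'a ^ 6 ^ 6" and r :: "nat \<Rightarrow> 'a"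
  assumes AB: "A ** B = mat 1" and BA: "B ** A = mat 1"
    and form_f: "form 3 f" and hess_f: "vanishing_hessian f" and not_cone: "\<not> is_cone (hypersurface f)"
    and f_A: "peval f (A *v y) = normal_cubic r y"
begin

lemma AB_vec [simp]: "A *v (B *v x) = x" and BA_vec [simp]: "B *v (A *v x) = x"
  by (simp_all add: matrix_vector_mul_assoc AB BA)

definition At where "At = transpose A"
definition Bt where "Bt = transpose B"

lemma At_Bt [simp]: "At *v (Bt *v x) = x" and Bt_At [simp]: "Bt *v (At *v x) = x"
  unfolding At_def Bt_def
  by (simp_all only: matrix_vector_mul_assoc matrix_transpose_mul[symmetric] AB BA transpose_mat
      matrix_vector_mul_lid)

lemma dot_A: "dot (A *v x) y = dot x (At *v y)"
  unfolding At_def by (rule dot_matrix)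

lemma dot_Bt: "dot (Bt *v x) y = dot x (B *v y)"
  unfolding Bt_def using dot_matrix[of "transpose B" x y] by simp

lemma A_eq_0 [simp]: "A *v x = 0 \<longleftrightarrow> x = 0"
  by (metis BA_vec matrix_vector_mult_0_right)

lemma tB_eq_0 [simp]: "Bt *v x = 0 \<longleftrightarrow> x = 0"
  by (metis At_Bt matrix_vector_mult_0_right)

lemma f_eq: "peval f x = normal_cubic r (B *v x)"
  using f_A[of "B *v x"] by simp

text \<open>Otherwise x3 occurs only linearly, multiplied by a quadratic form in x4 and x5. A shift
  of x0, x1, x2 absorbs that form, which makes the vector \<open>n\<close> a vertex.\<close>

lemma cubic_involves_x3: "r 0 \<noteq> 0 \<or> r 1 \<noteq> 0 \<or> r 2 \<noteq> 0"
proof (rule ccontr)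
  assume "\<not> (r 0 \<noteq> 0 \<or> r 1 \<noteq> 0 \<or> r 2 \<noteq> 0)"
  then have r: "r 0 = 0" "r (Suc 0) = 0" "r 2 = 0"
    by simp_all
  define n where "n = vec6 (- r 3) (- r 4 / 2) (- r 5) 1 0 0"
  have n: "normal_cubic r (a *s n + y) = normal_cubic r y" for a y
    by (simp add: normal_cubic_def cubic_tail_def n_def r algebra_simps)
  have "A *v n \<noteq> 0"
    unfolding A_eq_0 by (simp add: n_def vec6_eq_iff)
  moreover have "peval f (A *v n) = 0"
    using n[of 1 0] by (simp add: f_A) (simp add: normal_cubic_def cubic_tail_def)
  ultimately have mem: "A *v n \<in> hypersurface f"
    by (simp add: hypersurface_def)
  have zero: "peval f w = 0" if q: "q \<in> hypersurface f" and w: "w \<in> vec.span {A *v n, q}" for q w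
  proof -
    obtain a where "w - a *s (A *v n) \<in> vec.span {q}"
      using w vec.span_breakdown_eq by blast
    then obtain b where "w - a *s (A *v n) = b *s q"
      by (auto simp: vec.span_singleton)
    then have "w = A *v (a *s n + b *s (B *v q))"
      by (simp add: matrix_vector_right_distrib vector_scalar_commute algebra_simps)
    then have "peval f w = peval f (b *s q)"
      by (simp add: f_A n) (simp add: f_eq vector_scalar_commute)
    then show ?thesis
      using q by (simp add: form_scale[OF form_f] hypersurface_def)
  qed
  have "is_cone (hypersurface f)"
    unfolding is_cone_def
  proof (intro bexI[OF _ mem] ballI impI subsetI)
    fix q w assume "q \<in> hypersurface f" "w \<in> vec.span {A *v n, q} - {0}"
    then show "w \<in> hypersurface f"
      using zero[of q w] by (simp add: hypersurface_def)
  qed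
  then show False
    using not_cone by blast
qed

text \<open>\<open>tail3\<close>, \<open>tail4\<close> and \<open>tail5\<close> are the partial
  derivatives of \<open>cubic_tail r u s t\<close> in \<open>u\<close>, \<open>s\<close> and
  \<open>t\<close>, numbered by the coordinates of the normal form.\<close>

definition tail3 :: "'a \<Rightarrow> 'a \<Rightarrow> 'a \<Rightarrow> 'a" where
  "tail3 u s t = 3 * r 0 * u ^ 2 + 2 * u * (r 1 * s + r 2 * t) + (r 3 * s ^ 2 + r 4 * (s * t) + r 5 * t ^ 2)"

definition tail4 :: "'a \<Rightarrow> 'a \<Rightarrow> 'a \<Rightarrow> 'a" where
  "tail4 u s t = u ^ 2 * r 1 + u * (2 * r 3 * s + r 4 * t) + (3 * r 6 * s ^ 2 + 2 * r 7 * (s * t) + r 8 * t ^ 2)"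

definition tail5 :: "'a \<Rightarrow> 'a \<Rightarrow> 'a \<Rightarrow> 'a" where
  "tail5 u s t = u ^ 2 * r 2 + u * (r 4 * s + 2 * r 5 * t) + (r 7 * s ^ 2 + 2 * r 8 * (s * t) + 3 * r 9 * t ^ 2)"

definition grad_normal :: "'a ^ 6 \<Rightarrow> 'a ^ 6" where
  "grad_normal y = vec6 (y $ 4 ^ 2) (2 * y $ 4 * y $ 5) (y $ 5 ^ 2) (tail3 (y $ 3) (y $ 4) (y $ 5))
    (2 * (y $ 0 * y $ 4 + y $ 1 * y $ 5) + tail4 (y $ 3) (y $ 4) (y $ 5))
    (2 * (y $ 1 * y $ 4 + y $ 2 * y $ 5) + tail5 (y $ 3) (y $ 4) (y $ 5))"

lemma dot_grad_normal: "dot (grad f (A *v y)) (A *v v) = dot (grad_normal y) v"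
proof -
  define q where "q i = [:y $ i, v $ i:]" for i
  have q: "poly (q i) e = (y + e *s v) $ i" and q0: "poly (q i) 0 = y $ i" "poly (pderiv (q i)) 0 = v $ i"
    for i e
    by (simp_all add: q_def pderiv_pCons)
  define p where "p = q 0 * q 4 ^ 2 + 2 * q 1 * q 4 * q 5 + q 2 * q 5 ^ 2 +
    (smult (r 0) (q 3 ^ 3) + q 3 ^ 2 * (smult (r 1) (q 4) + smult (r 2) (q 5)) +
    q 3 * (smult (r 3) (q 4 ^ 2) + smult (r 4) (q 4 * q 5) + smult (r 5) (q 5 ^ 2)) +
    (smult (r 6) (q 4 ^ 3) + smult (r 7) (q 4 ^ 2 * q 5) + smult (r 8) (q 4 * q 5 ^ 2) + smult (r 9) (q 5 ^ 3)))"
  have "dot (grad f (A *v y)) (A *v v) = poly (pderiv p) 0"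
  proof (rule dot_grad_line)
    fix e
    have "A *v y + e *s (A *v v) = A *v (y + e *s v)"
      by (simp add: matrix_vector_right_distrib vector_scalar_commute)
    then show "poly p e = peval f (A *v y + e *s (A *v v))"
      by (simp add: f_A normal_cubic_def cubic_tail_def p_def q)
  qed
  also have "\<dots> = dot (grad_normal y) v"
    by (simp add: p_def pderiv_add pderiv_mult pderiv_smult pderiv_power q0 dot_6 grad_normal_def
        tail3_def tail4_def tail5_def power2_eq_square power3_eq_cube algebra_simps)
  finally show ?thesis .
qed

lemma grad_f: "grad f x = Bt *v grad_normal (B *v x)"
proof (rule dot_ext)
  fix w
  have "dot (grad f x) w = dot (grad f (A *v (B *v x))) (A *v (B *v w))"
    by simp
  also have "\<dots> = dot (grad_normal (B *v x)) (B *v w)"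
    by (rule dot_grad_normal)
  finally show "dot (grad f x) w = dot (Bt *v grad_normal (B *v x)) w"
    by (simp add: dot_Bt)
qed

text \<open>\<open>quad_point\<close> parametrises the cone over the quadric \<open>\<eta>\<^sub>1\<^sup>2 = 4 \<eta>\<^sub>0 \<eta>\<^sub>2\<close>, where \<open>\<eta>\<close> are the coordinates
  dual to \<open>B *v x\<close>; this quadric is the polar image, and its vertex is \<open>s = t = 0\<close>.\<close>

definition quad_point :: "'a \<Rightarrow> 'a \<Rightarrow> 'a \<Rightarrow> 'a \<Rightarrow> 'a \<Rightarrow> 'a ^ 6" where
  "quad_point s t p q w = Bt *v vec6 (s ^ 2) (2 * s * t) (t ^ 2) p q w"

definition quadric :: "('a ^ 6) set" where
  "quadric = {z. z \<noteq> 0 \<and> (At *v z) $ 1 ^ 2 - 4 * ((At *v z) $ 0 * (At *v z) $ 2) = 0}"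

section \<open>The quadric cone and the closure of the image of the gradient\<close>

lemma quadric_form:
  "formfun 2 (\<lambda>z. (At *v z) $ 1 ^ 2 - 4 * ((At *v z) $ 0 * (At *v z) $ 2))"
  by (intro formfun_diff formfun_cmult formfun_mult[OF formfun_matrix formfun_matrix]
      formfun_power[OF formfun_matrix]) simp_all

lemma quad_point_eq_0: "quad_point s t p q w = 0 \<longleftrightarrow> s = 0 \<and> t = 0 \<and> p = 0 \<and> q = 0 \<and> w = 0"
  unfolding quad_point_def tB_eq_0 by (auto simp: vec6_eq_iff)

lemma quadric_iff: "z \<in> quadric \<longleftrightarrow> z \<noteq> 0 \<and> (\<exists>s t p q w. z = quad_point s t p q w)"
proof -
  let ?y = "At *v z"
  have "(\<exists>s t p q w. z = quad_point s t p q w) \<longleftrightarrow> ?y $ 1 ^ 2 - 4 * (?y $ 0 * ?y $ 2) = 0"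
  proof
    assume eq: "?y $ 1 ^ 2 - 4 * (?y $ 0 * ?y $ 2) = 0"
    obtain s t where st: "s ^ 2 = ?y $ 0" "t ^ 2 = ?y $ 2"
      using nth_root_exists[of 2] by (metis zero_less_numeral)
    have "(?y $ 1) ^ 2 = (2 * s * t) ^ 2"
      using eq by (simp add: st power_mult_distrib)
    then have "?y $ 1 = 2 * s * t \<or> ?y $ 1 = - (2 * s * t)"
      by (simp add: power2_eq_iff)
    then have "?y $ 1 = 2 * s * t \<or> ?y $ 1 = 2 * (- s) * t"
      by simp
    then obtain s' where "s' ^ 2 = ?y $ 0" "?y $ 1 = 2 * s' * t"
      using st(1) by (metis power2_minus)
    then have "?y = vec6 (s' ^ 2) (2 * s' * t) (t ^ 2) (?y $ 3) (?y $ 4) (?y $ 5)"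
      using st(2) by (simp add: vec6_eq_iff)
    then have "z = quad_point s' t (?y $ 3) (?y $ 4) (?y $ 5)"
      unfolding quad_point_def by (metis Bt_At)
    then show "\<exists>s t p q w. z = quad_point s t p q w"
      by blast
  qed (auto simp: quad_point_def power_mult_distrib)
  then show ?thesis
    by (simp add: quadric_def)
qed

lemma quad_point_in_quadric: "quad_point s t p q w \<noteq> 0 \<Longrightarrow> quad_point s t p q w \<in> quadric"
  unfolding quadric_iff by (intro conjI exI) (assumption, rule refl)

lemma quadric_closed: "zariski_closed quadric"
  unfolding quadric_def by (rule zariski_closed_form[OF quadric_form])

lemma grad_f_quad_point: "grad f x = quad_point ((B *v x) $ 4) ((B *v x) $ 5) (grad_normal (B *v x) $ 3)
    (grad_normal (B *v x) $ 4) (grad_normal (B *v x) $ 5)"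
  by (simp add: grad_f quad_point_def grad_normal_def)

lemma quad_point_polyfun:
  "polyfun (\<lambda>x :: 'a ^ 5. quad_point (x $ 0) (x $ 1) (x $ 2) (x $ 3) (x $ 4) $ i)"
  unfolding quad_point_def
  by (rule polyfun_matrix_comp) (unfold vec6_def vec_lambda_beta,
      intro polyfun_if polyfun_power polyfun_mult polyfun_nth polyfun_const)

text \<open>The coordinate with index 3 gives an equation of degree at most two in \<open>u\<close>,
  which the second hypothesis keeps from being constant. The last two coordinates are then linear
  equations for \<open>y1\<close> and \<open>y0\<close> with leading coefficient
  \<open>2 * s\<close>.\<close>

lemma gradient_surjective:
  assumes "s \<noteq> 0" "r 0 \<noteq> 0 \<or> r 1 * s + r 2 * t \<noteq> 0"
  obtains x where "x \<noteq> 0" "grad f x = quad_point s t p q w"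
proof -
  let ?P = "[:r 3 * s ^ 2 + r 4 * (s * t) + r 5 * t ^ 2 - p, 2 * (r 1 * s + r 2 * t), 3 * r 0:]"
  have "degree ?P > 0"
    using assms(2) by (cases "r 0 = 0") (simp_all del: distrib_left_numeral)
  then obtain u where u: "poly ?P u = 0"
    using alg_closed_imp_poly_has_root by blast
  define y1 where "y1 = (w - tail5 u s t) / (2 * s)"
  define y0 where "y0 = (q - tail4 u s t - 2 * y1 * t) / (2 * s)"
  define x where "x = A *v vec6 y0 y1 0 u s t"
  have "tail3 u s t = p"
    using u by (simp add: tail3_def algebra_simps power2_eq_square)
  moreover have "2 * (y0 * s + y1 * t) + tail4 u s t = q"
    using assms(1) by (simp add: y0_def field_simps)
  moreover have "2 * (y1 * s) + tail5 u s t = w"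
    using assms(1) by (simp add: y1_def field_simps)
  ultimately have "grad f x = quad_point s t p q w"
    by (simp add: grad_f x_def grad_normal_def quad_point_def)
  moreover have "x \<noteq> 0"
    unfolding x_def A_eq_0 using assms(1) by (simp add: vec6_eq_iff)
  ultimately show ?thesis
    using that by blast
qed

lemma polar_image_eq: "polar_image f = quadric"
proof
  show "polar_image f \<subseteq> quadric"
    unfolding polar_image_def
  proof (rule zariski_closure_minimal[OF quadric_closed])
    show "{y. y \<noteq> 0 \<and> (\<exists>p. p \<noteq> 0 \<and> y = grad f p)} - {0} \<subseteq> quadric"
      unfolding quadric_iff subset_iff using grad_f_quad_point by blast
  qed
  show "quadric \<subseteq> polar_image f"
  proof
    fix z assume "z \<in> quadric"
    then obtain s t p q w where z: "z \<noteq> 0" "z = quad_point s t p q w"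
      unfolding quadric_iff by blast
    have "h z = 0" if h: "formfun d h" and zero: "\<forall>y\<in>{y. y \<noteq> 0 \<and> (\<exists>p. p \<noteq> 0 \<and> y = grad f p)} - {0}. h y = 0"
      for d h
    proof -
      \<comment> \<open>Nonzero exactly where \<open>gradient_surjective\<close> applies, and
        somewhere nonzero by \<open>cubic_involves_x3\<close>. A form vanishing on all gradients
        therefore vanishes on the whole parametrised quadric.\<close>
      define \<phi> where "\<phi> = (\<lambda>x :: 'a ^ 5. x $ 0 * (if r 0 \<noteq> 0 then 1 else r 1 * x $ 0 + r 2 * x $ 1))"
      define \<psi> where "\<psi> = (\<lambda>x :: 'a ^ 5. h (quad_point (x $ 0) (x $ 1) (x $ 2) (x $ 3) (x $ 4)))"
      have \<phi>: "polyfun \<phi>"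
        unfolding \<phi>_def by (intro polyfun_mult polyfun_if polyfun_nth polyfun_const polyfun_add)
      have \<psi>: "polyfun \<psi>"
        unfolding \<psi>_def by (rule polyfun_comp[OF formfun_imp_polyfun[OF h] quad_point_polyfun])
      have prod: "\<phi> x = 0 \<or> \<psi> x = 0" for x
      proof (rule disjCI)
        assume nz: "\<psi> x \<noteq> 0"
        show "\<phi> x = 0"
        proof (rule ccontr)
          assume "\<phi> x \<noteq> 0"
          then have x0: "x $ 0 \<noteq> 0" and x1: "r 0 \<noteq> 0 \<or> r 1 * x $ 0 + r 2 * x $ 1 \<noteq> 0"
            by (auto simp: \<phi>_def split: if_splits)
          obtain y where y: "y \<noteq> 0" "grad f y = quad_point (x $ 0) (x $ 1) (x $ 2) (x $ 3) (x $ 4)"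
            by (rule gradient_surjective[OF x0 x1])
          have "grad f y \<noteq> 0"
            using x0 by (simp add: y(2) quad_point_eq_0)
          then have "h (grad f y) = 0"
            using zero y(1) by blast
          then show False
            using nz y(2) by (simp add: \<psi>_def)
        qed
      qed
      have "\<exists>a. \<phi> a \<noteq> 0"
      proof (cases "r 0 = 0 \<and> r 1 = 0")
        case True
        then have "\<phi> (vec5 1 1 0 0 0) \<noteq> 0"
          using cubic_involves_x3 by (simp add: \<phi>_def)
        then show ?thesis ..
      next
        case False
        then have "\<phi> (vec5 1 0 0 0 0) \<noteq> 0"
          by (auto simp: \<phi>_def)
        then show ?thesis ..
      qed
      then obtain a where a: "\<phi> a \<noteq> 0" ..
      have "\<psi> (vec5 s t p q w) = 0"
        by (rule polyfun_mult_eq_zero[OF \<phi> \<psi> prod a])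
      then show ?thesis
        by (simp add: \<psi>_def z(2))
    qed
    then show "z \<in> polar_image f"
      unfolding polar_image_def zariski_closure_iff using z(1) by blast
  qed
qed

section \<open>Linear subspaces, irreducibility and dimension of the quadric\<close>

definition coord_subspace :: "6 set \<Rightarrow> ('a ^ 6) set" where
  "coord_subspace I = {z. z \<noteq> 0 \<and> (\<forall>\<phi>\<in>(\<lambda>i z. (At *v z) $ i) ` I. \<phi> z = 0)}"

lemma coord_subspace_iff: "z \<in> coord_subspace I \<longleftrightarrow> z \<noteq> 0 \<and> (\<forall>i\<in>I. (At *v z) $ i = 0)"
  by (simp add: coord_subspace_def)

lemma coord_subspace_closed: "zariski_closed (coord_subspace I)"
  unfolding coord_subspace_def by (rule zariski_closed_forms) (use formfun_matrix in blast)

lemma coord_subspace_irreducible: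
  assumes "j \<notin> I"
  shows "zariski_irreducible (coord_subspace I)"
proof -
  define \<phi> :: "'a ^ 6 \<Rightarrow> 'a ^ 6" where "\<phi> x = Bt *v (\<chi> i. if i \<in> I then 0 else x $ i)" for x
  have "(\<exists>x. z = \<phi> x) \<longleftrightarrow> (\<forall>i\<in>I. (At *v z) $ i = 0)" for z
  proof
    assume "\<forall>i\<in>I. (At *v z) $ i = 0"
    then have "At *v z = (\<chi> i. if i \<in> I then 0 else (At *v z) $ i)"
      by (simp add: vec_eq_iff)
    then have "z = \<phi> (At *v z)"
      unfolding \<phi>_def by (metis Bt_At)
    then show "\<exists>x. z = \<phi> x" ..
  qed (auto simp: \<phi>_def)
  then have "coord_subspace I = {z. z \<noteq> 0 \<and> (\<exists>x. z = \<phi> x)}"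
    by (auto simp: coord_subspace_iff)
  moreover have "zariski_irreducible {z. z \<noteq> 0 \<and> (\<exists>x. z = \<phi> x)}"
  proof (rule zariski_irreducible_image)
    show "polyfun (\<lambda>x. \<phi> x $ i)" for i
      unfolding \<phi>_def
      by (rule polyfun_matrix_comp) (unfold vec_lambda_beta, intro polyfun_if polyfun_const polyfun_nth)
    show "\<phi> (\<chi> i. 1) \<noteq> 0"
    proof
      assume "\<phi> (\<chi> i. 1) = 0"
      then have "(\<chi> i. if i \<in> I then 0 else (\<chi> i. 1) $ i) = (0 :: 'a ^ 6)"
        unfolding \<phi>_def tB_eq_0 .
      then have "(\<chi> i. if i \<in> I then 0 else (\<chi> i. 1) $ i) $ j = (0 :: 'a ^ 6) $ j"
        by (rule arg_cong)
      then show False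
        using assms by simp
    qed
  qed
  ultimately show ?thesis
    by simp
qed

lemma quadric_irreducible: "zariski_irreducible quadric"
proof -
  define \<phi> where "\<phi> = (\<lambda>x :: 'a ^ 5. quad_point (x $ 0) (x $ 1) (x $ 2) (x $ 3) (x $ 4))"
  have "(\<exists>s t p q w. z = quad_point s t p q w) \<longleftrightarrow> (\<exists>x. z = \<phi> x)" for z
  proof
    assume "\<exists>s t p q w. z = quad_point s t p q w"
    then obtain s t p q w where "z = \<phi> (vec5 s t p q w)"
      by (auto simp: \<phi>_def)
    then show "\<exists>x. z = \<phi> x" ..
  next
    assume "\<exists>x. z = \<phi> x"
    then show "\<exists>s t p q w. z = quad_point s t p q w"
      unfolding \<phi>_def by blast
  qed
  then have "quadric = {z. z \<noteq> 0 \<and> (\<exists>x. z = \<phi> x)}"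
    by (auto simp: quadric_iff)
  moreover have "zariski_irreducible {z. z \<noteq> 0 \<and> (\<exists>x. z = \<phi> x)}"
  proof (rule zariski_irreducible_image)
    show "polyfun (\<lambda>x. \<phi> x $ i)" for i
      unfolding \<phi>_def by (rule quad_point_polyfun)
    show "\<phi> (vec5 1 1 1 1 1) \<noteq> 0"
      by (simp add: \<phi>_def quad_point_eq_0)
  qed
  ultimately show ?thesis
    by simp
qed

text \<open>The quadric contains the linear space of dimension three where the dual coordinates 0
  and 1 vanish. A flag in it, continued by the quadric, has length four, and the five parameters of
  \<open>quad_point\<close> give the upper bound.\<close>

lemma proj_dim_quadric: "proj_dim quadric = 4"
proof -
  define C where "C = (\<lambda>i::nat. [coord_subspace {0, 1, 3, 4, 5}, coord_subspace {0, 1, 4, 5},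
    coord_subspace {0, 1, 5}, coord_subspace {0, 1}, quadric] ! i)"
  have C: "C 0 = coord_subspace {0, 1, 3, 4, 5}" "C 1 = coord_subspace {0, 1, 4, 5}"
    "C 2 = coord_subspace {0, 1, 5}" "C 3 = coord_subspace {0, 1}" "C 4 = quadric"
    by (simp_all add: C_def)
  have cases: "i = 0 \<or> i = 1 \<or> i = 2 \<or> i = 3 \<or> i = 4" if "i \<le> 4" for i :: nat
    using that by linarith
  have witness: "Bt *v axis j 1 \<in> coord_subspace I \<longleftrightarrow> j \<notin> I" for j I
  proof -
    have "Bt *v axis j 1 \<noteq> 0"
      unfolding tB_eq_0 axis_eq_0_iff by simp
    then show ?thesis
      unfolding coord_subspace_iff At_Bt by (auto simp: axis_def)
  qed
  have mono: "coord_subspace I \<subset> coord_subspace J" if "J \<subseteq> I" "j \<in> I" "j \<notin> J" for I J j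
  proof -
    have "coord_subspace I \<subseteq> coord_subspace J"
      unfolding subset_iff coord_subspace_iff using that(1) by blast
    then show ?thesis
      using witness[of j I] witness[of j J] that(2,3) by blast
  qed
  have sub3: "coord_subspace {0, 1} \<subseteq> quadric"
    by (auto simp: coord_subspace_iff quadric_def)
  have "quad_point 1 0 0 0 0 \<in> quadric"
    by (rule quad_point_in_quadric) (simp add: quad_point_eq_0)
  moreover have "quad_point 1 0 0 0 0 \<notin> coord_subspace {0, 1}"
    by (simp add: coord_subspace_iff quad_point_def)
  ultimately have s34: "coord_subspace {0, 1} \<subset> quadric"
    using sub3 by blast
  have s01: "C 0 \<subset> C 1"
    unfolding C by (rule mono[where j = 3]) auto
  have s12: "C 1 \<subset> C 2"
    unfolding C by (rule mono[where j = 4]) auto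
  have s23: "C 2 \<subset> C 3"
    unfolding C by (rule mono[where j = 5]) auto
  show ?thesis
  proof (rule proj_dim_eqI[where C = C and \<phi> = "\<lambda>x :: 'a ^ 5. quad_point (x $ 0) (x $ 1) (x $ 2) (x $ 3) (x $ 4)"])
    show "zariski_closed (C i)" if "i \<le> 4" for i
      using cases[OF that] coord_subspace_closed quadric_closed C by metis
    show "zariski_irreducible (C i)" if "i \<le> 4" for i
    proof -
      have "zariski_irreducible (coord_subspace I)" if "2 \<notin> I" for I
        by (rule coord_subspace_irreducible[OF that])
      then have "zariski_irreducible (C 0)" "zariski_irreducible (C 1)" "zariski_irreducible (C 2)"
        "zariski_irreducible (C 3)" "zariski_irreducible (C 4)"
        unfolding C using quadric_irreducible by simp_all
      then show ?thesis
        using cases[OF that] by metis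
    qed
    show "C i \<subset> C (Suc i)" if "i < 4" for i
    proof -
      have "i = 0 \<or> i = 1 \<or> i = 2 \<or> i = 3"
        using that by linarith
      then show ?thesis
        using s01 s12 s23 s34 C by (elim disjE) (simp_all add: numeral_2_eq_2 numeral_3_eq_3 eval_nat_numeral)
    qed
    show "C i \<subseteq> quadric" if "i \<le> 4" for i
      using cases[OF that] s01 s12 s23 s34 unfolding C(1)[symmetric] by (elim disjE) (auto simp: C)
    show "quadric \<subseteq> range (\<lambda>x :: 'a ^ 5. quad_point (x $ 0) (x $ 1) (x $ 2) (x $ 3) (x $ 4))"
    proof
      fix z assume "z \<in> quadric"
      then obtain s t p q w where "z = quad_point s t p q w"
        unfolding quadric_iff by blast
      then have "z = (\<lambda>x :: 'a ^ 5. quad_point (x $ 0) (x $ 1) (x $ 2) (x $ 3) (x $ 4)) (vec5 s t p q w)"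
        by simp
      then show "z \<in> range (\<lambda>x :: 'a ^ 5. quad_point (x $ 0) (x $ 1) (x $ 2) (x $ 3) (x $ 4))"
        by (rule range_eqI)
    qed
  qed (use quad_point_polyfun in auto)
qed

section \<open>Tangent spaces and smooth points of the quadric\<close>

definition conic_pt :: "'a \<Rightarrow> 'a \<Rightarrow> 'a ^ 6" where
  "conic_pt s t = A *v vec6 (t ^ 2) (- (s * t)) (s ^ 2) 0 0 0"

lemma dot_conic_pt: "dot (conic_pt s t) v = t ^ 2 * (At *v v) $ 0 - s * t * (At *v v) $ 1 +
    s ^ 2 * (At *v v) $ 2"
  unfolding conic_pt_def dot_A by (simp add: dot_6)

lemma conic_pt_eq_0: "conic_pt s t = 0 \<longleftrightarrow> s = 0 \<and> t = 0"
  unfolding conic_pt_def A_eq_0 by (auto simp: vec6_eq_iff)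

lemma tangent_space_quadric_subset:
  assumes "v \<in> tangent_space quadric (quad_point s t p q w)"
  shows "dot (conic_pt s t) v = 0"
proof -
  obtain g where g: "form 2 g"
    "\<And>z. peval g z = (At *v z) $ 1 ^ 2 - 4 * ((At *v z) $ 0 * (At *v z) $ 2)"
    using quadric_form by (auto simp: formfun_def)
  let ?z = "quad_point s t p q w" and ?v = "At *v v"
  let ?P = "[:2 * s * t, ?v $ 1:] ^ 2 - [:4:] * ([:s ^ 2, ?v $ 0:] * [:t ^ 2, ?v $ 2:])"
  have "dot (grad g ?z) v = poly (pderiv ?P) 0"
    by (rule dot_grad_line)
      (simp add: g quad_point_def matrix_vector_right_distrib vector_scalar_commute algebra_simps)
  also have "\<dots> = - 4 * dot (conic_pt s t) v"
    by (simp add: dot_conic_pt pderiv_diff pderiv_mult pderiv_power pderiv_pCons pderiv_smult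
        power2_eq_square algebra_simps)
  finally have "dot (grad g ?z) v = - 4 * dot (conic_pt s t) v" .
  moreover have "homogeneous g \<and> (\<forall>x\<in>quadric. peval g x = 0)"
    using g(1) by (auto simp: homogeneous_def quadric_def g(2))
  ultimately show ?thesis
    using assms by (auto simp: tangent_space_dot)
qed

lemma quad_point_curve:
  assumes "quad_point s t p q w \<noteq> 0"
  shows "Bt *v vec6 (2 * s * a) (2 * (s * b + t * a)) (2 * t * b) p' q' w' \<in>
    tangent_space quadric (quad_point s t p q w)"
proof -
  define S where "S = [:s, a:]" define T where "T = [:t, b:]"
  have ST: "poly S 0 = s" "poly T 0 = t" "poly (pderiv S) 0 = a" "poly (pderiv T) 0 = b"
    by (simp_all add: S_def T_def pderiv_pCons)
  define P Q W where "P = [:p, p':]" and "Q = [:q, q':]" and "W = [:w, w':]"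
  have PQW: "poly P e = p + e * p'" "poly Q e = q + e * q'" "poly W e = w + e * w'"
    "poly (pderiv P) 0 = p'" "poly (pderiv Q) 0 = q'" "poly (pderiv W) 0 = w'" for e
    by (simp_all add: P_def Q_def W_def pderiv_pCons)
  define Y where "Y = vec6 (S ^ 2) (2 * S * T) (T ^ 2) P Q W"
  define c where "c i = (\<Sum>j\<in>UNIV. smult (Bt $ i $ j) (Y $ j))" for i
  have cpt: "cpt c e = quad_point (poly S e) (poly T e) (p + e * p') (q + e * q') (w + e * w')" for e
    by (simp add: vec_eq_iff quad_point_def c_def poly_sum matrix_vector_mult_def sum_6 Y_def PQW)
  have "(\<chi> i. poly (pderiv (c i)) 0) \<in> tangent_space quadric (cpt c 0)"
    by (rule tangent_space_curve) (use assms quad_point_in_quadric in \<open>simp_all add: cpt ST\<close>)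
  moreover have "(\<chi> i. poly (pderiv (c i)) 0) =
      Bt *v vec6 (2 * s * a) (2 * (s * b + t * a)) (2 * t * b) p' q' w'"
    by (simp add: vec_eq_iff c_def poly_sum matrix_vector_mult_def sum_6 Y_def pderiv_smult pderiv_add
        pderiv_power pderiv_mult ST PQW algebra_simps)
  ultimately show ?thesis
    by (simp add: cpt ST)
qed

text \<open>Off the vertex the map from (s, t) to (s^2, 2 s t, t^2) has a differential of rank two,
  so together with the three free coordinates the velocities fill the tangent hyperplane.\<close>

lemma tangent_space_quadric:
  assumes "s \<noteq> 0 \<or> t \<noteq> 0"
  shows "tangent_space quadric (quad_point s t p q w) = {v. dot (conic_pt s t) v = 0}"
proof
  show "tangent_space quadric (quad_point s t p q w) \<subseteq> {v. dot (conic_pt s t) v = 0}"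
    using tangent_space_quadric_subset by blast
  show "{v. dot (conic_pt s t) v = 0} \<subseteq> tangent_space quadric (quad_point s t p q w)"
  proof
    fix v assume "v \<in> {v. dot (conic_pt s t) v = 0}"
    then have v: "t ^ 2 * (At *v v) $ 0 - s * t * (At *v v) $ 1 +
        s ^ 2 * (At *v v) $ 2 = 0"
      by (simp add: dot_conic_pt)
    let ?n = "At *v v"
    have "\<exists>a b. 2 * s * a = ?n $ 0 \<and> 2 * (s * b + t * a) = ?n $ 1 \<and> 2 * t * b = ?n $ 2"
    proof (cases "s = 0")
      case True
      then have "?n $ 0 = 0"
        using v assms by simp
      then show ?thesis
        using True assms by (intro exI[of _ "?n $ 1 / (2 * t)"] exI[of _ "?n $ 2 / (2 * t)"]) simp
    next
      case False
      then have s2: "s ^ 2 \<noteq> 0"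
        by simp
      define a where "a = ?n $ 0 / (2 * s)"
      define b where "b = (?n $ 1 / 2 - t * a) / s"
      have 1: "2 * s * a = ?n $ 0"
        using False by (simp add: a_def)
      have 2: "2 * (s * b + t * a) = ?n $ 1"
        using False by (simp add: b_def field_simps)
      have "s ^ 2 * (2 * t * b) = s * t * (2 * (s * b + t * a)) - t ^ 2 * (2 * s * a)"
        by (simp add: power2_eq_square algebra_simps)
      also have "\<dots> = s ^ 2 * ?n $ 2"
        unfolding 1 2 using v by algebra
      finally have "2 * t * b = ?n $ 2"
        by (simp only: mult_left_cancel[OF s2])
      then show ?thesis
        using 1 2 by blast
    qed
    then obtain a b where ab: "2 * s * a = ?n $ 0" "2 * (s * b + t * a) = ?n $ 1" "2 * t * b = ?n $ 2"
      by (elim exE conjE)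
    have "Bt *v vec6 (2 * s * a) (2 * (s * b + t * a)) (2 * t * b) (?n $ 3) (?n $ 4) (?n $ 5) \<in>
        tangent_space quadric (quad_point s t p q w)"
      by (rule quad_point_curve) (use assms in \<open>auto simp: quad_point_eq_0\<close>)
    then show "v \<in> tangent_space quadric (quad_point s t p q w)"
      by (simp only: ab vec6_eta Bt_At)
  qed
qed

text \<open>Starting from a vertex point in the direction of any point of the quadric one stays on
  the quadric, so all these directions are tangent, and they span the whole space.\<close>

lemma tangent_space_vertex:
  assumes "quad_point 0 0 p q w \<noteq> 0"
  shows "tangent_space quadric (quad_point 0 0 p q w) = UNIV"
proof -
  have ray: "Bt *v vec6 (s ^ 2) (2 * s * t) (t ^ 2) p' q' w' \<in> tangent_space quadric (quad_point 0 0 p q w)"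
    for s t p' q' w'
  proof -
    let ?v = "Bt *v vec6 (s ^ 2) (2 * s * t) (t ^ 2) p' q' w'"
    show ?thesis
    proof (rule tangent_space_line[OF _ assms])
      fix e
      assume nz: "quad_point 0 0 p q w + e *s ?v \<noteq> 0"
      obtain k where k: "k ^ 2 = e"
        using nth_root_exists[of 2 e] by auto
      have "quad_point 0 0 p q w + e *s ?v = Bt *v (vec6 0 0 0 p q w +
          e *s vec6 (s ^ 2) (2 * s * t) (t ^ 2) p' q' w')"
        by (simp add: quad_point_def matrix_vector_right_distrib vector_scalar_commute)
      moreover have "vec6 0 0 0 p q w + e *s vec6 (s ^ 2) (2 * s * t) (t ^ 2) p' q' w' =
          vec6 ((k * s) ^ 2) (2 * (k * s) * (k * t)) ((k * t) ^ 2) (p + e * p') (q + e * q') (w + e * w')"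
        by (simp add: vec6_eq_iff k[symmetric] power2_eq_square)
      ultimately have "quad_point 0 0 p q w + e *s ?v =
          quad_point (k * s) (k * t) (p + e * p') (q + e * q') (w + e * w')"
        by (simp only: quad_point_def)
      then show "quad_point 0 0 p q w + e *s ?v \<in> quadric"
        using nz quad_point_in_quadric by simp
    qed
  qed
  have "v \<in> tangent_space quadric (quad_point 0 0 p q w)" for v
  proof -
    let ?n = "At *v v" and ?T = "tangent_space quadric (quad_point 0 0 p q w)"
    let ?r = "\<lambda>s t p q w. Bt *v vec6 (s ^ 2) (2 * s * t) (t ^ 2) p q w"
    \<comment> \<open>The direction with \<open>s = t = 1\<close> supplies the middle coordinate,
      and the directions (1, 0) and (0, 1) correct the outer two.\<close>
    have "?n = (?n $ 0 - ?n $ 1 / 2) *s vec6 (1 ^ 2) (2 * 1 * 0) (0 ^ 2) 0 0 0 +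
        ((?n $ 1 / 2) *s vec6 (1 ^ 2) (2 * 1 * 1) (1 ^ 2) 0 0 0 +
        ((?n $ 2 - ?n $ 1 / 2) *s vec6 (0 ^ 2) (2 * 0 * 1) (1 ^ 2) 0 0 0 +
         1 *s vec6 (0 ^ 2) (2 * 0 * 0) (0 ^ 2) (?n $ 3) (?n $ 4) (?n $ 5)))"
      by (simp add: vec6_eq_iff)
    then have "Bt *v ?n = (?n $ 0 - ?n $ 1 / 2) *s ?r 1 0 0 0 0 + ((?n $ 1 / 2) *s ?r 1 1 0 0 0 +
        ((?n $ 2 - ?n $ 1 / 2) *s ?r 0 1 0 0 0 + 1 *s ?r 0 0 (?n $ 3) (?n $ 4) (?n $ 5)))"
      by (metis (no_types) matrix_vector_right_distrib vector_scalar_commute)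
    moreover have "(?n $ 0 - ?n $ 1 / 2) *s ?r 1 0 0 0 0 + ((?n $ 1 / 2) *s ?r 1 1 0 0 0 +
        ((?n $ 2 - ?n $ 1 / 2) *s ?r 0 1 0 0 0 + 1 *s ?r 0 0 (?n $ 3) (?n $ 4) (?n $ 5))) \<in> ?T"
      by (intro vec.subspace_add[OF subspace_tangent_space] vec.subspace_scale[OF subspace_tangent_space] ray)
    ultimately have "Bt *v ?n \<in> ?T"
      by (simp only:)
    then show ?thesis
      by simp
  qed
  then show ?thesis
    by blast
qed

lemma smooth_locus_quadric:
  assumes "quad_point s t p q w \<noteq> 0"
  shows "quad_point s t p q w \<in> smooth_locus quadric \<longleftrightarrow> s \<noteq> 0 \<or> t \<noteq> 0"
proof -
  have mem: "quad_point s t p q w \<in> quadric"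
    by (rule quad_point_in_quadric[OF assms])
  show ?thesis
  proof (cases "s = 0 \<and> t = 0")
    case True
    then have "vec.dim (tangent_space quadric (quad_point s t p q w)) = 6"
      using tangent_space_vertex[of p q w] assms by (simp add: card_cart_basis)
    then show ?thesis
      using True by (simp add: smooth_locus_def proj_dim_quadric)
  next
    case False
    then have "vec.dim (tangent_space quadric (quad_point s t p q w)) = 5"
      using tangent_space_quadric[of s t p q w] dim_hyperplane[of "conic_pt s t"] by (simp add: conic_pt_eq_0)
    then show ?thesis
      using False mem by (simp add: smooth_locus_def proj_dim_quadric)
  qed
qed

end

section \<open>Irreducibility\<close>

lemma const_dvd_one: "c \<noteq> 0 \<Longrightarrow> Poly_Mapping.single 0 (c :: 'a::field) dvd (1 :: ('a, 'n) mpoly)"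
  by (rule dvdI[of _ _ "Poly_Mapping.single 0 (inverse c)"]) (simp add: mult_single)

lemma polyfun_grad: "polyfun (\<lambda>x. dot (grad a x) v)"
  unfolding dot_def grad_def vec_lambda_beta by (intro polyfun_sum polyfun_mult polyfun_peval polyfun_const)

text \<open>A product of degree at most one in \<open>e\<close> cannot have two factors that both
  vary along the same line. Irreducibility of affine space then makes one and the same factor
  constant along all parallel lines.\<close>

lemma factor_constant_along:
  fixes a b :: "('a::field_char_0, 'n::finite) mpoly"
  assumes lin: "\<And>x e. peval (a * b) (x + e *s v) = peval (a * b) x + e * l x"
    and l: "polyfun l" "l z \<noteq> 0"
  shows "(\<forall>x e. peval a (x + e *s v) = peval a x) \<or> (\<forall>x e. peval b (x + e *s v) = peval b x)"
proof -
  define p where "p g x = mev (\<lambda>c. [:c:]) (line x v) g" for g :: "('a, 'n) mpoly" and x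
  have p: "poly (p g x) e = peval g (x + e *s v)" for g x e
    by (simp add: p_def poly_mev cpt_line[symmetric] cpt_def)
  have p': "poly (pderiv (p g x)) e = dot (grad g (x + e *s v)) v" for g x e
    by (simp add: p_def poly_pderiv_mev cpt_line dot_def)
  have prod: "l x = 0 \<or> dot (grad a x) v * dot (grad b x) v = 0" for x
  proof (rule disjCI)
    assume "dot (grad a x) v * dot (grad b x) v \<noteq> 0"
    then have "poly (pderiv (p a x)) 0 \<noteq> 0" "poly (pderiv (p b x)) 0 \<noteq> 0"
      by (simp_all add: p')
    then have "degree (p a x) \<noteq> 0" "degree (p b x) \<noteq> 0"
      using pderiv_eq_0_iff[of "p a x"] pderiv_eq_0_iff[of "p b x"] by auto
    then have "degree (p a x * p b x) \<ge> 2"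
      by (subst degree_mult_eq) auto
    moreover have "p a x * p b x - [:peval (a * b) x, l x:] = 0"
      by (rule poly_eq_zero_if_cofinite[of "{}"]) (use lin[of x] in \<open>simp_all add: p\<close>)
    then have "p a x * p b x = [:peval (a * b) x, l x:]"
      by simp
    ultimately show "l x = 0"
      by (cases "l x = 0") simp_all
  qed
  have zero: "dot (grad a x) v = 0 \<or> dot (grad b x) v = 0" for x
    using polyfun_mult_eq_zero[OF l(1) polyfun_mult[OF polyfun_grad polyfun_grad] prod l(2), of x] by simp
  have "(\<forall>x. dot (grad a x) v = 0) \<or> (\<forall>x. dot (grad b x) v = 0)"
  proof (rule disjCI)
    assume "\<not> (\<forall>x. dot (grad b x) v = 0)"
    then obtain y where y: "dot (grad b y) v \<noteq> 0"
      by blast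
    show "\<forall>x. dot (grad a x) v = 0"
      using polyfun_mult_eq_zero[OF polyfun_grad polyfun_grad _ y, of a v] zero by blast
  qed
  moreover have "peval g (x + e *s v) = peval g x" if "\<forall>x. dot (grad g x) v = 0" for g x e
  proof -
    have "pderiv (p g x) = 0"
      by (rule poly_eq_zero_if_cofinite[of "{}"]) (simp_all add: p' that)
    then obtain c where "p g x = [:c:]"
      using pderiv_eq_0_iff degree_eq_zeroE by metis
    then show ?thesis
      using p[of g x e] p[of g x 0] by simp
  qed
  ultimately show ?thesis
    by blast
qed

text \<open>Zeros are confined to a set of codimension two. On a line inside a nonzero level set of
  \<open>l\<close> or of \<open>m\<close> the polynomial has no root and is constant, and such lines
  connect general points with \<open>q\<close>.\<close>

lemma nonvanishing_off_two_hyperplanes: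
  fixes a :: "('a::{alg_closed_field, field_char_0}, 'n::finite) mpoly"
  assumes pq: "dot l p = 1" "dot m p = 0" "dot l q = 0" "dot m q = 1"
    and nz: "\<And>x. dot l x \<noteq> 0 \<or> dot m x \<noteq> 0 \<Longrightarrow> peval a x \<noteq> 0"
  shows "a dvd 1"
proof -
  have const: "peval a y = peval a x"
    if k: "dot k x = dot k y" "dot k x \<noteq> 0" "k = l \<or> k = m" for k x y
  proof -
    define P where "P = mev (\<lambda>c. [:c:]) (line x (y - x)) a"
    have P: "poly P e = peval a (x + e *s (y - x))" for e
      by (simp add: P_def poly_mev cpt_line[symmetric] cpt_def)
    have "poly P e \<noteq> 0" for e
    proof -
      have "dot k (x + e *s (y - x)) = dot k x"
        using k(1) by (simp add: dot_linear)
      then show ?thesis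
        unfolding P using k nz by metis
    qed
    then have "degree P = 0"
      using alg_closed_imp_poly_has_root[of P] by blast
    then obtain c where "P = [:c:]"
      by (rule degree_eq_zeroE)
    then show ?thesis
      using P[of 0] P[of 1] by simp
  qed
  have aq: "peval a x = peval a q" if x: "dot l x \<noteq> 0" for x
  proof -
    let ?y = "dot l x *s p + q"
    have "peval a ?y = peval a x"
      by (rule const[of l]) (use x in \<open>simp_all add: dot_linear pq\<close>)
    moreover have "peval a q = peval a ?y"
      by (rule const[of m]) (simp_all add: dot_linear pq)
    ultimately show ?thesis
      by simp
  qed
  have "peval a x - peval a q = 0" for x
  proof (rule polyfun_mult_eq_zero[where \<phi> = "dot l" and \<psi> = "\<lambda>x. peval a x - peval a q" and a = p])
    show "polyfun (\<lambda>x. peval a x - peval a q)"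
      by (intro polyfun_diff polyfun_peval polyfun_const)
  qed (use aq pq in \<open>auto intro: polyfun_dot\<close>)
  then have "a = Poly_Mapping.single 0 (peval a q)"
    by (intro peval_eq_imp_eq) simp
  moreover have "peval a q \<noteq> 0"
    by (rule nz) (simp add: pq)
  ultimately show ?thesis
    by (metis const_dvd_one)
qed

text \<open>A factor constant along \<open>v\<close> cannot vanish where \<open>l\<close> is
  nonzero: \<open>g\<close> would be zero along the line, yet it changes. The same holds for
  \<open>w\<close> and \<open>m\<close>. A factor constant in both directions is therefore a unit;
  if each direction has its own factor, both are nonzero at \<open>z\<close>, although
  \<open>g\<close> vanishes there.\<close>

lemma irreducible_two_directions:
  fixes g :: "('a::{alg_closed_field, field_char_0}, 'n::finite) mpoly"
  assumes v: "\<And>x e. peval g (x + e *s v) = peval g x + e * (c * dot l x ^ k)"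
    and w: "\<And>x e. peval g (x + e *s w) = peval g x + e * (d * dot m x ^ k)"
    and pq: "dot l p = 1" "dot m p = 0" "dot l q = 0" "dot m q = 1"
    and z: "peval g z = 0" "dot l z \<noteq> 0" "dot m z \<noteq> 0" and cd: "c \<noteq> 0" "d \<noteq> 0"
  shows "irreducible g"
proof (rule irreducibleI)
  show "g \<noteq> 0"
    using v[of z 1] z cd by auto
  show "\<not> g dvd 1"
    using z(1) by (metis dvd_def mult_zero_left peval_mult peval_one zero_neq_one)
  fix a b assume g: "g = a * b"
  have lm: "polyfun (\<lambda>x. c * dot l x ^ k)" "polyfun (\<lambda>x. d * dot m x ^ k)"
    by (intro polyfun_mult polyfun_const polyfun_power polyfun_dot)+
  have nz: "c * dot l z ^ k \<noteq> 0" "d * dot m z ^ k \<noteq> 0"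
    using z cd by auto
  have 1: "(\<forall>x e. peval a (x + e *s v) = peval a x) \<or> (\<forall>x e. peval b (x + e *s v) = peval b x)"
    using factor_constant_along[OF v[unfolded g] lm(1) nz(1)] .
  have 2: "(\<forall>x e. peval a (x + e *s w) = peval a x) \<or> (\<forall>x e. peval b (x + e *s w) = peval b x)"
    using factor_constant_along[OF w[unfolded g] lm(2) nz(2)] .
  have nv: "peval a x \<noteq> 0"
    if "\<forall>x e. peval a (x + e *s v) = peval a x" "dot l x \<noteq> 0" "g = a * b" for a b x
  proof
    assume "peval a x = 0"
    then have "c * dot l x ^ k = 0"
      using v[of x 1] spec[OF spec[OF that(1), of x], of 1] that(3) by simp
    then show False
      using that(2) cd by simp
  qed
  have nw: "peval a x \<noteq> 0"
    if "\<forall>x e. peval a (x + e *s w) = peval a x" "dot m x \<noteq> 0" "g = a * b" for a b x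
  proof
    assume "peval a x = 0"
    then have "d * dot m x ^ k = 0"
      using w[of x 1] spec[OF spec[OF that(1), of x], of 1] that(3) by simp
    then show False
      using that(2) cd by simp
  qed
  have unit: "a dvd 1"
    if "\<forall>x e. peval a (x + e *s v) = peval a x" "\<forall>x e. peval a (x + e *s w) = peval a x" "g = a * b" for a b
    by (rule nonvanishing_off_two_hyperplanes[OF pq]) (use nv nw that in blast)
  have mixed: False
    if "\<forall>x e. peval a (x + e *s v) = peval a x" "\<forall>x e. peval b (x + e *s w) = peval b x"
      "g = a * b" "g = b * a" for a b
  proof -
    have "peval a z \<noteq> 0" "peval b z \<noteq> 0"
      using nv[OF that(1) z(2) that(3)] nw[OF that(2) z(3) that(4)] by blast+
    then show False
      using z(1) that(3) by simp
  qed
  have g': "g = b * a"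
    by (simp add: g mult.commute)
  from 1 2 show "a dvd 1 \<or> b dvd 1"
    using unit[OF _ _ g] unit[OF _ _ g'] mixed[OF _ _ g g'] mixed[OF _ _ g' g] by blast
qed

lemma dot_3: "dot x y = x $ 0 * y $ 0 + x $ 1 * y $ 1 + x $ 2 * y $ 2" for x y :: "'a::comm_ring_1 ^ 3"
  by (simp add: dot_def sum_3')

lemma irreducible_conic:
  "irreducible (Var 1 ^ 2 - Var 0 * Var 2 :: ('a::{alg_closed_field, field_char_0}, 3) mpoly)"
  by (rule irreducible_two_directions[where v = "vec3 1 0 0" and w = "vec3 0 0 1" and l = "vec3 0 0 1"
        and m = "vec3 1 0 0" and c = "-1" and d = "-1" and k = 1 and p = "vec3 0 0 1" and q = "vec3 1 0 0"
        and z = "vec3 1 1 1"])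
    (simp_all add: dot_3 algebra_simps)

lemma is_conic_set:
  fixes M :: "'a::{alg_closed_field, field_char_0} ^ 3 ^ 'n"
  assumes LM: "L ** M = mat 1"
  shows "is_conic (conic_set M)"
  unfolding is_conic_def
proof (intro exI conjI)
  let ?q = "Var 1 ^ 2 - Var 0 * Var 2 :: ('a, 3) mpoly"
  have LM': "L *v (M *v y) = y" for y
    by (simp add: matrix_vector_mul_assoc LM)
  have eq: "t v* transpose M = M *v t" for t
    using transpose_matrix_vector[of "transpose M" t] by simp
  show "inj (\<lambda>t. t v* transpose M)"
    unfolding eq by (rule injI) (metis LM')
  have "formfun 2 (peval ?q)"
    unfolding peval_diff peval_mult peval_power peval_Var
    by (intro formfun_diff formfun_power[OF formfun_nth] formfun_mult[OF formfun_nth formfun_nth]) simp_all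
  then obtain q' where "form 2 q'" "\<And>x. peval q' x = peval ?q x"
    by (auto simp: formfun_def)
  then show "form 2 ?q"
    using peval_eq_imp_eq[of q' ?q] by simp
  show "irreducible ?q"
    by (rule irreducible_conic)
  have "t \<in> hypersurface ?q \<longleftrightarrow> t \<noteq> 0 \<and> (\<exists>a b. t = conic_point a b)" for t
    by (simp add: hypersurface_def conic_point_iff)
  moreover have "M *v t \<noteq> 0 \<longleftrightarrow> t \<noteq> 0" for t
    by (metis LM' matrix_vector_mult_0_right)
  ultimately show "conic_set M = (\<lambda>t. t v* transpose M) ` hypersurface ?q"
    unfolding eq conic_set_def by (auto simp: image_iff) blast+
qed

section \<open>The dual variety and the Perazzo map\<close>

context cubic_normal_form
begin

definition J3 :: "'a ^ 3 ^ 6" where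
  "J3 = (\<chi> i j. if (i = 0 \<and> j = 0) \<or> (i = 1 \<and> j = 1) \<or> (i = 2 \<and> j = 2) then 1 else 0)"

definition J6 :: "'a ^ 6 ^ 3" where
  "J6 = (\<chi> i j. if (i = 0 \<and> j = 0) \<or> (i = 1 \<and> j = 1) \<or> (i = 2 \<and> j = 2) then 1 else 0)"

lemma J3_vec: "J3 *v x = vec6 (x $ 0) (x $ 1) (x $ 2) 0 0 0"
  by (simp add: vec6_eq_iff J3_def matrix_vector_mult_def sum_3')

lemma J6_vec: "J6 *v y = vec3 (y $ 0) (y $ 1) (y $ 2)"
  by (simp add: vec3_eq_iff J6_def matrix_vector_mult_def sum_6)

definition conic_mat :: "'a ^ 3 ^ 6" where "conic_mat = A ** J3"

definition conic_inv :: "'a ^ 6 ^ 3" where "conic_inv = J6 ** B"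

lemma conic_mat_vec: "conic_mat *v x = A *v vec6 (x $ 0) (x $ 1) (x $ 2) 0 0 0"
  by (simp add: conic_mat_def matrix_vector_mul_assoc[symmetric] J3_vec)

lemma conic_inv_vec: "conic_inv *v y = vec3 ((B *v y) $ 0) ((B *v y) $ 1) ((B *v y) $ 2)"
  by (simp add: conic_inv_def matrix_vector_mul_assoc[symmetric] J6_vec)

lemma conic_inv_mat: "conic_inv ** conic_mat = mat 1"
proof -
  have "(conic_inv ** conic_mat) *v x = x" for x
    by (simp add: matrix_vector_mul_assoc[symmetric] conic_mat_vec conic_inv_vec vec3_eq_iff)
  then show ?thesis
    by (simp add: matrix_eq)
qed

lemma conic_pt_conv: "conic_pt s t = conic_mat *v conic_point s t"
  by (simp add: conic_pt_def conic_mat_vec conic_point_def)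

lemma conic_set_conv: "x \<in> conic_set conic_mat \<longleftrightarrow> x \<noteq> 0 \<and> (\<exists>s t. x = conic_pt s t)"
  by (simp add: conic_set_def conic_pt_conv)

lemma conic_pt_scale: "conic_pt (k * s) (k * t) = k ^ 2 *s conic_pt s t"
proof -
  have "vec6 ((k * t) ^ 2) (- (k * s * (k * t))) ((k * s) ^ 2) 0 0 0 = k ^ 2 *s vec6 (t ^ 2) (- (s * t)) (s ^ 2) 0 0 0"
    by (simp add: vec6_eq_iff power2_eq_square)
  then show ?thesis
    by (simp add: conic_pt_def vector_scalar_commute)
qed

lemma scaled_conic_pt: "\<exists>s' t'. k *s conic_pt s t = conic_pt s' t'"
proof -
  obtain c where "c ^ 2 = k"
    using nth_root_exists[of 2 k] by auto
  then show ?thesis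
    using conic_pt_scale[of c s t] by metis
qed

lemma dual_space_quad_point:
  assumes "s \<noteq> 0 \<or> t \<noteq> 0"
  shows "dual_space (tangent_space quadric (quad_point s t p q w)) = vec.span {conic_pt s t}"
  unfolding tangent_space_quadric[OF assms]
  by (rule dual_space_hyperplane) (use assms in \<open>auto simp: conic_pt_eq_0\<close>)

lemma smooth_quadricE:
  assumes "z \<in> smooth_locus quadric"
  obtains s t p q w where "z = quad_point s t p q w" "s \<noteq> 0 \<or> t \<noteq> 0"
proof -
  have "z \<in> quadric"
    using assms by (simp add: smooth_locus_def)
  then obtain s t p q w where z: "z \<noteq> 0" "z = quad_point s t p q w"
    unfolding quadric_iff by (elim exE conjE)
  then have "s \<noteq> 0 \<or> t \<noteq> 0"
    using smooth_locus_quadric[of s t p q w] assms by simp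
  then show ?thesis
    using that z(2) by blast
qed

text \<open>At each smooth point the tangent hyperplane is dual to one conic point, and every conic
  point occurs. Their union is already closed, as the conic is.\<close>

lemma dual_variety_eq: "dual_variety (polar_image f) = conic_set conic_mat"
proof -
  have "(\<Union>z\<in>smooth_locus quadric. dual_space (tangent_space quadric z) - {0}) = conic_set conic_mat"
  proof (rule set_eqI)
    fix x
    show "x \<in> (\<Union>z\<in>smooth_locus quadric. dual_space (tangent_space quadric z) - {0}) \<longleftrightarrow> x \<in> conic_set conic_mat"
    proof
      assume "x \<in> (\<Union>z\<in>smooth_locus quadric. dual_space (tangent_space quadric z) - {0})"
      then obtain z where z: "z \<in> smooth_locus quadric" "x \<in> dual_space (tangent_space quadric z)" "x \<noteq> 0"
        by blast
      obtain s t p q w where st: "z = quad_point s t p q w" "s \<noteq> 0 \<or> t \<noteq> 0"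
        by (rule smooth_quadricE[OF z(1)])
      obtain k where "x = k *s conic_pt s t"
        using z(2) unfolding st(1) dual_space_quad_point[OF st(2)] by (auto simp: vec.span_singleton)
      then show "x \<in> conic_set conic_mat"
        using scaled_conic_pt[of k s t] z(3) by (auto simp: conic_set_conv)
    next
      assume "x \<in> conic_set conic_mat"
      then obtain s t where x: "x \<noteq> 0" "x = conic_pt s t"
        by (auto simp: conic_set_conv)
      then have st: "s \<noteq> 0 \<or> t \<noteq> 0"
        by (auto simp: conic_pt_eq_0)
      then have "quad_point s t 0 0 0 \<in> smooth_locus quadric"
        by (subst smooth_locus_quadric) (auto simp: quad_point_eq_0)
      moreover have "x \<in> dual_space (tangent_space quadric (quad_point s t 0 0 0))"
        unfolding dual_space_quad_point[OF st] x(2) by (rule vec.span_base) simp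
      ultimately show "x \<in> (\<Union>z\<in>smooth_locus quadric. dual_space (tangent_space quadric z) - {0})"
        using x(1) by blast
    qed
  qed
  then show ?thesis
    unfolding dual_variety_def polar_image_eq
    using zariski_closure_id[OF zariski_closed_conic[OF conic_inv_mat]] by simp
qed

section \<open>The Perazzo map and its rank\<close>

lemma perazzo_domain_iff: "p \<in> perazzo_domain f \<longleftrightarrow> (B *v p) $ 4 \<noteq> 0 \<or> (B *v p) $ 5 \<noteq> 0"
proof
  assume "p \<in> perazzo_domain f"
  then have smooth: "grad f p \<in> smooth_locus quadric"
    by (simp add: perazzo_domain_def polar_image_eq)
  then have "grad f p \<noteq> 0"
    using zariski_closed_0[OF quadric_closed] by (auto simp: smooth_locus_def)
  then show "(B *v p) $ 4 \<noteq> 0 \<or> (B *v p) $ 5 \<noteq> 0"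
    using smooth unfolding grad_f_quad_point by (simp add: smooth_locus_quadric)
next
  assume nz: "(B *v p) $ 4 \<noteq> 0 \<or> (B *v p) $ 5 \<noteq> 0"
  then have "grad f p \<in> smooth_locus quadric"
    unfolding grad_f_quad_point by (subst smooth_locus_quadric) (auto simp: quad_point_eq_0)
  moreover have "p \<noteq> 0"
    using nz by auto
  ultimately show "p \<in> perazzo_domain f"
    by (simp add: perazzo_domain_def polar_image_eq)
qed

lemma perazzo_map_eq:
  assumes "p \<in> perazzo_domain f"
  shows "perazzo_map f p = vec.span {conic_pt ((B *v p) $ 4) ((B *v p) $ 5)}"
  unfolding perazzo_map_def polar_image_eq grad_f_quad_point
  by (rule dual_space_quad_point) (use assms perazzo_domain_iff in simp)

text \<open>The Pluecker embedding for one-dimensional subspaces: coordinates sit at the singletons,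
  and the other index sets are padding.\<close>

definition E1 :: "'a ^ 6 ^ (6 set)" where "E1 = (\<chi> S i. if S = {i} then 1 else 0)"

definition E1' :: "'a ^ (6 set) ^ 6" where "E1' = (\<chi> i S. if S = {i} then 1 else 0)"

lemma E1_inverse [simp]: "E1' *v (E1 *v x) = x"
proof -
  have "(E1' *v X) $ i = X $ {i}" for X i
    by (simp add: E1'_def matrix_vector_mult_def if_distrib[of "\<lambda>c. c * _"] cong: if_cong)
  moreover have "(E1 *v x) $ {i} = x $ i" for i
    by (simp add: E1_def matrix_vector_mult_def if_distrib[of "\<lambda>c. c * _"] cong: if_cong)
  ultimately show ?thesis
    by (simp add: vec_eq_iff)
qed

lemma pluecker_vector_single: "pluecker_vector [b] = E1 *v b"
proof (rule vec_eq_iff[THEN iffD2], rule allI)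
  fix S :: "6 set"
  have perm: "{\<pi>. \<pi> permutes {..<Suc 0}} = {id}"
    by (auto simp: lessThan_Suc permutes_sing)
  show "pluecker_vector [b] $ S = (E1 *v b) $ S"
  proof (cases "card S = 1")
    case True
    then obtain i where "S = {i}"
      by (rule card_1_singletonE)
    then show ?thesis
      by (simp add: pluecker_vector_def perm E1_def matrix_vector_mult_def sign_id
          if_distrib[of "\<lambda>c. c * _"] cong: if_cong)
  next
    case False
    then have "S \<noteq> {i}" for i
      by auto
    then show ?thesis
      using False by (simp add: pluecker_vector_def E1_def matrix_vector_mult_def)
  qed
qed

lemma pluecker_line:
  assumes "w \<noteq> 0"
  shows "pluecker (vec.span {w}) = {E1 *v (k *s w) | k. k \<noteq> 0}"
proof (rule set_eqI)
  fix X
  show "X \<in> pluecker (vec.span {w}) \<longleftrightarrow> X \<in> {E1 *v (k *s w) | k. k \<noteq> 0}"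
  proof
    assume "X \<in> pluecker (vec.span {w})"
    then obtain bs where bs: "X = pluecker_vector bs" "distinct bs" "vec.independent (set bs)"
      "vec.span (set bs) = vec.span {w}"
      by (auto simp: pluecker_def)
    have "vec.dim (vec.span (set bs)) = 1"
      using assms by (simp add: bs(4))
    then have "length bs = 1"
      using bs(2,3) by (simp add: vec.dim_eq_card_independent distinct_card)
    then obtain b where b: "bs = [b]"
      by (metis One_nat_def length_0_conv length_Suc_conv)
    have "b \<in> vec.span {w}"
      using bs(4) b vec.span_base[of b "{b}"] by simp
    then obtain k where k: "b = k *s w"
      by (auto simp: vec.span_singleton)
    have "b \<noteq> 0"
      using bs(3) b by simp
    then have "k \<noteq> 0"
      using k by auto
    then show "X \<in> {E1 *v (k *s w) | k. k \<noteq> 0}"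
      using bs(1) b k pluecker_vector_single by blast
  next
    assume "X \<in> {E1 *v (k *s w) | k. k \<noteq> 0}"
    then obtain k where k: "X = E1 *v (k *s w)" "k \<noteq> 0"
      by blast
    have sp: "vec.span {k *s w} = vec.span {w}"
    proof
      show "vec.span {k *s w} \<subseteq> vec.span {w}"
        by (rule vec.span_minimal) (auto intro: vec.span_scale vec.span_base vec.subspace_span)
      have "w = inverse k *s (k *s w)"
        using k(2) by (simp add: vector_smult_assoc)
      then have "w \<in> vec.span {k *s w}"
        by (metis singletonI vec.span_base vec.span_scale)
      then show "vec.span {w} \<subseteq> vec.span {k *s w}"
        by (intro vec.span_minimal) (auto intro: vec.subspace_span)
    qed
    have "X = pluecker_vector [k *s w]"
      by (simp add: k(1) pluecker_vector_single)
    moreover have "distinct [k *s w]" "vec.independent (set [k *s w])"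
      using k(2) assms by simp_all
    ultimately show "X \<in> pluecker (vec.span {w})"
      unfolding pluecker_def using sp by (intro CollectI exI[of _ "[k *s w]"]) simp
  qed
qed

text \<open>The polar image is a hypersurface, so the values of the Perazzo map are points and its
  image is the conic again, moved into Pluecker coordinates by \<open>E1\<close>.\<close>

lemma perazzo_rank_eq: "perazzo_rank f = 1"
proof -
  let ?M = "E1 ** conic_mat" and ?L = "conic_inv ** E1'"
  have inv: "conic_inv *v (conic_mat *v x) = x" for x
    by (simp add: matrix_vector_mul_assoc conic_inv_mat)
  have "(?L ** ?M) *v x = x" for x
    by (simp add: matrix_vector_mul_assoc[symmetric] inv)
  then have LM: "?L ** ?M = mat 1"
    by (simp add: matrix_eq)
  have M: "?M *v conic_point s t = E1 *v conic_pt s t" for s t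
    by (simp add: conic_pt_conv matrix_vector_mul_assoc)
  have E0: "E1 *v x = 0 \<longleftrightarrow> x = 0" for x
    by (metis E1_inverse matrix_vector_mult_0_right)
  have "(\<Union>p\<in>perazzo_domain f. pluecker (perazzo_map f p)) = conic_set ?M"
  proof (rule set_eqI)
    fix X
    show "X \<in> (\<Union>p\<in>perazzo_domain f. pluecker (perazzo_map f p)) \<longleftrightarrow> X \<in> conic_set ?M"
    proof
      assume "X \<in> (\<Union>p\<in>perazzo_domain f. pluecker (perazzo_map f p))"
      then obtain p where p: "p \<in> perazzo_domain f" "X \<in> pluecker (perazzo_map f p)"
        by blast
      let ?s = "(B *v p) $ 4" and ?t = "(B *v p) $ 5"
      have nz: "conic_pt ?s ?t \<noteq> 0"
        using p(1) by (auto simp: perazzo_domain_iff conic_pt_eq_0)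
      obtain k where k: "X = E1 *v (k *s conic_pt ?s ?t)" "k \<noteq> 0"
        using p(2) unfolding perazzo_map_eq[OF p(1)] pluecker_line[OF nz] by blast
      moreover obtain s t where "k *s conic_pt ?s ?t = conic_pt s t"
        using scaled_conic_pt by blast
      ultimately show "X \<in> conic_set ?M"
        using nz by (auto simp: conic_set_def M E0)
    next
      assume "X \<in> conic_set ?M"
      then obtain s t where X: "X \<noteq> 0" "X = E1 *v conic_pt s t"
        by (auto simp: conic_set_def M)
      then have nz: "conic_pt s t \<noteq> 0"
        by auto
      define p where "p = A *v vec6 0 0 0 0 s t"
      have p: "p \<in> perazzo_domain f"
        using nz by (auto simp: perazzo_domain_iff p_def conic_pt_eq_0)
      have "X \<in> {E1 *v (k *s conic_pt s t) | k. k \<noteq> 0}"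
        using X(2) by (intro CollectI exI[of _ 1]) simp
      then have "X \<in> pluecker (vec.span {conic_pt s t})"
        unfolding pluecker_line[OF nz] .
      then have "X \<in> pluecker (perazzo_map f p)"
        using perazzo_map_eq[OF p] by (simp add: p_def)
      then show "X \<in> (\<Union>p\<in>perazzo_domain f. pluecker (perazzo_map f p))"
        using p by blast
    qed
  qed
  then show ?thesis
    unfolding perazzo_rank_def
    using proj_dim_conic[OF LM] zariski_closure_id[OF zariski_closed_conic[OF LM]] by simp
qed

lemma irreducible_f: "irreducible f"
proof -
  have Bl: "(B *v x) $ i = dot (transpose B *v axis i 1) x" for x i
    using dot_Bt[of "axis i 1" x] by (simp add: Bt_def dot_axis)
  \<comment> \<open>A zero of the cubic with x4 = x5 = 1, found by solving for x0.\<close>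
  define z where "z = vec6 (- cubic_tail r 0 1 1) 0 0 0 1 1"
  have shift: "peval f (x + e *s (A *v v)) = normal_cubic r (B *v x + e *s v)" for x e v
    by (simp add: f_eq matrix_vector_right_distrib vector_scalar_commute)
  show ?thesis
  proof (rule irreducible_two_directions[where v = "A *v axis 0 1" and w = "A *v axis 2 1" and c = 1 and d = 1
        and k = 2 and l = "transpose B *v axis 4 1" and m = "transpose B *v axis 5 1"
        and p = "A *v axis 4 1" and q = "A *v axis 5 1" and z = "A *v z"])
    show "peval f (x + e *s (A *v axis 0 1)) = peval f x + e * (1 * dot (transpose B *v axis 4 1) x ^ 2)" for x e
      unfolding Bl[symmetric] shift f_eq[of x]
      by (simp add: normal_cubic_def axis_def algebra_simps)
    show "peval f (x + e *s (A *v axis 2 1)) = peval f x + e * (1 * dot (transpose B *v axis 5 1) x ^ 2)" for x e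
      unfolding Bl[symmetric] shift f_eq[of x]
      by (simp add: normal_cubic_def axis_def algebra_simps)
    show "peval f (A *v z) = 0"
      by (simp add: f_A normal_cubic_def z_def)
  qed (unfold Bl[symmetric] BA_vec, simp_all add: axis_def z_def)
qed

lemma special_perazzo: "special_perazzo_cubic f"
proof -
  \<comment> \<open>The linear space common to the closures of the general fibers, of projective
    dimension 5 - 1 - 1 = 3.\<close>
  define L where "L = {x. (B *v x) $ 4 = 0 \<and> (B *v x) $ 5 = 0}"
  have sub: "vec.subspace L"
    by (auto simp: L_def vec.subspace_def matrix_vector_right_distrib vector_scalar_commute)
  have dim: "vec.dim L = 4"
  proof -
    let ?S = "{y::'a^6. \<forall>i. i \<notin> {0, 1, 2, 3} \<longrightarrow> y $ i = 0}"
    have S: "y \<in> ?S \<longleftrightarrow> y $ 4 = 0 \<and> y $ 5 = 0" for y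
      unfolding mem_Collect_eq all_6 by simp
    have LS: "L = (*v) A ` ?S"
    proof (rule set_eqI)
      fix x
      show "x \<in> L \<longleftrightarrow> x \<in> (*v) A ` ?S"
      proof
        assume "x \<in> L"
        then have "B *v x \<in> ?S"
          unfolding S by (simp add: L_def)
        then have "A *v (B *v x) \<in> (*v) A ` ?S"
          by (rule imageI)
        then show "x \<in> (*v) A ` ?S"
          unfolding AB_vec .
      next
        assume "x \<in> (*v) A ` ?S"
        then show "x \<in> L"
        proof (rule imageE)
          fix y assume "x = A *v y" "y \<in> ?S"
          then show "x \<in> L"
            unfolding S by (simp add: L_def)
        qed
      qed
    qed
    have subS: "vec.subspace ?S"
      by (auto simp: vec.subspace_def)
    have "{x\<in>?S. A *v x = 0} \<subseteq> {0}"
      by auto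
    then have ker: "vec.dim {x\<in>?S. A *v x = 0} = 0"
      unfolding vec.dim_eq_0 .
    have dimS: "vec.dim ?S = 4"
      by (subst dim_substandard_cart) simp
    show ?thesis
      using vec_rank_nullity[OF subS, of A] unfolding LS[symmetric] ker dimS by simp
  qed
  have gen: "generically (UNIV - {0}) (\<lambda>p. p \<in> perazzo_domain f \<and> L - {0} \<subseteq> zariski_closure (perazzo_fiber f p))"
    unfolding generically_def
  proof (intro exI conjI ballI)
    let ?H = "{x. x \<noteq> 0 \<and> (B *v x) $ 4 = 0}"
    show "zariski_closed ?H"
      by (rule zariski_closed_form[OF formfun_matrix])
    show "UNIV - {0} \<subseteq> zariski_closure (UNIV - {0} - ?H)"
    proof
      fix x :: "'a ^ 6" assume x: "x \<in> UNIV - {0}"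
      show "x \<in> zariski_closure (UNIV - {0} - ?H)"
        unfolding zariski_closure_iff
      proof (intro conjI allI impI)
        fix d and h :: "'a ^ 6 \<Rightarrow> 'a"
        assume h: "formfun d h" "\<forall>y\<in>UNIV - {0} - ?H - {0}. h y = 0"
        show "h x = 0"
        proof (rule polyfun_mult_eq_zero[where \<phi> = "\<lambda>x. (B *v x) $ 4" and a = "A *v axis 4 1"])
          show "polyfun h"
            by (rule formfun_imp_polyfun[OF h(1)])
          show "(B *v y) $ 4 = 0 \<or> h y = 0" for y
          proof (rule disjCI)
            assume "h y \<noteq> 0"
            then have "y \<notin> UNIV - {0} - ?H - {0}"
              using h(2) by blast
            then show "(B *v y) $ 4 = 0"
              by (cases "y = 0") simp_all
          qed
        qed (simp_all add: polyfun_matrix axis_def)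
      qed (use x in simp)
    qed
    fix p assume "p \<in> UNIV - {0} - ?H"
    then have p4: "(B *v p) $ 4 \<noteq> 0"
      by auto
    then show p: "p \<in> perazzo_domain f"
      by (simp add: perazzo_domain_iff)
    let ?s = "(B *v p) $ 4" and ?t = "(B *v p) $ 5"
    have fiber: "A *v y \<in> perazzo_fiber f p" if y: "y $ 4 = e * ?s" "y $ 5 = e * ?t" "e \<noteq> 0" for y e
    proof -
      have dom: "A *v y \<in> perazzo_domain f"
        using y p4 by (simp add: perazzo_domain_iff)
      have "vec.span {e ^ 2 *s conic_pt ?s ?t} = vec.span {conic_pt ?s ?t}"
        using vec.span_image_scale[of "{conic_pt ?s ?t}" "\<lambda>_. e ^ 2"] y(3) by simp
      moreover have "perazzo_map f (A *v y) = vec.span {conic_pt (e * ?s) (e * ?t)}"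
        using perazzo_map_eq[OF dom] by (simp only: BA_vec y(1,2))
      ultimately have "perazzo_map f (A *v y) = perazzo_map f p"
        unfolding perazzo_map_eq[OF p] conic_pt_scale by (simp only:)
      then show ?thesis
        unfolding perazzo_fiber_def using dom by blast
    qed
    show "L - {0} \<subseteq> zariski_closure (perazzo_fiber f p)"
    proof
      fix x assume x: "x \<in> L - {0}"
      \<comment> \<open>Moving off \<open>x\<close> in this direction enters the fiber at once,
        since proportional pairs (x4, x5) give the same conic point.\<close>
      let ?q = "line x (A *v vec6 0 0 0 0 ?s ?t)"
      have "cpt ?q 0 \<in> zariski_closure (perazzo_fiber f p)"
      proof (rule zariski_closure_curve)
        show "cpt ?q 0 \<noteq> 0"
          using x by (simp add: cpt_line)
        fix e :: 'a assume e: "e \<noteq> 0"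
        have "cpt ?q e = A *v (B *v x + e *s vec6 0 0 0 0 ?s ?t)"
          by (simp add: cpt_line matrix_vector_right_distrib vector_scalar_commute)
        moreover have "A *v (B *v x + e *s vec6 0 0 0 0 ?s ?t) \<in> perazzo_fiber f p"
          by (rule fiber[of _ e]) (use x e in \<open>simp_all add: L_def\<close>)
        ultimately show "cpt ?q e \<in> perazzo_fiber f p"
          by simp
      qed
      then show "x \<in> zariski_closure (perazzo_fiber f p)"
        by (simp add: cpt_line)
    qed
  qed
  have card: "vec.dim L + perazzo_rank f + 1 = CARD(6)"
    by (simp add: dim perazzo_rank_eq)
  show ?thesis
    unfolding special_perazzo_cubic_def
    by (intro conjI exI[of _ L] form_f irreducible_f hess_f not_cone sub card gen)
qed

end

section \<open>Pluecker coordinates of planes\<close>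

text \<open>The 3 by 3 minor, with its terms in the order in which the sum over permutations
  unfolds.\<close>

definition det3 :: "'a::comm_ring_1 ^ 'n \<Rightarrow> 'a ^ 'n \<Rightarrow> 'a ^ 'n \<Rightarrow> 'n \<Rightarrow> 'n \<Rightarrow> 'n \<Rightarrow> 'a" where
  "det3 u v w i j k = u $ i * v $ j * w $ k - u $ i * w $ j * v $ k - v $ i * u $ j * w $ k +
    w $ i * u $ j * v $ k + v $ i * w $ j * u $ k - w $ i * v $ j * u $ k"

lemma det3_linear:
  "det3 (u + u') v w i j k = det3 u v w i j k + det3 u' v w i j k"
  "det3 u (v + v') w i j k = det3 u v w i j k + det3 u v' w i j k"
  "det3 u v (w + w') i j k = det3 u v w i j k + det3 u v w' i j k"
  "det3 (c *s u) v w i j k = c * det3 u v w i j k"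
  "det3 u (c *s v) w i j k = c * det3 u v w i j k"
  "det3 u v (c *s w) i j k = c * det3 u v w i j k"
  by (simp_all add: det3_def algebra_simps)

lemma det3_equal [simp]: "det3 u u w i j k = 0" "det3 u v u i j k = 0" "det3 u v v i j k = 0"
  by (simp_all add: det3_def algebra_simps)

lemma sum_permutations_3:
  fixes x y z :: "nat \<Rightarrow> 'a::comm_ring_1"
  shows "(\<Sum>\<pi> | \<pi> permutes {0, 1, 2}. of_int (sign \<pi>) * (x (\<pi> 0) * (y (\<pi> 1) * z (\<pi> 2)))) =
    x 0 * y 1 * z 2 - x 0 * z 1 * y 2 - y 0 * x 1 * z 2 + z 0 * x 1 * y 2 + y 0 * z 1 * x 2 - z 0 * y 1 * x 2"
proof -
  have f: "finite {1, 2 :: nat}" "0 \<notin> {1, 2 :: nat}" "finite {2 :: nat}" "1 \<notin> {2 :: nat}"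
    by auto
  show ?thesis
    unfolding sum_over_permutations_insert[OF f(1,2)] sum_over_permutations_insert[OF f(3,4)] permutes_sing
    by (simp add: sign_swap_id permutation_swap_id sign_compose sign_id transpose_def mult_ac)
qed

lemma pluecker_vector_triple:
  "pluecker_vector [u, v, w] $ S = (if card S = 3 then
    det3 u v w (sorted_list_of_set S ! 0) (sorted_list_of_set S ! 1) (sorted_list_of_set S ! 2) else 0)"
proof -
  let ?s = "sorted_list_of_set S"
  have len: "length [u, v, w] = 3"
    by simp
  have set3: "{..<3 :: nat} = {0, 1, 2}"
    by auto
  have prod3: "(\<Prod>i\<in>{0, 1, 2 :: nat}. ([u, v, w] ! i) $ (?s ! \<pi> i)) =
      u $ (?s ! \<pi> 0) * (v $ (?s ! \<pi> 1) * w $ (?s ! \<pi> 2))" for \<pi>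
    by simp
  show ?thesis
    unfolding pluecker_vector_def vec_lambda_beta len set3 prod3 det3_def
    using sum_permutations_3[of "\<lambda>i. u $ (?s ! i)" "\<lambda>i. v $ (?s ! i)" "\<lambda>i. w $ (?s ! i)"]
    by (simp only:)
qed

lemma pluecker_vector_sorted:
  assumes "x < y" "y < z"
  shows "pluecker_vector [u, v, w] $ {x, y, z} = det3 u v w x y z"
proof -
  have "sorted_list_of_set {x, y, z} = [x, y, z]"
  proof -
    have "sorted [x, y, z]" "distinct [x, y, z]"
      using assms by auto
    then have "sorted_list_of_set (set [x, y, z]) = [x, y, z]"
      by (rule sorted_list_of_set.idem_if_sorted_distinct)
    then show ?thesis
      by (simp only: list.set)
  qed
  moreover have "x \<noteq> y" "y \<noteq> z" "x \<noteq> z"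
    using assms by auto
  then have "card {x, y, z} = 3"
    by simp
  ultimately show ?thesis
    by (simp add: pluecker_vector_triple)
qed

text \<open>Pluecker coordinates are indexed by unordered sets. This restores the alternating tensor
  on ordered triples, with the sign of the sorting permutation.\<close>

definition alt_tensor :: "'a::comm_ring_1 ^ ('n::{finite,linorder} set) \<Rightarrow> 'n \<Rightarrow> 'n \<Rightarrow> 'n \<Rightarrow> 'a" where
  "alt_tensor X a b c = (if a < b \<and> b < c then X $ {a, b, c} else if a < c \<and> c < b then - X $ {a, c, b}
    else if b < a \<and> a < c then - X $ {b, a, c} else if b < c \<and> c < a then X $ {b, c, a}
    else if c < a \<and> a < b then X $ {c, a, b} else if c < b \<and> b < a then - X $ {c, b, a} else 0)"

lemma alt_tensor_pluecker: "alt_tensor (pluecker_vector [u, v, w]) a b c = det3 u v w a b c"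
proof -
  consider "a = b" | "b = c" | "a = c" | "a < b" "b < c" | "a < c" "c < b" | "b < a" "a < c" |
    "b < c" "c < a" | "c < a" "a < b" | "c < b" "b < a"
    by (metis linorder_less_linear)
  then show ?thesis
    by cases (auto simp: alt_tensor_def pluecker_vector_sorted det3_def)
qed

text \<open>Contraction with three covectors. It expresses minors with respect to any basis, here
  the one given by \<open>A\<close>, as linear forms in the Pluecker vector.\<close>

definition tri_pair :: "'a::comm_ring_1 ^ 'n::{finite,linorder} \<Rightarrow> 'a ^ 'n::{finite,linorder} \<Rightarrow>
    'a ^ 'n::{finite,linorder} \<Rightarrow> 'a ^ ('n::{finite,linorder} set) \<Rightarrow> 'a" where
  "tri_pair \<alpha> \<beta> \<gamma> X = (\<Sum>a\<in>UNIV. \<Sum>b\<in>UNIV. \<Sum>c\<in>UNIV. \<alpha> $ a * \<beta> $ b * \<gamma> $ c * alt_tensor X a b c)"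

lemma tri_pair_pluecker:
  "tri_pair \<alpha> \<beta> \<gamma> (pluecker_vector [u, v, w]) =
    dot \<alpha> u * dot \<beta> v * dot \<gamma> w - dot \<alpha> u * dot \<beta> w * dot \<gamma> v - dot \<alpha> v * dot \<beta> u * dot \<gamma> w +
    dot \<alpha> w * dot \<beta> u * dot \<gamma> v + dot \<alpha> v * dot \<beta> w * dot \<gamma> u - dot \<alpha> w * dot \<beta> v * dot \<gamma> u"
proof -
  have prod: "(\<Sum>a\<in>UNIV. \<Sum>b\<in>UNIV. \<Sum>c\<in>UNIV. \<alpha> $ a * \<beta> $ b * \<gamma> $ c * (p $ a * q $ b * r $ c)) =
      dot \<alpha> p * dot \<beta> q * dot \<gamma> r" for p q r
  proof -
    have "dot \<alpha> p * dot \<beta> q * dot \<gamma> r = (\<Sum>a\<in>UNIV. (\<alpha> $ a * p $ a) *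
        (\<Sum>b\<in>UNIV. (\<beta> $ b * q $ b) * (\<Sum>c\<in>UNIV. \<gamma> $ c * r $ c)))"
      unfolding dot_def sum_distrib_right[symmetric] by (simp add: mult.assoc)
    then show ?thesis
      by (simp add: sum_distrib_left mult_ac)
  qed
  show ?thesis
    unfolding tri_pair_def alt_tensor_pluecker det3_def right_diff_distrib distrib_left
      sum_subtractf sum.distrib prod ..
qed

lemma formfun_if:
  "(b \<Longrightarrow> formfun d \<phi>) \<Longrightarrow> (\<not> b \<Longrightarrow> formfun d \<psi>) \<Longrightarrow> formfun d (\<lambda>x. if b then \<phi> x else \<psi> x)"
  by (cases b) simp_all

lemma formfun_tri_pair: "formfun 1 (tri_pair \<alpha> \<beta> \<gamma>)"
proof -
  have "formfun 1 (\<lambda>X. alt_tensor X a b c)" for a b c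
    unfolding alt_tensor_def by (intro formfun_if formfun_nth formfun_uminus formfun_zero)
  then show ?thesis
    unfolding tri_pair_def by (intro formfun_sum formfun_cmult)
qed

lemma span_3:
  fixes u v w :: "'a::field ^ 'n"
  assumes "x \<in> vec.span {u, v, w}"
  shows "\<exists>a b c. x = a *s u + b *s v + c *s w"
proof -
  obtain a where "x - a *s u \<in> vec.span {v, w}"
    using assms vec.span_breakdown_eq by blast
  then obtain b where "x - a *s u - b *s v \<in> vec.span {w}"
    using vec.span_breakdown_eq by blast
  then obtain c where "x - a *s u - b *s v = c *s w"
    by (auto simp: vec.span_singleton)
  then have "x = a *s u + b *s v + c *s w"
    by (simp add: algebra_simps)
  then show ?thesis
    by blast
qed

text \<open>\<open>k\<close> is the determinant of the coefficient matrix. It may be zero, since the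
  new vectors are only assumed to lie in the span.\<close>

lemma pluecker_vector_change:
  assumes "u' \<in> vec.span {u, v, w}" "v' \<in> vec.span {u, v, w}" "w' \<in> vec.span {u, v, w}"
  obtains k where "pluecker_vector [u', v', w'] = k *s pluecker_vector [u, v, w]"
proof -

  obtain a1 b1 c1 a2 b2 c2 a3 b3 c3 where
    u': "u' = a1 *s u + b1 *s v + c1 *s w" and v': "v' = a2 *s u + b2 *s v + c2 *s w" and
    w': "w' = a3 *s u + b3 *s v + c3 *s w"
    using span_3[OF assms(1)] span_3[OF assms(2)] span_3[OF assms(3)] by (elim exE)
  have sw: "det3 u w v i j k = - det3 u v w i j k" "det3 v u w i j k = - det3 u v w i j k"
    "det3 v w u i j k = det3 u v w i j k" "det3 w u v i j k = det3 u v w i j k"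
    "det3 w v u i j k = - det3 u v w i j k" for i j k
    by (simp_all add: det3_def)
  have "det3 u' v' w' i j k = (a1 * b2 * c3 - a1 * c2 * b3 - b1 * a2 * c3 + b1 * c2 * a3 + c1 * a2 * b3 -
      c1 * b2 * a3) * det3 u v w i j k" for i j k
    unfolding u' v' w' by (simp add: det3_linear sw algebra_simps)
  then show ?thesis
    using that[of "a1 * b2 * c3 - a1 * c2 * b3 - b1 * a2 * c3 + b1 * c2 * a3 + c1 * a2 * b3 - c1 * b2 * a3"]
    by (simp add: vec_eq_iff pluecker_vector_triple)
qed

lemma pluecker_vector_nonzero_independent:
  assumes "pluecker_vector [u, v, w] \<noteq> 0"
  shows "distinct [u, v, w]" "vec.independent (set [u, v, w])" "vec.dim (vec.span {u, v, w}) = 3"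
proof -
  obtain i j k where d: "det3 u v w i j k \<noteq> 0"
    using assms by (auto simp: vec_eq_iff pluecker_vector_triple split: if_splits)
  have w: "w \<notin> vec.span {}"
    using d by (auto simp: det3_def)
  have v: "v \<notin> vec.span {w}"
    using d by (auto simp: vec.span_singleton det3_linear)
  have u: "u \<notin> vec.span {v, w}"
  proof
    assume "u \<in> vec.span {v, w}"
    then obtain a where "u - a *s v \<in> vec.span {w}"
      using vec.span_breakdown_eq by blast
    then obtain b where "u - a *s v = b *s w"
      by (auto simp: vec.span_singleton)
    then have "u = a *s v + b *s w"
      by (simp add: algebra_simps)
    then show False
      using d by (simp add: det3_linear)
  qed
  show dist: "distinct [u, v, w]"
    using u v vec.span_base[of u "{v, w}"] vec.span_base[of v "{w}"] by auto
  have "vec.independent {w}"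
    using w by simp
  then have "vec.independent {v, w}"
    by (rule vec.independent_insertI[OF v])
  then have "vec.independent {u, v, w}"
    by (rule vec.independent_insertI[OF u])
  then show ind: "vec.independent (set [u, v, w])"
    unfolding list.set .
  have "card (set [u, v, w]) = 3"
    using distinct_card[OF dist] by simp
  then show "vec.dim (vec.span {u, v, w}) = 3"
    using vec.dim_span_eq_card_independent[OF ind] by (simp only: list.set)
qed

lemma pluecker_vector_in_pluecker:
  "pluecker_vector [u, v, w] \<noteq> 0 \<Longrightarrow> pluecker_vector [u, v, w] \<in> pluecker (vec.span {u, v, w})"
  unfolding pluecker_def using pluecker_vector_nonzero_independent[of u v w]
  by (intro CollectI exI[of _ "[u, v, w]"]) simp

lemma pluecker_plane_multiple:
  fixes u v w :: "'a::field ^ 'n::{finite,linorder}"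
  assumes nz: "pluecker_vector [u, v, w] \<noteq> 0" and Y: "Y \<in> pluecker (vec.span {u, v, w})"
  obtains k where "k \<noteq> 0" "Y = k *s pluecker_vector [u, v, w]"
proof -
  obtain bs where bs: "Y = pluecker_vector bs" "distinct bs" "vec.independent (set bs)"
    "vec.span (set bs) = vec.span {u, v, w}"
    using Y by (auto simp: pluecker_def)
  have "card (set bs) = 3"
    using pluecker_vector_nonzero_independent(3)[OF nz] bs(4) vec.dim_span_eq_card_independent[OF bs(3)]
    by simp
  then have "length bs = 3"
    using distinct_card[OF bs(2)] by simp
  then obtain u' v' w' where b: "bs = [u', v', w']"
    by (auto simp: numeral_3_eq_3 length_Suc_conv)
  have sp: "vec.span {u', v', w'} = vec.span {u, v, w}"
    using bs(4) b by simp
  have "u' \<in> vec.span {u', v', w'}" "v' \<in> vec.span {u', v', w'}" "w' \<in> vec.span {u', v', w'}"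
    by (simp_all add: vec.span_base)
  then obtain k where k: "Y = k *s pluecker_vector [u, v, w]"
    unfolding sp bs(1) b by (rule pluecker_vector_change)
  have "u \<in> vec.span {u, v, w}" "v \<in> vec.span {u, v, w}" "w \<in> vec.span {u, v, w}"
    by (simp_all add: vec.span_base)
  then obtain l where l: "pluecker_vector [u, v, w] = l *s Y"
    unfolding sp[symmetric] bs(1) b by (rule pluecker_vector_change)
  have "k \<noteq> 0"
  proof
    assume "k = 0"
    then have "Y = 0"
      using k by simp
    then show False
      using nz l by simp
  qed
  then show ?thesis
    using that k by blast
qed

section \<open>The scroll of planes\<close>

lemma proportional:
  fixes s t p q :: "'a::field"
  assumes "s \<noteq> 0 \<or> t \<noteq> 0" "p * t = q * s"
  shows "\<exists>k. p = k * s \<and> q = k * t"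
proof (cases "s = 0")
  case True
  then show ?thesis
    using assms by (intro exI[of _ "q / t"]) auto
next
  case False
  then have "q = p / s * t"
    using assms(2) by (simp add: field_simps)
  then show ?thesis
    using False by (intro exI[of _ "p / s"]) simp
qed

text \<open>The \<open>2 \<times> 5\<close> matrix with rows \<open>(a\<^sub>0, a\<^sub>1, e\<^sub>0, e\<^sub>1, e\<^sub>2)\<close> and \<open>(a\<^sub>1, a\<^sub>2, e\<^sub>1, e\<^sub>2, e\<^sub>3)\<close>, whose minors cut out a
  rational normal scroll, has rank one only at the points parametrised below.\<close>

lemma scroll_parametrisation:
  fixes a0 a1 a2 e0 e1 e2 e3 :: "'a::field"
  assumes minors: "\<And>p q p' q'. (p, q) \<in> {(a0, a1), (a1, a2), (e0, e1), (e1, e2), (e2, e3)} \<Longrightarrow>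
    (p', q') \<in> {(a0, a1), (a1, a2), (e0, e1), (e1, e2), (e2, e3)} \<Longrightarrow> p * q' - p' * q = 0"
  obtains s t x l where "s \<noteq> 0 \<or> t \<noteq> 0" "a0 = x * s ^ 2" "a1 = x * (s * t)" "a2 = x * t ^ 2"
    "e0 = l * s ^ 3" "e1 = l * (s ^ 2 * t)" "e2 = l * (s * t ^ 2)" "e3 = l * t ^ 3"
proof -
  let ?C = "{(a0, a1), (a1, a2), (e0, e1), (e1, e2), (e2, e3)}"
  show ?thesis
  proof (cases "\<forall>(p, q)\<in>?C. p = 0 \<and> q = 0")
    case True
    then show ?thesis
      using that[of 1 0 0 0] by simp
  next
    case False
    then obtain s t where st: "(s, t) \<in> ?C" "s \<noteq> 0 \<or> t \<noteq> 0"
      by auto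
    have col: "\<exists>k. p = k * s \<and> q = k * t" if "(p, q) \<in> ?C" for p q
      using minors[OF that st(1)] by (intro proportional[OF st(2)]) (simp add: mult.commute)
    have "\<exists>k. a0 = k * s \<and> a1 = k * t" "\<exists>k. a1 = k * s \<and> a2 = k * t"
      by (rule col, simp)+
    then obtain \<alpha> \<beta> where ab: "a0 = \<alpha> * s" "a1 = \<alpha> * t" "a1 = \<beta> * s" "a2 = \<beta> * t"
      by blast
    obtain x where x: "\<alpha> = x * s" "\<beta> = x * t"
      using proportional[OF st(2), of \<alpha> \<beta>] ab by auto
    have "\<exists>k. e0 = k * s \<and> e1 = k * t" "\<exists>k. e1 = k * s \<and> e2 = k * t" "\<exists>k. e2 = k * s \<and> e3 = k * t"
      by (rule col, simp)+
    then obtain g0 g1 g2 where g: "e0 = g0 * s" "e1 = g0 * t" "e1 = g1 * s" "e2 = g1 * t" "e2 = g2 * s" "e3 = g2 * t"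
      by blast
    obtain h0 where h0: "g0 = h0 * s" "g1 = h0 * t"
      using proportional[OF st(2), of g0 g1] g by auto
    obtain h1 where h1: "g1 = h1 * s" "g2 = h1 * t"
      using proportional[OF st(2), of g1 g2] g by auto
    obtain l where l: "h0 = l * s" "h1 = l * t"
      using proportional[OF st(2), of h0 h1] h0 h1 by auto
    show ?thesis
    proof (rule that[OF st(2)])
      show "a0 = x * s ^ 2" "a1 = x * (s * t)" "a2 = x * t ^ 2"
        by (simp_all add: ab(1,2,4) x power2_eq_square)
      show "e0 = l * s ^ 3" "e1 = l * (s ^ 2 * t)" "e2 = l * (s * t ^ 2)" "e3 = l * t ^ 3"
        by (simp_all add: g(1,2,4,6) h0 h1(2) l power2_eq_square power3_eq_cube)
    qed
  qed
qed

context cubic_normal_form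
begin

text \<open>\<open>e_vec\<close> is the derivative of \<open>conic_pt\<close> in \<open>t\<close>
  and \<open>e_vec'\<close> is minus its derivative in \<open>s\<close>; together they span the
  tangent line.\<close>

definition e_vec :: "'a \<Rightarrow> 'a \<Rightarrow> 'a ^ 6" where "e_vec s t = A *v vec6 (2 * t) (- s) 0 0 0 0"

definition e_vec' :: "'a \<Rightarrow> 'a \<Rightarrow> 'a ^ 6" where "e_vec' s t = A *v vec6 0 t (- (2 * s)) 0 0 0"

definition basis_pluecker :: "6 \<Rightarrow> 6 \<Rightarrow> 6 \<Rightarrow> 'a ^ (6 set)" where
  "basis_pluecker i j k = pluecker_vector [A *v axis i 1, A *v axis j 1, A *v axis k 1]"

text \<open>The Pluecker vector of the plane spanned by \<open>A *v q\<close> and the tangent line of the conic with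
  parameter \<open>(s, t)\<close>, in terms of \<open>w = q\<^sub>0 s\<^sup>2 + 2 q\<^sub>1 s t + q\<^sub>2 t\<^sup>2\<close>, the monomials
  \<open>q\<^sub>3 (s\<^sup>2, s t, t\<^sup>2)\<close>, and \<open>l (s\<^sup>3, s\<^sup>2 t, s t\<^sup>2, t\<^sup>3)\<close> for \<open>(q\<^sub>4, q\<^sub>5) = l (s, t)\<close>.\<close>

definition plane_pluecker :: "'a \<Rightarrow> 'a \<Rightarrow> 'a \<Rightarrow> 'a \<Rightarrow> 'a \<Rightarrow> 'a \<Rightarrow> 'a \<Rightarrow> 'a \<Rightarrow> 'a ^ (6 set)" where
  "plane_pluecker w a0 a1 a2 e0 e1 e2 e3 = (2 * w) *s basis_pluecker 0 1 2 +
    ((2 * a2) *s basis_pluecker 3 0 1 + (- 4 * a1) *s basis_pluecker 3 0 2 + (2 * a0) *s basis_pluecker 3 1 2) +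
    ((2 * e2) *s basis_pluecker 4 0 1 + (- 4 * e1) *s basis_pluecker 4 0 2 + (2 * e0) *s basis_pluecker 4 1 2) +
    ((2 * e3) *s basis_pluecker 5 0 1 + (- 4 * e2) *s basis_pluecker 5 0 2 + (2 * e1) *s basis_pluecker 5 1 2)"

lemma A_vec6: "A *v vec6 a b c d e g = a *s (A *v axis 0 1) + b *s (A *v axis 1 1) + c *s (A *v axis 2 1) +
    d *s (A *v axis 3 1) + e *s (A *v axis 4 1) + g *s (A *v axis 5 1)"
proof -
  have "vec6 a b c d e g = a *s axis 0 1 + b *s axis 1 1 + c *s axis 2 1 + d *s axis 3 1 + e *s axis 4 1 +
      g *s axis 5 1"
    by (simp add: vec6_eq_iff axis_def)
  then show ?thesis
    by (simp only: matrix_vector_right_distrib vector_scalar_commute)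
qed

lemma plane_pluecker_eq:
  assumes "q $ 4 = l * s" "q $ 5 = l * t"
  shows "pluecker_vector [A *v q, e_vec s t, e_vec' s t] =
    plane_pluecker (q $ 0 * s ^ 2 + 2 * q $ 1 * s * t + q $ 2 * t ^ 2)
      (q $ 3 * s ^ 2) (q $ 3 * (s * t)) (q $ 3 * t ^ 2)
      (l * s ^ 3) (l * (s ^ 2 * t)) (l * (s * t ^ 2)) (l * t ^ 3)"
proof -
  define a where "a i = A *v axis i 1" for i
  have "q = vec6 (q $ 0) (q $ 1) (q $ 2) (q $ 3) (l * s) (l * t)"
    by (simp add: vec6_eq_iff assms)
  then have "A *v q = A *v vec6 (q $ 0) (q $ 1) (q $ 2) (q $ 3) (l * s) (l * t)"
    by (rule arg_cong)
  then have q: "A *v q = q $ 0 *s a 0 + q $ 1 *s a 1 + q $ 2 *s a 2 + q $ 3 *s a 3 + (l * s) *s a 4 + (l * t) *s a 5"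
    by (simp only: A_vec6 a_def)
  have e: "e_vec s t = (2 * t) *s a 0 + (- s) *s a 1" "e_vec' s t = t *s a 1 + (- (2 * s)) *s a 2"
    by (simp_all add: e_vec_def e_vec'_def A_vec6 a_def)
  have minus: "det3 u (v - v') x i j k = det3 u v x i j k - det3 u v' x i j k"
    "det3 u v (x - x') i j k = det3 u v x i j k - det3 u v x' i j k"
    "det3 u (- v) x i j k = - det3 u v x i j k" "det3 u v (- x) i j k = - det3 u v x i j k"
    for u v v' x x' :: "'a ^ 6" and i j k
    by (simp_all add: det3_def algebra_simps)
  have sw: "det3 (a 1) (a 0) (a 2) i j k = - det3 (a 0) (a 1) (a 2) i j k"
    "det3 (a 2) (a 0) (a 1) i j k = det3 (a 0) (a 1) (a 2) i j k" for i j k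
    by (simp_all add: det3_def)
  show ?thesis
    unfolding vec_eq_iff plane_pluecker_def basis_pluecker_def a_def[symmetric] q e
    by (simp add: pluecker_vector_triple det3_linear minus sw power2_eq_square power3_eq_cube algebra_simps)
qed

section \<open>Linear coordinates on Pluecker vectors of planes\<close>

definition coord :: "6 \<Rightarrow> 6 \<Rightarrow> 6 \<Rightarrow> 'a ^ (6 set) \<Rightarrow> 'a" where
  "coord i j k = tri_pair (transpose B *v axis i 1) (transpose B *v axis j 1) (transpose B *v axis k 1)"

lemma coord_form: "formfun 1 (coord i j k)"
  unfolding coord_def by (rule formfun_tri_pair)

lemma coord_pluecker: "coord i j k (pluecker_vector [A *v u, A *v v, A *v w]) = det3 u v w i j k"
proof -
  have "dot (transpose B *v axis i 1) (A *v x) = x $ i" for i x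
    using dot_Bt[of "axis i 1" "A *v x"] by (simp add: Bt_def dot_axis)
  then show ?thesis
    unfolding coord_def tri_pair_pluecker by (simp add: det3_def)
qed

text \<open>This and the next seven linear forms invert \<open>plane_pluecker\<close>: each reads
  off one argument from one basis coordinate and divides by the coefficient placed there.\<close>

definition cw where "cw X = coord 0 1 2 X / 2"
definition ca0 where "ca0 X = coord 3 1 2 X / 2"
definition ca1 where "ca1 X = coord 3 0 2 X / (- 4)"
definition ca2 where "ca2 X = coord 3 0 1 X / 2"
definition ce0 where "ce0 X = coord 4 1 2 X / 2"
definition ce1 where "ce1 X = coord 4 0 2 X / (- 4)"
definition ce2 where "ce2 X = coord 4 0 1 X / 2"
definition ce3 where "ce3 X = coord 5 0 1 X / 2"

lemma coords_form: "formfun 1 cw" "formfun 1 ca0" "formfun 1 ca1" "formfun 1 ca2"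
  "formfun 1 ce0" "formfun 1 ce1" "formfun 1 ce2" "formfun 1 ce3"
proof -
  have *: "formfun 1 (\<lambda>X. coord i j k X / c)" for i j k c
    unfolding divide_inverse by (subst mult.commute) (rule formfun_cmult[OF coord_form])
  show "formfun 1 cw" "formfun 1 ca0" "formfun 1 ca1" "formfun 1 ca2"
    "formfun 1 ce0" "formfun 1 ce1" "formfun 1 ce2" "formfun 1 ce3"
    unfolding cw_def ca0_def ca1_def ca2_def ce0_def ce1_def ce2_def ce3_def by (rule *)+
qed

lemma coords_pluecker:
  assumes "q $ 4 = l * s" "q $ 5 = l * t" "X = pluecker_vector [A *v q, e_vec s t, e_vec' s t]"
  shows "cw X = q $ 0 * s ^ 2 + 2 * q $ 1 * s * t + q $ 2 * t ^ 2"
    "ca0 X = q $ 3 * s ^ 2" "ca1 X = q $ 3 * (s * t)" "ca2 X = q $ 3 * t ^ 2"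
    "ce0 X = l * s ^ 3" "ce1 X = l * (s ^ 2 * t)" "ce2 X = l * (s * t ^ 2)" "ce3 X = l * t ^ 3"
  unfolding cw_def ca0_def ca1_def ca2_def ce0_def ce1_def ce2_def ce3_def assms(3) e_vec_def e_vec'_def
    coord_pluecker
  by (simp_all add: det3_def assms(1,2) power2_eq_square power3_eq_cube algebra_simps)

text \<open>For (s, t) nonzero this is the plane through a point of the hypersurface with last
  coordinates (u, s, t). The cubic equation prescribes q0 s^2 + 2 q1 s t + q2 t^2, the only way in
  which the other three coordinates enter.\<close>

definition plane_of :: "'a \<Rightarrow> 'a \<Rightarrow> 'a \<Rightarrow> 'a ^ (6 set)" where
  "plane_of u s t = plane_pluecker (- cubic_tail r u s t) (u * s ^ 2) (u * (s * t)) (u * t ^ 2)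
    (1 * s ^ 3) (1 * (s ^ 2 * t)) (1 * (s * t ^ 2)) (1 * t ^ 3)"

definition planes :: "('a ^ (6 set)) set" where
  "planes = {X. X \<noteq> 0 \<and> (\<exists>p :: 'a ^ 3. X = plane_of (p $ 0) (p $ 1) (p $ 2))}"

lemma plane_of_eq:
  assumes "normal_cubic r q = 0"
  shows "plane_of (q $ 3) (q $ 4) (q $ 5) =
    pluecker_vector [A *v q, e_vec (q $ 4) (q $ 5), e_vec' (q $ 4) (q $ 5)]"
proof -
  have "q $ 0 * q $ 4 ^ 2 + 2 * q $ 1 * q $ 4 * q $ 5 + q $ 2 * q $ 5 ^ 2 = - cubic_tail r (q $ 3) (q $ 4) (q $ 5)"
    using assms by (simp add: normal_cubic_def eq_neg_iff_add_eq_0)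
  then show ?thesis
    unfolding plane_of_def using plane_pluecker_eq[of q 1 "q $ 4" "q $ 5"] by simp
qed

lemma plane_of_nonzero:
  assumes "normal_cubic r q = 0" "q $ 4 \<noteq> 0 \<or> q $ 5 \<noteq> 0"
  shows "plane_of (q $ 3) (q $ 4) (q $ 5) \<noteq> 0"
proof
  assume "plane_of (q $ 3) (q $ 4) (q $ 5) = 0"
  then have "0 = pluecker_vector [A *v q, e_vec (q $ 4) (q $ 5), e_vec' (q $ 4) (q $ 5)]"
    using plane_of_eq[OF assms(1)] by simp
  then have "ce0 0 = 1 * q $ 4 ^ 3" "ce3 0 = 1 * q $ 5 ^ 3"
    by (intro coords_pluecker(5,8)[where q = q and l = 1 and s = "q $ 4" and t = "q $ 5"]; simp)+
  moreover have "ce0 0 = 0" "ce3 0 = 0"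
    using formfun_scale[OF coords_form(5), of 0 0] formfun_scale[OF coords_form(8), of 0 0] by simp_all
  ultimately show False
    using assms(2) by auto
qed

lemma plane_of_point:
  assumes "s \<noteq> 0 \<or> t \<noteq> 0"
  obtains q where "normal_cubic r q = 0" "q $ 3 = u" "q $ 4 = s" "q $ 5 = t"
proof (cases "s = 0")
  case True
  let ?q = "vec6 0 0 (- cubic_tail r u s t / t ^ 2) u s t"
  have "normal_cubic r ?q = 0"
    using True assms by (simp add: normal_cubic_def)
  then show ?thesis
    by (rule that) simp_all
next
  case False
  let ?q = "vec6 (- cubic_tail r u s t / s ^ 2) 0 0 u s t"
  have "normal_cubic r ?q = 0"
    using False by (simp add: normal_cubic_def)
  then show ?thesis
    by (rule that) simp_all
qed

end

lemma formfun_multc: "formfun d \<phi> \<Longrightarrow> formfun d (\<lambda>x. \<phi> x * c)"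
  using formfun_mult[OF _ formfun_const, of d \<phi> d c] by simp

lemma cubic_tail_scale: "cubic_tail r (c * u) (c * s) (c * t) = c ^ 3 * cubic_tail r u s t"
  by (simp add: cubic_tail_def power2_eq_square power3_eq_cube algebra_simps)

lemma formfun_cubic_tail:
  assumes "formfun 1 a" "formfun 1 b" "formfun 1 c"
  shows "formfun 3 (\<lambda>x. cubic_tail r (a x) (b x) (c x))"
proof -
  have m: "formfun 2 \<phi> \<Longrightarrow> formfun 1 \<psi> \<Longrightarrow> formfun 3 (\<lambda>x. \<phi> x * \<psi> x)"
    "formfun 1 \<phi> \<Longrightarrow> formfun 2 \<psi> \<Longrightarrow> formfun 3 (\<lambda>x. \<phi> x * \<psi> x)"
    "formfun 1 \<phi> \<Longrightarrow> formfun 1 \<psi> \<Longrightarrow> formfun 2 (\<lambda>x. \<phi> x * \<psi> x)"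
    "formfun 1 \<phi> \<Longrightarrow> formfun 2 (\<lambda>x. \<phi> x ^ 2)" "formfun 1 \<phi> \<Longrightarrow> formfun 3 (\<lambda>x. \<phi> x ^ 3)"
    for \<phi> \<psi> :: "'a ^ 'b \<Rightarrow> 'a"
    by (auto intro: formfun_mult formfun_power)
  have quad: "formfun 2 (\<lambda>x. r 3 * b x ^ 2 + r 4 * (b x * c x) + r 5 * c x ^ 2)"
    by (intro formfun_add formfun_cmult m assms)
  have lin: "formfun 1 (\<lambda>x. r 1 * b x + r 2 * c x)"
    by (intro formfun_add formfun_cmult assms)
  have "formfun 3 (\<lambda>x. r 0 * a x ^ 3)"
    "formfun 3 (\<lambda>x. a x ^ 2 * (r 1 * b x + r 2 * c x))"
    "formfun 3 (\<lambda>x. a x * (r 3 * b x ^ 2 + r 4 * (b x * c x) + r 5 * c x ^ 2))"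
    "formfun 3 (\<lambda>x. r 6 * b x ^ 3)" "formfun 3 (\<lambda>x. r 7 * (b x ^ 2 * c x))"
    "formfun 3 (\<lambda>x. r 8 * (b x * c x ^ 2))" "formfun 3 (\<lambda>x. r 9 * c x ^ 3)"
    by (rule formfun_cmult m(5) m(1)[OF m(4)] m(2)[OF _ m(4)] m(2)[OF _ quad] lin assms)+
  then show ?thesis
    unfolding cubic_tail_def by (intro formfun_add)
qed

context cubic_normal_form
begin

section \<open>The closure of the family of planes\<close>

lemma planes_irreducible: "zariski_irreducible planes"
proof -
  obtain q where q: "normal_cubic r q = 0" "q $ 3 = 0" "q $ 4 = 1" "q $ 5 = 0"
    by (rule plane_of_point[of 1 0 0]) simp
  have nz: "plane_of (vec3 0 1 0 $ 0) (vec3 0 1 0 $ 1) (vec3 0 1 0 $ 2) \<noteq> 0"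
    using plane_of_nonzero[OF q(1)] q(2-4) by simp
  have "polyfun (\<lambda>p :: 'a ^ 3. plane_of (p $ 0) (p $ 1) (p $ 2) $ i)" for i
    unfolding plane_of_def plane_pluecker_def cubic_tail_def vector_add_component vector_smult_component
    by (intro polyfun_add polyfun_mult polyfun_const polyfun_nth polyfun_power polyfun_uminus)
  then show ?thesis
    unfolding planes_def
    by (rule zariski_irreducible_image[where \<phi> = "\<lambda>p :: 'a ^ 3. plane_of (p $ 0) (p $ 1) (p $ 2)" and a = "vec3 0 1 0"])
      (rule nz)
qed

lemma planes_coords:
  assumes "X \<in> planes"
  obtains u s t where "cw X = - cubic_tail r u s t" "ca0 X = u * s ^ 2" "ca1 X = u * (s * t)" "ca2 X = u * t ^ 2"
    "ce0 X = s ^ 3" "ce1 X = s ^ 2 * t" "ce2 X = s * t ^ 2" "ce3 X = t ^ 3" "X = plane_of u s t"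
proof -
  obtain p :: "'a ^ 3" where X: "X = plane_of (p $ 0) (p $ 1) (p $ 2)"
    using assms by (auto simp: planes_def)
  define u s t where "u = p $ 0" "s = p $ 1" "t = p $ 2"
  note X = X[folded u_s_t_def]
  show ?thesis
  proof (cases "s = 0 \<and> t = 0")
    case True
    \<comment> \<open>A nonzero member with \<open>s = t = 0\<close> is the plane of the conic
      itself, so any parameter on the conic will do; (1, 0) is taken, with
      \<open>l = 0\<close>.\<close>
    let ?q = "vec6 (- cubic_tail r u 0 0) 0 0 0 0 0"
    have st: "s = 0" "t = 0"
      using True by auto
    have "X = pluecker_vector [A *v ?q, e_vec 1 0, e_vec' 1 0]"
      using plane_pluecker_eq[of ?q 0 1 0] by (simp add: X st plane_of_def)
    then show ?thesis
      using coords_pluecker[of ?q 0 1 0 X] by (intro that[OF _ _ _ _ _ _ _ _ X]) (simp_all add: st)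
  next
    case False
    then obtain q where q: "normal_cubic r q = 0" "q $ 3 = u" "q $ 4 = s" "q $ 5 = t"
      using plane_of_point[of s t u] by blast
    have "q $ 0 * s ^ 2 + 2 * q $ 1 * s * t + q $ 2 * t ^ 2 = - cubic_tail r u s t"
      using q by (simp add: normal_cubic_def eq_neg_iff_add_eq_0)
    moreover have "X = pluecker_vector [A *v q, e_vec s t, e_vec' s t]"
      using plane_of_eq[OF q(1)] by (simp add: X q(2-4))
    ultimately show ?thesis
      using coords_pluecker[of q 1 s t X] q by (intro that[OF _ _ _ _ _ _ _ _ X]) simp_all
  qed
qed

definition plane_closure :: "('a ^ (6 set)) set" where
  "plane_closure = zariski_closure planes"

lemma plane_closure_pluecker:
  assumes "X \<in> plane_closure"
  shows "X = plane_pluecker (cw X) (ca0 X) (ca1 X) (ca2 X) (ce0 X) (ce1 X) (ce2 X) (ce3 X)"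
proof -
  let ?P = "\<lambda>X. plane_pluecker (cw X) (ca0 X) (ca1 X) (ca2 X) (ce0 X) (ce1 X) (ce2 X) (ce3 X)"
  have "X $ i - ?P X $ i = 0" for i
  proof (rule zariski_closure_form_zero[where \<phi> = "\<lambda>X. X $ i - ?P X $ i"])
    show "X \<in> zariski_closure planes"
      using assms by (simp add: plane_closure_def)
    show "formfun 1 (\<lambda>X. X $ i - ?P X $ i)"
      unfolding plane_pluecker_def vector_add_component vector_smult_component
      by (intro formfun_diff formfun_nth formfun_add formfun_multc formfun_cmult coords_form)
    show "Y $ i - ?P Y $ i = 0" if Y: "Y \<in> planes" for Y
    proof -
      obtain u s t where "cw Y = - cubic_tail r u s t" "ca0 Y = u * s ^ 2" "ca1 Y = u * (s * t)" "ca2 Y = u * t ^ 2"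
        "ce0 Y = s ^ 3" "ce1 Y = s ^ 2 * t" "ce2 Y = s * t ^ 2" "ce3 Y = t ^ 3" "Y = plane_of u s t"
        using Y by (rule planes_coords)
      then have "?P Y = Y"
        unfolding plane_of_def by simp
      then show ?thesis
        by simp
    qed
  qed
  then show ?thesis
    by (simp add: vec_eq_iff)
qed

text \<open>On \<open>planes\<close> the five columns are proportional to (s, t). Limits come
  without such a pair, so the proportionality is passed to the closure as quadratic
  relations.\<close>

lemma plane_closure_minors:
  assumes X: "X \<in> plane_closure"
    and pq: "(p, q) \<in> {(ca0, ca1), (ca1, ca2), (ce0, ce1), (ce1, ce2), (ce2, ce3)}"
    and pq': "(p', q') \<in> {(ca0, ca1), (ca1, ca2), (ce0, ce1), (ce1, ce2), (ce2, ce3)}"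
  shows "p X * q' X - p' X * q X = 0"
proof (rule zariski_closure_form_zero[where \<phi> = "\<lambda>X. p X * q' X - p' X * q X"])
  show "X \<in> zariski_closure planes"
    using X by (simp add: plane_closure_def)
  have form: "formfun 1 p \<and> formfun 1 q"
    if "(p, q) \<in> {(ca0, ca1), (ca1, ca2), (ce0, ce1), (ce1, ce2), (ce2, ce3)}" for p q
    using that coords_form by auto
  show "formfun 2 (\<lambda>X. p X * q' X - p' X * q X)"
    by (intro formfun_diff formfun_mult[where d = 1 and e = 1]) (use form[OF pq] form[OF pq'] in simp_all)
  show "p Y * q' Y - p' Y * q Y = 0" if Y: "Y \<in> planes" for Y
  proof -
    obtain u s t where c: "cw Y = - cubic_tail r u s t" "ca0 Y = u * s ^ 2" "ca1 Y = u * (s * t)" "ca2 Y = u * t ^ 2"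
      "ce0 Y = s ^ 3" "ce1 Y = s ^ 2 * t" "ce2 Y = s * t ^ 2" "ce3 Y = t ^ 3" "Y = plane_of u s t"
      using Y by (rule planes_coords)
    have col: "p Y * t = q Y * s"
      if "(p, q) \<in> {(ca0, ca1), (ca1, ca2), (ce0, ce1), (ce1, ce2), (ce2, ce3)}" for p q
      using that by (auto simp: c(2-8) power2_eq_square power3_eq_cube)
    show ?thesis
    proof (cases "s = 0 \<and> t = 0")
      case True
      have "p Y = 0" if "(p, q) \<in> {(ca0, ca1), (ca1, ca2), (ce0, ce1), (ce1, ce2), (ce2, ce3)}" for p q
        using that by (auto simp: c(2-8) True)
      from this[OF pq] this[OF pq'] show ?thesis
        by simp
    next
      case False
      then have st: "s \<noteq> 0 \<or> t \<noteq> 0"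
        by simp
      obtain k k' where "p Y = k * s" "q Y = k * t" "p' Y = k' * s" "q' Y = k' * t"
        using proportional[OF st col[OF pq]] proportional[OF st col[OF pq']] by blast
      then show ?thesis
        by simp
    qed
  qed
qed

text \<open>The equation of the hypersurface in the new coordinates: on \<open>planes\<close> the
  triple \<open>(ca0, ce0, ce1)\<close> is s^2 times (u, s, t), so multiplying by s^6 gives a cubic
  relation. The second relation does the same with t.\<close>

lemma plane_closure_cubics:
  assumes X: "X \<in> plane_closure"
  shows "ce0 X ^ 2 * cw X + cubic_tail r (ca0 X) (ce0 X) (ce1 X) = 0"
    "ce3 X ^ 2 * cw X + cubic_tail r (ca2 X) (ce2 X) (ce3 X) = 0"
proof -
  have X: "X \<in> zariski_closure planes"
    using X by (simp add: plane_closure_def)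
  have form: "formfun 3 (\<lambda>X. e X ^ 2 * w X + cubic_tail r (a X) (b X) (c X))"
    if "formfun 1 e" "formfun 1 w" "formfun 1 a" "formfun 1 b" "formfun 1 c"
    for e w a b c :: "'a ^ (6 set) \<Rightarrow> 'a"
    by (intro formfun_add formfun_cubic_tail formfun_mult[OF formfun_power, of 1 e 2 2 1 w 3] that) simp_all
  show "ce0 X ^ 2 * cw X + cubic_tail r (ca0 X) (ce0 X) (ce1 X) = 0"
  proof (rule zariski_closure_form_zero[OF X form[OF coords_form(5,1,2,5,6)]])
    fix Y assume Y: "Y \<in> planes"
    obtain u s t where c: "cw Y = - cubic_tail r u s t" "ca0 Y = u * s ^ 2" "ca1 Y = u * (s * t)" "ca2 Y = u * t ^ 2"
      "ce0 Y = s ^ 3" "ce1 Y = s ^ 2 * t" "ce2 Y = s * t ^ 2" "ce3 Y = t ^ 3" "Y = plane_of u s t"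
      using Y by (rule planes_coords)
    have "cubic_tail r (ca0 Y) (ce0 Y) (ce1 Y) = (s ^ 2) ^ 3 * cubic_tail r u s t"
      unfolding cubic_tail_scale[symmetric] c(1-8) by (simp add: power2_eq_square power3_eq_cube mult_ac)
    then show "ce0 Y ^ 2 * cw Y + cubic_tail r (ca0 Y) (ce0 Y) (ce1 Y) = 0"
      by (simp add: c(1,5) flip: power_mult)
  qed
  show "ce3 X ^ 2 * cw X + cubic_tail r (ca2 X) (ce2 X) (ce3 X) = 0"
  proof (rule zariski_closure_form_zero[OF X form[OF coords_form(8,1,4,7,8)]])
    fix Y assume Y: "Y \<in> planes"
    obtain u s t where c: "cw Y = - cubic_tail r u s t" "ca0 Y = u * s ^ 2" "ca1 Y = u * (s * t)" "ca2 Y = u * t ^ 2"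
      "ce0 Y = s ^ 3" "ce1 Y = s ^ 2 * t" "ce2 Y = s * t ^ 2" "ce3 Y = t ^ 3" "Y = plane_of u s t"
      using Y by (rule planes_coords)
    have "cubic_tail r (ca2 Y) (ce2 Y) (ce3 Y) = (t ^ 2) ^ 3 * cubic_tail r u s t"
      unfolding cubic_tail_scale[symmetric] c(1-8) by (simp add: power2_eq_square power3_eq_cube mult_ac)
    then show "ce3 Y ^ 2 * cw Y + cubic_tail r (ca2 Y) (ce2 Y) (ce3 Y) = 0"
      by (simp add: c(1,8) flip: power_mult)
  qed
qed

text \<open>Membership in the closure is part of the definition, so the equations only have to show
  that every limit is a plane of this shape. The value \<open>l = 0\<close> admits limit planes
  whose point \<open>q\<close> has x4 = x5 = 0.\<close>

definition scroll_plane :: "'a ^ 6 \<Rightarrow> 'a \<Rightarrow> 'a \<Rightarrow> 'a \<Rightarrow> bool" where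
  "scroll_plane q s t l \<longleftrightarrow> (s \<noteq> 0 \<or> t \<noteq> 0) \<and> q $ 4 = l * s \<and> q $ 5 = l * t \<and> normal_cubic r q = 0 \<and>
    pluecker_vector [A *v q, e_vec s t, e_vec' s t] \<in> plane_closure"

definition scroll :: "('a ^ 6) set set" where
  "scroll = {L. \<exists>q s t l. scroll_plane q s t l \<and> L = vec.span {A *v q, e_vec s t, e_vec' s t}}"

text \<open>The minors yield \<open>s\<close>, \<open>t\<close>, \<open>x\<close> and
  \<open>l\<close>. One of the two cubic relations carries a nonzero power of \<open>s\<close> or
  \<open>t\<close>, and cancelling it places \<open>q\<close> on the hypersurface.\<close>

lemma plane_closure_plane:
  assumes X: "X \<in> plane_closure"
  shows "\<exists>q s t l. scroll_plane q s t l \<and> X = pluecker_vector [A *v q, e_vec s t, e_vec' s t]"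
proof -
  have "P * Q' - P' * Q = 0"
    if "(P, Q) \<in> {(ca0 X, ca1 X), (ca1 X, ca2 X), (ce0 X, ce1 X), (ce1 X, ce2 X), (ce2 X, ce3 X)}"
      "(P', Q') \<in> {(ca0 X, ca1 X), (ca1 X, ca2 X), (ce0 X, ce1 X), (ce1 X, ce2 X), (ce2 X, ce3 X)}" for P Q P' Q'
  proof -
    note PQ = that
    have col: "\<exists>p q. (p, q) \<in> {(ca0, ca1), (ca1, ca2), (ce0, ce1), (ce1, ce2), (ce2, ce3)} \<and> P = p X \<and> Q = q X"
      if "(P, Q) \<in> {(ca0 X, ca1 X), (ca1 X, ca2 X), (ce0 X, ce1 X), (ce1 X, ce2 X), (ce2 X, ce3 X)}" for P Q
      using that unfolding insert_iff empty_iff prod.inject by blast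
    obtain p q where 1: "(p, q) \<in> {(ca0, ca1), (ca1, ca2), (ce0, ce1), (ce1, ce2), (ce2, ce3)}" "P = p X" "Q = q X"
      using col[OF PQ(1)] by (elim exE conjE)
    obtain p' q' where 2: "(p', q') \<in> {(ca0, ca1), (ca1, ca2), (ce0, ce1), (ce1, ce2), (ce2, ce3)}" "P' = p' X" "Q' = q' X"
      using col[OF PQ(2)] by (elim exE conjE)
    show ?thesis
      unfolding 1 2 by (rule plane_closure_minors[OF X 1(1) 2(1)])
  qed
  then obtain s t x l where st: "s \<noteq> 0 \<or> t \<noteq> 0" and a: "ca0 X = x * s ^ 2" "ca1 X = x * (s * t)" "ca2 X = x * t ^ 2"
    and e: "ce0 X = l * s ^ 3" "ce1 X = l * (s ^ 2 * t)" "ce2 X = l * (s * t ^ 2)" "ce3 X = l * t ^ 3"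
    by (rule scroll_parametrisation)
  have "cubic_tail r (ca0 X) (ce0 X) (ce1 X) = (s ^ 2) ^ 3 * cubic_tail r x (l * s) (l * t)"
    unfolding cubic_tail_scale[symmetric] a e by (simp add: power2_eq_square power3_eq_cube mult_ac)
  then have "(s ^ 2) ^ 3 * (l ^ 2 * cw X + cubic_tail r x (l * s) (l * t)) = 0"
    using plane_closure_cubics(1)[OF X] by (simp add: e power2_eq_square power3_eq_cube algebra_simps)
  moreover have "cubic_tail r (ca2 X) (ce2 X) (ce3 X) = (t ^ 2) ^ 3 * cubic_tail r x (l * s) (l * t)"
    unfolding cubic_tail_scale[symmetric] a e by (simp add: power2_eq_square power3_eq_cube mult_ac)
  then have "(t ^ 2) ^ 3 * (l ^ 2 * cw X + cubic_tail r x (l * s) (l * t)) = 0"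
    using plane_closure_cubics(2)[OF X] by (simp add: e power2_eq_square power3_eq_cube algebra_simps)
  ultimately have w: "l ^ 2 * cw X + cubic_tail r x (l * s) (l * t) = 0"
    using st by auto
  \<comment> \<open>Only q0 s^2 + 2 q1 s t + q2 t^2 is prescribed, so a single coordinate can carry
    it.\<close>
  define q where "q = (if s = 0 then vec6 0 0 (cw X / t ^ 2) x (l * s) (l * t)
    else vec6 (cw X / s ^ 2) 0 0 x (l * s) (l * t))"
  have q: "q $ 3 = x" "q $ 4 = l * s" "q $ 5 = l * t"
    "q $ 0 * s ^ 2 + 2 * q $ 1 * s * t + q $ 2 * t ^ 2 = cw X"
    using st by (auto simp: q_def)
  have "normal_cubic r q = l ^ 2 * (q $ 0 * s ^ 2 + 2 * q $ 1 * s * t + q $ 2 * t ^ 2) + cubic_tail r x (l * s) (l * t)"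
    unfolding normal_cubic_def q(1-3) by (simp add: power2_eq_square algebra_simps)
  then have "normal_cubic r q = 0"
    using w q(4) by simp
  moreover have "pluecker_vector [A *v q, e_vec s t, e_vec' s t] = X"
    unfolding plane_pluecker_eq[OF q(2,3)] q(4) q(1) a[symmetric] e[symmetric]
    by (rule plane_closure_pluecker[OF X, symmetric])
  ultimately show ?thesis
    using st q(2,3) X unfolding scroll_plane_def by (intro exI[of _ q] exI[of _ s] exI[of _ t] exI[of _ l]) simp
qed

lemma plane_closure_nonzero: "X \<in> plane_closure \<Longrightarrow> X \<noteq> 0"
  using zariski_closed_0[OF zariski_closure_closed] by (auto simp: plane_closure_def)

lemma scroll_pluecker: "(\<Union>L\<in>scroll. pluecker L) = plane_closure"
proof (rule set_eqI, rule iffI)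
  fix X assume "X \<in> (\<Union>L\<in>scroll. pluecker L)"
  then obtain q s t l where L: "scroll_plane q s t l" "X \<in> pluecker (vec.span {A *v q, e_vec s t, e_vec' s t})"
    unfolding scroll_def by blast
  have P: "pluecker_vector [A *v q, e_vec s t, e_vec' s t] \<in> plane_closure"
    using L(1) by (simp add: scroll_plane_def)
  obtain k where k: "k \<noteq> 0" "X = k *s pluecker_vector [A *v q, e_vec s t, e_vec' s t]"
    using L(2) by (rule pluecker_plane_multiple[OF plane_closure_nonzero[OF P]])
  show "X \<in> plane_closure"
    using zariski_closed_scale[OF zariski_closure_closed P[unfolded plane_closure_def] k(1)] k(2)
    by (simp add: plane_closure_def)
next
  fix X assume X: "X \<in> plane_closure"
  then obtain q s t l where L: "scroll_plane q s t l" "X = pluecker_vector [A *v q, e_vec s t, e_vec' s t]"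
    using plane_closure_plane by blast
  have "X \<in> pluecker (vec.span {A *v q, e_vec s t, e_vec' s t})"
    using pluecker_vector_in_pluecker plane_closure_nonzero[OF X] L(2) by blast
  moreover have "vec.span {A *v q, e_vec s t, e_vec' s t} \<in> scroll"
    unfolding scroll_def mem_Collect_eq using L(1) by (intro exI[of _ q] exI[of _ s] exI[of _ t] exI[of _ l]) simp
  ultimately show "X \<in> (\<Union>L\<in>scroll. pluecker L)"
    by (rule UN_I[rotated])
qed

lemma scroll_dim:
  assumes "L \<in> scroll"
  shows "vec.subspace L" "vec.dim L = 3"
proof -
  obtain q s t l where L: "scroll_plane q s t l" "L = vec.span {A *v q, e_vec s t, e_vec' s t}"
    using assms unfolding scroll_def by blast
  show "vec.subspace L"
    unfolding L(2) by (rule vec.subspace_span)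
  have "pluecker_vector [A *v q, e_vec s t, e_vec' s t] \<noteq> 0"
    using L(1) plane_closure_nonzero by (simp add: scroll_plane_def)
  then show "vec.dim L = 3"
    unfolding L(2) by (rule pluecker_vector_nonzero_independent(3))
qed

lemma scroll_irreducible_family: "irreducible_family 2 scroll"
proof -
  have "0 \<notin> planes"
    by (simp add: planes_def)
  then show ?thesis
    unfolding irreducible_family_def scroll_pluecker plane_closure_def
    using scroll_dim zariski_closure_closed zariski_irreducible_closure[OF planes_irreducible] by simp
qed

lemma scroll_plane_point:
  assumes "x \<in> vec.span {A *v q, e_vec s t, e_vec' s t}"
  obtains a b c where "x = A *v (a *s q + vec6 (2 * t * b) (t * c - s * b) (- (2 * s * c)) 0 0 0)"
proof -
  obtain a b c where x: "x = a *s (A *v q) + b *s e_vec s t + c *s e_vec' s t"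
    using span_3[OF assms] by blast
  have "vec6 (2 * t * b) (t * c - s * b) (- (2 * s * c)) 0 0 0 =
      b *s vec6 (2 * t) (- s) 0 0 0 0 + c *s vec6 0 t (- (2 * s)) 0 0 0"
    by (simp add: vec6_eq_iff)
  then have "x = A *v (a *s q + vec6 (2 * t * b) (t * c - s * b) (- (2 * s * c)) 0 0 0)"
    unfolding x e_vec_def e_vec'_def by (simp only: matrix_vector_right_distrib vector_scalar_commute add.assoc)
  then show ?thesis
    by (rule that)
qed

text \<open>Tangent vectors of the conic at (s, t) contribute nothing to y0 s^2 + 2 y1 s t + y2 t^2
  and leave y3, y4, y5 unchanged. On such a plane the cubic is therefore \<open>a ^ 3\<close> times
  its value at \<open>q\<close>.\<close>

lemma scroll_subset:
  assumes "L \<in> scroll"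
  shows "L - {0} \<subseteq> hypersurface f"
proof
  fix x assume x: "x \<in> L - {0}"
  obtain q s t l where L: "scroll_plane q s t l" "L = vec.span {A *v q, e_vec s t, e_vec' s t}"
    using assms unfolding scroll_def by blast
  then have q: "q $ 4 = l * s" "q $ 5 = l * t" "normal_cubic r q = 0"
    by (simp_all add: scroll_plane_def)
  obtain a b c where y: "x = A *v (a *s q + vec6 (2 * t * b) (t * c - s * b) (- (2 * s * c)) 0 0 0)"
    using scroll_plane_point[of x q s t] x[unfolded L(2)] by (metis DiffD1)
  have "normal_cubic r (a *s q + vec6 (2 * t * b) (t * c - s * b) (- (2 * s * c)) 0 0 0) =
      a ^ 3 * (q $ 0 * q $ 4 ^ 2 + 2 * q $ 1 * q $ 4 * q $ 5 + q $ 2 * q $ 5 ^ 2) +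
      cubic_tail r (a * q $ 3) (a * q $ 4) (a * q $ 5)"
    by (simp add: normal_cubic_def q(1,2) power2_eq_square power3_eq_cube algebra_simps)
  also have "\<dots> = a ^ 3 * normal_cubic r q"
    by (simp add: cubic_tail_scale normal_cubic_def algebra_simps)
  finally have "peval f x = 0"
    using y q(3) by (simp add: f_A)
  then show "x \<in> hypersurface f"
    using x by (simp add: hypersurface_def)
qed

end

section \<open>Tangent lines of the conic\<close>

definition matrix_curve :: "'a::comm_ring_1 ^ 'n ^ 'm \<Rightarrow> ('n::finite \<Rightarrow> 'a poly) \<Rightarrow> 'm \<Rightarrow> 'a poly" where
  "matrix_curve M q i = (\<Sum>j\<in>UNIV. smult (M $ i $ j) (q j))"

lemma cpt_matrix_curve: "cpt (matrix_curve M q) e = M *v cpt q e"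
  by (simp add: vec_eq_iff matrix_vector_mult_def matrix_curve_def poly_sum)

lemma pderiv_matrix_curve:
  fixes M :: "'a::{comm_ring_1, semiring_no_zero_divisors} ^ 'n ^ 'm"
  shows "(\<chi> i. poly (pderiv (matrix_curve M q i)) e) = M *v (\<chi> i. poly (pderiv (q i)) e)"
  by (simp add: vec_eq_iff matrix_vector_mult_def matrix_curve_def poly_sum pderiv_sum pderiv_smult)

lemma cpt_vec6: "cpt (\<lambda>j. vec6 a b c d e g $ j) x = vec6 (poly a x) (poly b x) (poly c x) (poly d x) (poly e x) (poly g x)"
  by (simp add: vec6_eq_iff)

lemma tangent_space_form:
  fixes z v :: "'a::field_char_0 ^ 'n::finite"
  assumes v: "v \<in> tangent_space Z z" and \<phi>: "formfun d \<phi>" "\<And>x. x \<in> Z \<Longrightarrow> \<phi> x = 0"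
    and p: "\<And>e. poly p e = \<phi> (z + e *s v)"
  shows "poly (pderiv p) 0 = 0"
proof -
  obtain g where g: "form d g" "\<And>x. peval g x = \<phi> x"
    using \<phi>(1) by (auto simp: formfun_def)
  have "dot (grad g z) v = poly (pderiv p) 0"
    by (rule dot_grad_line) (simp add: g(2) p)
  moreover have "homogeneous g \<and> (\<forall>x\<in>Z. peval g x = 0)"
    using g \<phi>(2) by (auto simp: homogeneous_def)
  ultimately show ?thesis
    using v by (auto simp: tangent_space_dot)
qed

context cubic_normal_form
begin

lemma tangent_conic_subset:
  assumes st: "s \<noteq> 0 \<or> t \<noteq> 0" and v: "v \<in> tangent_space (conic_set conic_mat) (conic_pt s t)"
  shows "v \<in> vec.span {e_vec s t, e_vec' s t}"
proof -
  let ?z = "conic_pt s t" and ?u = "B *v v"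
  have Bz: "B *v ?z = vec6 (t ^ 2) (- (s * t)) (s ^ 2) 0 0 0"
    by (simp add: conic_pt_def)
  have conic: "\<exists>a b. B *v x = vec6 (b ^ 2) (- (a * b)) (a ^ 2) 0 0 0" if "x \<in> conic_set conic_mat" for x
  proof -
    obtain a b where "x = conic_pt a b"
      using \<open>x \<in> conic_set conic_mat\<close> by (auto simp: conic_set_conv)
    then show ?thesis
      by (intro exI[of _ a] exI[of _ b]) (simp add: conic_pt_def)
  qed
  have line: "B *v (?z + e *s v) = vec6 (t ^ 2) (- (s * t)) (s ^ 2) 0 0 0 + e *s ?u" for e
    by (simp add: matrix_vector_right_distrib vector_scalar_commute Bz)
  have lin: "?u $ i = 0" if i: "i = 3 \<or> i = 4 \<or> i = 5" for i
  proof -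
    have "poly (pderiv [:0, ?u $ i:]) 0 = 0"
    proof (rule tangent_space_form[OF v formfun_matrix[of B i]])
      show "(B *v x) $ i = 0" if "x \<in> conic_set conic_mat" for x
        using conic[OF that] i by auto
      show "poly [:0, ?u $ i:] e = (B *v (?z + e *s v)) $ i" for e
        unfolding line using i by auto
    qed
    then show ?thesis
      by (simp add: pderiv_pCons)
  qed
  have "poly (pderiv ([:- (s * t), ?u $ 1:] ^ 2 - [:t ^ 2, ?u $ 0:] * [:s ^ 2, ?u $ 2:])) 0 = 0"
  proof (rule tangent_space_form[OF v, where d = 2 and \<phi> = "\<lambda>x. (B *v x) $ 1 ^ 2 - (B *v x) $ 0 * (B *v x) $ 2"])
    show "formfun 2 (\<lambda>x. (B *v x) $ 1 ^ 2 - (B *v x) $ 0 * (B *v x) $ 2)"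
      by (intro formfun_diff formfun_power[OF formfun_matrix] formfun_mult[OF formfun_matrix formfun_matrix]) simp_all
    show "(B *v x) $ 1 ^ 2 - (B *v x) $ 0 * (B *v x) $ 2 = 0" if "x \<in> conic_set conic_mat" for x
      using conic[OF that] by (auto simp: power_mult_distrib)
    show "poly ([:- (s * t), ?u $ 1:] ^ 2 - [:t ^ 2, ?u $ 0:] * [:s ^ 2, ?u $ 2:]) e =
        (B *v (?z + e *s v)) $ 1 ^ 2 - (B *v (?z + e *s v)) $ 0 * (B *v (?z + e *s v)) $ 2" for e
      unfolding line by (simp add: power2_eq_square algebra_simps)
  qed
  moreover have "poly (pderiv ([:- (s * t), ?u $ 1:] ^ 2 - [:t ^ 2, ?u $ 0:] * [:s ^ 2, ?u $ 2:])) 0 =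
      - (s ^ 2 * ?u $ 0 + 2 * s * t * ?u $ 1 + t ^ 2 * ?u $ 2)"
    by (simp add: pderiv_diff pderiv_mult pderiv_power pderiv_pCons algebra_simps)
  ultimately have quad: "s ^ 2 * ?u $ 0 + 2 * s * t * ?u $ 1 + t ^ 2 * ?u $ 2 = 0"
    by (simp only: neg_equal_0_iff_equal)
  obtain b c where bc: "2 * t * b = ?u $ 0" "t * c - s * b = ?u $ 1" "- (2 * s * c) = ?u $ 2"
  proof (cases "s = 0")
    case True
    then have "?u $ 2 = 0"
      using st quad by simp
    then show ?thesis
      using that[of "?u $ 0 / (2 * t)" "?u $ 1 / t"] True st by simp
  next
    case False
    define c where "c = - ?u $ 2 / (2 * s)"
    define b where "b = (t * c - ?u $ 1) / s"
    have c: "- (2 * s * c) = ?u $ 2"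
      using False by (simp add: c_def)
    have b: "s * b = t * c - ?u $ 1"
      using False by (simp add: b_def)
    have "s ^ 2 * (2 * t * b) = 2 * t * s * (s * b)"
      by (simp add: power2_eq_square)
    also have "\<dots> = - (t ^ 2 * (- (2 * s * c))) - 2 * s * t * ?u $ 1"
      unfolding b by (simp add: power2_eq_square algebra_simps)
    also have "\<dots> = s ^ 2 * ?u $ 0"
      unfolding c using quad by algebra
    finally have "2 * t * b = ?u $ 0"
      using False by simp
    then show ?thesis
      using that[of b c] b c by simp
  qed
  have "?u = b *s vec6 (2 * t) (- s) 0 0 0 0 + c *s vec6 0 t (- (2 * s)) 0 0 0"
    using bc lin by (simp add: vec6_eq_iff algebra_simps)
  then have "A *v ?u = b *s e_vec s t + c *s e_vec' s t"
    unfolding e_vec_def e_vec'_def by (simp only: matrix_vector_right_distrib vector_scalar_commute)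
  then show ?thesis
    by (auto intro!: vec.span_add vec.span_scale intro: vec.span_base)
qed

lemma tangent_conic_curve:
  assumes "s \<noteq> 0 \<or> t \<noteq> 0"
  shows "A *v vec6 (2 * t * b) (t * c - s * b) (- (2 * s * c)) 0 0 0 \<in> tangent_space (conic_set conic_mat) (conic_pt s t)"
proof -
  define Y where "Y = (\<lambda>j. vec6 ([:t, b:] ^ 2) (- ([:s, - c:] * [:t, b:])) ([:s, - c:] ^ 2) 0 0 0 $ j)"
  have cpt: "cpt (matrix_curve A Y) e = conic_pt (s - e * c) (t + e * b)" for e
    unfolding cpt_matrix_curve Y_def cpt_vec6 conic_pt_def
    by (rule arg_cong[of _ _ "\<lambda>v. A *v v"]) (simp add: vec6_eq_iff algebra_simps)
  have "(\<chi> i. poly (pderiv (matrix_curve A Y i)) 0) \<in> tangent_space (conic_set conic_mat) (cpt (matrix_curve A Y) 0)"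
    by (rule tangent_space_curve) (use assms in \<open>auto simp: cpt conic_set_conv conic_pt_eq_0\<close>)
  moreover have "(\<chi> i. poly (pderiv (Y i)) 0) = vec6 (2 * t * b) (t * c - s * b) (- (2 * s * c)) 0 0 0"
    by (simp add: vec6_eq_iff Y_def pderiv_mult pderiv_power pderiv_pCons pderiv_minus algebra_simps)
  ultimately show ?thesis
    by (simp add: pderiv_matrix_curve cpt)
qed

lemma tangent_conic:
  assumes "s \<noteq> 0 \<or> t \<noteq> 0"
  shows "tangent_space (conic_set conic_mat) (conic_pt s t) = vec.span {e_vec s t, e_vec' s t}"
proof (rule antisym)
  show "tangent_space (conic_set conic_mat) (conic_pt s t) \<subseteq> vec.span {e_vec s t, e_vec' s t}"
    using tangent_conic_subset[OF assms] by (rule subsetI)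
  have "e_vec s t \<in> tangent_space (conic_set conic_mat) (conic_pt s t)"
    using tangent_conic_curve[OF assms, of 1 0] by (simp add: e_vec_def)
  moreover have "e_vec' s t \<in> tangent_space (conic_set conic_mat) (conic_pt s t)"
    using tangent_conic_curve[OF assms, of 0 1] by (simp add: e_vec'_def)
  ultimately show "vec.span {e_vec s t, e_vec' s t} \<subseteq> tangent_space (conic_set conic_mat) (conic_pt s t)"
    by (intro vec.span_minimal subspace_tangent_space) simp
qed

lemma conic_smooth:
  assumes "s \<noteq> 0 \<or> t \<noteq> 0"
  shows "conic_pt s t \<in> smooth_locus (conic_set conic_mat)"
proof -
  \<comment> \<open>Independence of the two tangent vectors is read off from a plane that contains
    them and has a nonzero Pluecker vector.\<close>
  obtain q where q: "normal_cubic r q = 0" "q $ 4 = s" "q $ 5 = t"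
    using plane_of_point[OF assms] by blast
  then have "pluecker_vector [A *v q, e_vec s t, e_vec' s t] \<noteq> 0"
    using plane_of_nonzero[of q] plane_of_eq[OF q(1)] assms by simp
  note ind = pluecker_vector_nonzero_independent(1,2)[OF this]
  have "vec.independent {e_vec s t, e_vec' s t}"
    using ind(2) by (rule vec.independent_mono) auto
  moreover have "card {e_vec s t, e_vec' s t} = 2"
    using ind(1) by simp
  ultimately have "vec.dim (vec.span {e_vec s t, e_vec' s t}) = 2"
    using vec.dim_span_eq_card_independent by metis
  moreover have "conic_pt s t \<in> conic_set conic_mat"
    using assms by (auto simp: conic_set_conv conic_pt_eq_0)
  ultimately show ?thesis
    by (simp add: smooth_locus_def tangent_conic[OF assms] proj_dim_conic[OF conic_inv_mat])
qed

section \<open>The scroll structure\<close>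

text \<open>Unless x4 = x5 = 0, the point determines the ratio of (s, t) and hence the tangent line
  contained in any member through it. That member contains \<open>P\<close>, and both have dimension
  three.\<close>

lemma scroll_through_point:
  assumes x: "x \<in> hypersurface f" and nz: "(B *v x) $ 4 \<noteq> 0 \<or> (B *v x) $ 5 \<noteq> 0"
  defines "P \<equiv> vec.span {x, e_vec ((B *v x) $ 4) ((B *v x) $ 5), e_vec' ((B *v x) $ 4) ((B *v x) $ 5)}"
  shows "P \<in> scroll" "\<And>L. L \<in> scroll \<Longrightarrow> x \<in> L \<Longrightarrow> L = P"
proof -
  let ?y = "B *v x"
  have y: "normal_cubic r ?y = 0"
    using x by (simp add: hypersurface_def f_eq)
  have pl: "plane_of (?y $ 3) (?y $ 4) (?y $ 5) = pluecker_vector [A *v ?y, e_vec (?y $ 4) (?y $ 5), e_vec' (?y $ 4) (?y $ 5)]"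
    by (rule plane_of_eq[OF y])
  have "plane_of (?y $ 3) (?y $ 4) (?y $ 5) \<in> planes"
    unfolding planes_def using plane_of_nonzero[OF y nz] by (auto intro!: exI[of _ "vec3 (?y $ 3) (?y $ 4) (?y $ 5)"])
  then have "plane_of (?y $ 3) (?y $ 4) (?y $ 5) \<in> plane_closure"
    unfolding plane_closure_def using zariski_closure_superset[of planes] plane_of_nonzero[OF y nz] by blast
  then have "scroll_plane ?y (?y $ 4) (?y $ 5) 1"
    unfolding scroll_plane_def using pl y nz by simp
  then show P: "P \<in> scroll"
    unfolding scroll_def P_def mem_Collect_eq
    by (intro exI[of _ ?y] exI[of _ "?y $ 4"] exI[of _ "?y $ 5"] exI[of _ 1]) simp
  fix L assume L: "L \<in> scroll" "x \<in> L"
  obtain q s t l where q: "scroll_plane q s t l" "L = vec.span {A *v q, e_vec s t, e_vec' s t}"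
    using L(1) unfolding scroll_def by blast
  obtain a b c where "x = A *v (a *s q + vec6 (2 * t * b) (t * c - s * b) (- (2 * s * c)) 0 0 0)"
    using scroll_plane_point[of x q s t] L(2) q(2) by metis
  then have y45: "?y $ 4 = a * l * s" "?y $ 5 = a * l * t"
    using q(1) by (simp_all add: scroll_plane_def)
  have "vec6 (2 * (k * t)) (- (k * s)) 0 0 0 0 = k *s vec6 (2 * t) (- s) 0 0 0 0"
    "vec6 0 (k * t) (- (2 * (k * s))) 0 0 0 = k *s vec6 0 t (- (2 * s)) 0 0 0" for k
    by (simp_all add: vec6_eq_iff)
  then have e: "e_vec (k * s) (k * t) = k *s e_vec s t" "e_vec' (k * s) (k * t) = k *s e_vec' s t" for k
    by (simp_all add: e_vec_def e_vec'_def vector_scalar_commute)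
  have "e_vec s t \<in> L" "e_vec' s t \<in> L"
    unfolding q(2) by (auto intro: vec.span_base)
  then have "{x, e_vec (?y $ 4) (?y $ 5), e_vec' (?y $ 4) (?y $ 5)} \<subseteq> L"
    unfolding y45 e using L(2) vec.subspace_scale[OF scroll_dim(1)[OF L(1)]] by simp
  then have "P \<subseteq> L"
    unfolding P_def by (rule vec.span_minimal[OF _ scroll_dim(1)[OF L(1)]])
  then show "L = P"
    using vec.subspace_dim_equal[OF scroll_dim(1)[OF P] scroll_dim(1)[OF L(1)]] scroll_dim(2)[OF P] scroll_dim(2)[OF L(1)]
    by simp
qed

section \<open>Density of the points off x4 = x5 = 0\<close>

definition base_locus :: "('a ^ 6) set" where
  "base_locus = {x. x \<noteq> 0 \<and> (B *v x) $ 4 = 0 \<and> (B *v x) $ 5 = 0}"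

lemma base_locus_closed: "zariski_closed base_locus"
  using zariski_closed_forms[of "{\<lambda>x. (B *v x) $ 4, \<lambda>x. (B *v x) $ 5}"] formfun_matrix[of B]
  by (auto simp: base_locus_def)

lemma limit_of_general_points:
  assumes y: "B *v x = cpt Y 0" "x \<noteq> 0"
    and Y: "\<And>e. e \<noteq> 0 \<Longrightarrow> normal_cubic r (cpt Y e) = 0" "\<And>e. e \<noteq> 0 \<Longrightarrow> cpt Y e $ 4 \<noteq> 0 \<or> cpt Y e $ 5 \<noteq> 0"
  shows "x \<in> zariski_closure (hypersurface f - base_locus)"
proof -
  have x: "cpt (matrix_curve A Y) 0 = x"
    by (simp add: cpt_matrix_curve flip: y(1))
  have "cpt (matrix_curve A Y) e \<in> hypersurface f - base_locus" if "e \<noteq> 0" for e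
  proof -
    have "cpt Y e \<noteq> 0"
      using Y(2)[OF that] by fastforce
    then show ?thesis
      using Y[OF that] unfolding cpt_matrix_curve hypersurface_def base_locus_def
      by (simp add: f_A del: cpt_nth)
  qed
  then have "cpt (matrix_curve A Y) 0 \<in> zariski_closure (hypersurface f - base_locus)"
    by (intro zariski_closure_curve) (simp_all add: x y(2))
  then show ?thesis
    by (simp add: x)
qed

text \<open>The curve leaves in a direction (s, t) that is a zero of a binary quadratic form, which
  removes the term of order two. The term of order three is balanced by moving x0 or x2
  linearly.\<close>

lemma limit_x3_zero:
  assumes x: "x \<noteq> 0" and y: "(B *v x) $ 3 = 0" "(B *v x) $ 4 = 0" "(B *v x) $ 5 = 0"
  shows "x \<in> zariski_closure (hypersurface f - base_locus)"
proof -
  let ?y = "B *v x"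
  have "\<exists>s t. (s \<noteq> 0 \<or> t \<noteq> 0) \<and> ?y $ 0 * s ^ 2 + 2 * ?y $ 1 * s * t + ?y $ 2 * t ^ 2 = 0"
  proof (cases "?y $ 0 = 0")
    case True
    then show ?thesis
      by (intro exI[of _ 1] exI[of _ 0]) simp
  next
    case False
    then have "degree [:?y $ 2, 2 * ?y $ 1, ?y $ 0:] > 0"
      by simp
    then obtain s where "poly [:?y $ 2, 2 * ?y $ 1, ?y $ 0:] s = 0"
      using alg_closed_imp_poly_has_root by blast
    then show ?thesis
      by (intro exI[of _ s] exI[of _ 1]) (simp add: power2_eq_square algebra_simps)
  qed
  then obtain s t where st: "s \<noteq> 0 \<or> t \<noteq> 0" and q: "?y $ 0 * s ^ 2 + 2 * ?y $ 1 * s * t + ?y $ 2 * t ^ 2 = 0"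
    by blast
  obtain v0 v2 where v: "v0 * s ^ 2 + v2 * t ^ 2 = cubic_tail r 0 s t"
  proof (cases "s = 0")
    case True
    then show ?thesis
      using that[of 0 "cubic_tail r 0 s t / t ^ 2"] st by simp
  next
    case False
    then show ?thesis
      using that[of "cubic_tail r 0 s t / s ^ 2" 0] by simp
  qed
  let ?Y = "\<lambda>j. vec6 [:?y $ 0, - v0:] [:?y $ 1:] [:?y $ 2, - v2:] 0 [:0, s:] [:0, t:] $ j"
  show ?thesis
  proof (rule limit_of_general_points[where Y = ?Y, OF _ x])
    show "B *v x = cpt ?Y 0"
      unfolding cpt_vec6 vec6_eq_iff using y by simp
    show "normal_cubic r (cpt ?Y e) = 0" for e
    proof -
      have "normal_cubic r (cpt ?Y e) = e ^ 2 * (?y $ 0 * s ^ 2 + 2 * ?y $ 1 * s * t + ?y $ 2 * t ^ 2)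
          - e ^ 3 * (v0 * s ^ 2 + v2 * t ^ 2) + cubic_tail r (e * 0) (e * s) (e * t)"
        unfolding cpt_vec6 normal_cubic_def by (simp add: power2_eq_square power3_eq_cube algebra_simps)
      then show ?thesis
        unfolding cubic_tail_scale q v by simp
    qed
    show "cpt ?Y e $ 4 \<noteq> 0 \<or> cpt ?Y e $ 5 \<noteq> 0" if "e \<noteq> 0" for e
      unfolding cpt_vec6 using st that by simp
  qed
qed

text \<open>Points with \<open>x\<^sub>3 \<noteq> 0\<close> and \<open>x\<^sub>4 = x\<^sub>5 = 0\<close> lie on the hypersurface only if \<open>r 0 = 0\<close>; the direction
  in which \<open>(x\<^sub>4, x\<^sub>5)\<close> leaves the origin is then forced, up to first order, by
  \<open>r 1 * x\<^sub>4 + r 2 * x\<^sub>5 = 0\<close>.\<close>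

lemma limit_x3_nonzero:
  assumes x: "x \<in> hypersurface f" and y: "(B *v x) $ 3 \<noteq> 0" "(B *v x) $ 4 = 0" "(B *v x) $ 5 = 0"
  shows "x \<in> zariski_closure (hypersurface f - base_locus)"
proof -
  define y0 y1 y2 y3 where "y0 = (B *v x) $ 0" "y1 = (B *v x) $ 1" "y2 = (B *v x) $ 2" "y3 = (B *v x) $ 3"
  note y_def = this
  have x0: "x \<noteq> 0" and "normal_cubic r (B *v x) = 0"
    using x by (simp_all add: hypersurface_def f_eq)
  then have r0: "r 0 = 0"
    using y by (simp add: normal_cubic_def cubic_tail_def)
  have y3: "y3 \<noteq> 0"
    using y(1) by (simp add: y_def)
  show ?thesis
  proof (cases "r 2 = 0")
    case False
    define s t where "s = r 2" "t = - r 1"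
    have s: "s \<noteq> 0" and rst: "r 1 * s + r 2 * t = 0"
      using False by (simp_all add: s_t_def)
    \<comment> \<open>\<open>v\<close> bends x5 at second order so that the terms in
      \<open>e ^ 2\<close> cancel while x0 starts at \<open>y0\<close>. Everything else is collected
      in \<open>N\<close> and absorbed into x0 by \<open>Z\<close>.\<close>
    define v where "v = - (y0 * s ^ 2 + 2 * y1 * s * t + y2 * t ^ 2 +
      y3 * (r 3 * s ^ 2 + r 4 * (s * t) + r 5 * t ^ 2)) / (y3 ^ 2 * s)"
    have v: "y0 * s ^ 2 + 2 * y1 * s * t + y2 * t ^ 2 + y3 * (r 3 * s ^ 2 + r 4 * (s * t) + r 5 * t ^ 2) +
        y3 ^ 2 * s * v = 0"
      using s y3 by (simp add: v_def field_simps)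
    define N where "N e = 2 * y1 * s * (t + e * v) + y2 * (t + e * v) ^ 2 + y3 ^ 2 * s * v +
      y3 * (r 3 * s ^ 2 + r 4 * (s * (t + e * v)) + r 5 * (t + e * v) ^ 2) +
      e * (r 6 * s ^ 3 + r 7 * (s ^ 2 * (t + e * v)) + r 8 * (s * (t + e * v) ^ 2) + r 9 * (t + e * v) ^ 3)" for e
    define T where "T = [:t, v:]"
    define M where "M = ([:2 * y1 * s:] * T + [:y2:] * T ^ 2 + [:y3 ^ 2 * s * v:] +
      [:y3:] * ([:r 3 * s ^ 2:] + [:r 4 * s:] * T + [:r 5:] * T ^ 2) +
      [:0, 1:] * ([:r 6 * s ^ 3:] + [:r 7 * s ^ 2:] * T + [:r 8 * s:] * T ^ 2 + [:r 9:] * T ^ 3))"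
    have M: "poly M e = N e" for e
      by (simp add: M_def N_def T_def algebra_simps)
    define Z where "Z = smult (- inverse (s ^ 2)) M"
    have Z: "poly Z e * s ^ 2 = - N e" for e
      using s by (simp add: Z_def M)
    let ?Y = "\<lambda>j. vec6 Z [:y1:] [:y2:] [:y3:] [:0, s:] ([:0, 1:] * T) $ j"
    show ?thesis
    proof (rule limit_of_general_points[where Y = ?Y, OF _ x0])
      have "poly Z 0 * s ^ 2 = y0 * s ^ 2"
        using Z[of 0] v unfolding N_def mult_zero_left add_0_right by algebra
      then have "poly Z 0 = y0"
        using s by simp
      then show "B *v x = cpt ?Y 0"
        unfolding cpt_vec6 vec6_eq_iff using y by (simp add: y_def)
      show "normal_cubic r (cpt ?Y e) = 0" for e
      proof -
        have "normal_cubic r (cpt ?Y e) = e ^ 2 * (poly Z e * s ^ 2 + N e) + e * y3 ^ 2 * (r 1 * s + r 2 * t) +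
            e ^ 2 * y3 ^ 2 * v * (r 2 - s)"
          unfolding cpt_vec6 normal_cubic_def cubic_tail_def N_def
          by (simp add: r0 T_def power2_eq_square power3_eq_cube algebra_simps)
        then show ?thesis
          unfolding Z rst by (simp add: s_t_def)
      qed
      show "cpt ?Y e $ 4 \<noteq> 0 \<or> cpt ?Y e $ 5 \<noteq> 0" if "e \<noteq> 0" for e
        unfolding cpt_vec6 using s that by simp
    qed
  next
    case True
    then have r1: "r 1 \<noteq> 0"
      using cubic_involves_x3 r0 by simp
    \<comment> \<open>Now the direction is (0, 1): x4 is the coordinate moved at second order, and
      x2 absorbs the remaining terms.\<close>
    define v where "v = - (y2 + y3 * r 5) / (y3 ^ 2 * r 1)"
    have v: "y2 + y3 * r 5 + y3 ^ 2 * r 1 * v = 0"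
      using r1 y3 by (simp add: v_def field_simps)
    define S where "S = [:0, v:]"
    define Z where "Z = - ([:y0:] * S ^ 2 + [:2 * y1:] * S + [:y3 ^ 2 * r 1 * v:] +
      [:y3:] * ([:r 3:] * S ^ 2 + [:r 4:] * S + [:r 5:]) +
      [:0, 1:] * ([:r 6:] * S ^ 3 + [:r 7:] * S ^ 2 + [:r 8:] * S + [:r 9:]))"
    let ?Y = "\<lambda>j. vec6 [:y0:] [:y1:] Z [:y3:] ([:0, 1:] * S) [:0, 1:] $ j"
    show ?thesis
    proof (rule limit_of_general_points[where Y = ?Y, OF _ x0])
      have "poly Z 0 = y2"
        using v unfolding Z_def S_def by (simp add: eq_neg_iff_add_eq_0 algebra_simps neg_eq_iff_add_eq_0)
      then show "B *v x = cpt ?Y 0"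
        unfolding cpt_vec6 vec6_eq_iff using y by (simp add: y_def)
      show "normal_cubic r (cpt ?Y e) = 0" for e
        unfolding cpt_vec6 normal_cubic_def cubic_tail_def Z_def S_def
        by (simp add: r0 True power2_eq_square power3_eq_cube algebra_simps)
      show "cpt ?Y e $ 4 \<noteq> 0 \<or> cpt ?Y e $ 5 \<noteq> 0" if "e \<noteq> 0" for e
        unfolding cpt_vec6 using that by simp
    qed
  qed
qed

lemma tangent_scroll: "tangent_scroll 2 (hypersurface f) (conic_set conic_mat)"
  unfolding tangent_scroll_def
proof (intro exI conjI ballI)
  show "irreducible_family 2 scroll"
    by (rule scroll_irreducible_family)
  show "L - {0} \<subseteq> hypersurface f" if "L \<in> scroll" for L
    using that by (rule scroll_subset)
  show "generically (hypersurface f) (\<lambda>x. (\<exists>!L. L \<in> scroll \<and> x \<in> L) \<and>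
      (\<forall>L\<in>scroll. x \<in> L \<longrightarrow> (\<exists>z\<in>smooth_locus (conic_set conic_mat). tangent_space (conic_set conic_mat) z \<subseteq> L)))"
    unfolding generically_def
  proof (intro exI[of _ base_locus] conjI ballI base_locus_closed subsetI)
    fix x assume x: "x \<in> hypersurface f"
    show "x \<in> zariski_closure (hypersurface f - base_locus)"
    proof (cases "x \<in> base_locus")
      case True
      then show ?thesis
        using limit_x3_zero[of x] limit_x3_nonzero[OF x] by (auto simp: base_locus_def)
    next
      case False
      then show ?thesis
        using x zariski_closure_superset[of "hypersurface f - base_locus"] by (auto simp: hypersurface_def)
    qed
  next
    fix x assume x: "x \<in> hypersurface f - base_locus"
    let ?s = "(B *v x) $ 4" and ?t = "(B *v x) $ 5"
    have nz: "?s \<noteq> 0 \<or> ?t \<noteq> 0" and X: "x \<in> hypersurface f"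
      using x by (auto simp: base_locus_def hypersurface_def)
    let ?P = "vec.span {x, e_vec ?s ?t, e_vec' ?s ?t}"
    note P = scroll_through_point[OF X nz]
    have "x \<in> ?P"
      by (rule vec.span_base, rule insertI1)
    show "\<exists>!L. L \<in> scroll \<and> x \<in> L"
    proof (rule ex1I[of _ ?P])
      show "?P \<in> scroll \<and> x \<in> ?P"
        using P(1) \<open>x \<in> ?P\<close> by (rule conjI)
      show "L = ?P" if "L \<in> scroll \<and> x \<in> L" for L
        by (rule P(2)) (rule conjunct1[OF that] conjunct2[OF that])+
    qed
    fix L assume "L \<in> scroll"
    show "x \<in> L \<longrightarrow> (\<exists>z\<in>smooth_locus (conic_set conic_mat). tangent_space (conic_set conic_mat) z \<subseteq> L)"
    proof
      assume "x \<in> L"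
      with \<open>L \<in> scroll\<close> have "L = ?P"
        by (rule P(2))
      then have "tangent_space (conic_set conic_mat) (conic_pt ?s ?t) \<subseteq> L"
        using vec.span_mono[OF subset_insertI] by (simp only: tangent_conic[OF nz])
      then show "\<exists>z\<in>smooth_locus (conic_set conic_mat). tangent_space (conic_set conic_mat) z \<subseteq> L"
        using conic_smooth[OF nz] by (rule bexI)
    qed
  qed
qed

end

section \<open>The normal form as a projective equivalence\<close>

definition vars_in :: "'n set \<Rightarrow> ('a::comm_ring_1, 'n) mpoly \<Rightarrow> bool" where
  "vars_in S p \<longleftrightarrow> (\<forall>m\<in>Poly_Mapping.keys p. Poly_Mapping.keys m \<subseteq> S)"

lemma vars_in_const: "vars_in S (Poly_Mapping.single 0 c)"
  and vars_in_Var: "i \<in> S \<Longrightarrow> vars_in S (Var i)"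
  by (simp_all add: vars_in_def Var_def)

lemma vars_in_add: "vars_in S p \<Longrightarrow> vars_in S q \<Longrightarrow> vars_in S (p + q)"
  using Poly_Mapping.keys_add[of p q] unfolding vars_in_def by blast

lemma vars_in_mult:
  assumes "vars_in S p" "vars_in S q"
  shows "vars_in S (p * q)"
  unfolding vars_in_def
proof
  fix m assume "m \<in> Poly_Mapping.keys (p * q)"
  then obtain a b where "m = a + b" "a \<in> Poly_Mapping.keys p" "b \<in> Poly_Mapping.keys q"
    using keys_mult[of p q] by blast
  then show "Poly_Mapping.keys m \<subseteq> S"
    using assms Poly_Mapping.keys_add[of a b] unfolding vars_in_def by blast
qed

lemma vars_in_power: "vars_in S p \<Longrightarrow> vars_in S (p ^ k)"
proof (induction k)
  case 0
  then show ?case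
    using vars_in_const[of S 1] by simp
next
  case (Suc k)
  then show ?case
    by (simp add: vars_in_mult)
qed

lemma peval_cubic_tail:
  "peval (cubic_tail (\<lambda>i. Poly_Mapping.single 0 (r i)) p q w) x = cubic_tail r (peval p x) (peval q x) (peval w x)"
  by (simp add: cubic_tail_def)

theorem theorem4p3:
  fixes f :: "('a::{alg_closed_field, field_char_0}, 6) mpoly"
  assumes "form 3 f"
    and "squarefree f"
    and "vanishing_hessian f"
    and "\<not> is_cone (hypersurface f)"
  shows "(special_perazzo_cubic f \<and>
          is_conic (dual_variety (polar_image f)) \<and>
          tangent_scroll 2 (hypersurface f) (dual_variety (polar_image f))) \<and>
         (\<exists>D :: ('a, 6) mpoly.
            form 3 D \<and> (\<forall>m\<in>Poly_Mapping.keys D. Poly_Mapping.keys m \<subseteq> {3, 4, 5}) \<and>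
            proj_equivalent (hypersurface f)
              (hypersurface (Var 0 * Var 4 ^ 2 + 2 * Var 1 * Var 4 * Var 5 + Var 2 * Var 5 ^ 2 + D)))"
proof -
  have "\<exists>(A :: 'a ^ 6 ^ 6) r. invertible A \<and> (\<forall>y. peval f (A *v y) = normal_cubic r y)"
    by (rule vanishing_hessian_normal_form[OF assms(1,3,4)]) blast
  then obtain A :: "'a ^ 6 ^ 6" and r where A: "invertible A" "\<And>y. peval f (A *v y) = normal_cubic r y"
    by blast
  then obtain B where "A ** B = mat 1" "B ** A = mat 1"
    unfolding invertible_def by blast
  then interpret cubic_normal_form f A B r
    by unfold_locales (use assms A(2) in simp_all)
  define D :: "('a, 6) mpoly" where "D = cubic_tail (\<lambda>i. Poly_Mapping.single 0 (r i)) (Var 3) (Var 4) (Var 5)"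
  have D: "peval D y = cubic_tail r (y $ 3) (y $ 4) (y $ 5)" for y
    by (simp add: D_def peval_cubic_tail)
  have "formfun 3 (peval D)"
    unfolding D by (intro formfun_cubic_tail formfun_nth)
  then obtain D' where "form 3 D'" "\<And>x. peval D' x = peval D x"
    by (auto simp: formfun_def)
  then have "form 3 D"
    using peval_eq_imp_eq[of D' D] by simp
  moreover have "vars_in {3, 4, 5} D"
    unfolding D_def cubic_tail_def
    by (intro vars_in_add vars_in_mult vars_in_power vars_in_const vars_in_Var) simp_all
  moreover have "proj_equivalent (hypersurface f)
      (hypersurface (Var 0 * Var 4 ^ 2 + 2 * Var 1 * Var 4 * Var 5 + Var 2 * Var 5 ^ 2 + D))"
    unfolding proj_equivalent_def
  \<comment> \<open>The equivalence is \<open>B\<close> and not \<open>A\<close>, because the normal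
    form is the equation in the coordinates \<open>B *v x\<close>.\<close>
  proof (intro exI[of _ B] conjI)
    show "invertible B"
      unfolding invertible_def using AB BA by blast
    have "x \<in> (\<lambda>x. B *v x) ` hypersurface f \<longleftrightarrow> A *v x \<in> hypersurface f" for x
    proof
      show "x \<in> (\<lambda>x. B *v x) ` hypersurface f \<Longrightarrow> A *v x \<in> hypersurface f"
        by auto
      show "A *v x \<in> hypersurface f \<Longrightarrow> x \<in> (\<lambda>x. B *v x) ` hypersurface f"
        by (rule image_eqI[of _ _ "A *v x"]) simp_all
    qed
    moreover have "A *v x \<in> hypersurface f \<longleftrightarrow>
        x \<in> hypersurface (Var 0 * Var 4 ^ 2 + 2 * Var 1 * Var 4 * Var 5 + Var 2 * Var 5 ^ 2 + D)" for x
      by (simp add: hypersurface_def f_A normal_cubic_def D)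
    ultimately show "(\<lambda>x. B *v x) ` hypersurface f =
        hypersurface (Var 0 * Var 4 ^ 2 + 2 * Var 1 * Var 4 * Var 5 + Var 2 * Var 5 ^ 2 + D)"
      by (intro set_eqI) simp
  qed
  ultimately show ?thesis
    unfolding dual_variety_eq vars_in_def
    by (intro conjI exI[of _ D] special_perazzo is_conic_set[OF conic_inv_mat] tangent_scroll) simp_all
qed

end
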